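(* For every integer $k\ge1$, every integer $m\ge1$ and every partition $\rho$, the coefficients $a^k_\mu\in\mathbb Q(b)$ satisfy $$a^k_{\rho \cup (m)} = \delta_{m,1}\,a^k_{\rho}+\sum_{\substack{r,s\ge1\\ r+s=m}}a^{k-1}_{\rho \cup (r,s)}+(1+b)\sum_{i=1}^{\ell(\rho)}\rho_i\, a^{k-1}_{(\rho\setminus\rho_i) \cup (\rho_i+m)}+b(m-1)\, a^{k-1}_{\rho \cup (m)}.$$
   Context: Let $b$ be an indeterminate, $\mathbf p=(p_1,p_2,\dots)$ the power-sum symmetric functions, $p_i^*:=i\,\partial/\partial p_i$, and $D_b=\frac12\big((1+b)\sum_{i,j\ge1}p_{i+j}p_i^*p_j^*+\sum_{i,j\ge1}p_ip_jp_{i+j}^*+b\sum_{i\ge1}(i-1)p_ip_i^*\big)$. A partition $\lambda$ is identified with its set of boxes $(x,y)$, $1\le x\le\ell(\lambda)$, $1\le y\le\lambda_x$. For $\square=(x,y)\in\lambda$: $a(\square)=\lambda_x-y$, $\ell(\square)=\lambda^t_y-x$, and the $b$-content is $c_b(\square)=b(y-1)+y-x$. Put $\mathrm{hook}_b(\lambda)=\prod_{\square\in\lambda}((1+b)a(\square)+\ell(\square)+1)$. The Jack symmetric functions $J_\lambda$ (of Jack parameter $\alpha=1+b$) are the unique symmetric functions over $\mathbb Q(b)$ with $D_bJ_\lambda=\big(\sum_{\square\in\lambda}c_b(\square)\big)J_\lambda$ and $J_\lambda\in\mathrm{hook}_b(\lambda)m_\lambda+\sum_{\nu<\lambda}\mathbb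 Q(b)m_\nu$ ($m_\nu$ monomial symmetric functions, $<$ dominance order). The Jack characters are $\theta_\mu(\lambda):=[p_\mu]J_\lambda$ for $|\mu|=|\lambda|$, the coefficient of $p_\mu=\prod_ip_{\mu_i}$ in $J_\lambda$. For each $n$, the functions $(\theta_\mu(\cdot))_{\mu\vdash n}$ form a $\mathbb Q(b)$-basis of the space of functions from partitions of $n$ to $\mathbb Q(b)$ (known). Let $\mathcal C_b(\lambda)$ be the multiset $\{c_b(\square):\square\in\lambda\}$ and $h_k$ the complete homogeneous symmetric function. The coefficients $a^k_\mu\in\mathbb Q(b)$ ($k\ge0$, $\mu$ a partition) are defined by $$h_k(\mathcal C_b(\lambda))=\sum_{\mu\vdash|\lambda|}a^k_\mu\,\theta_\mu(\lambda)\qquad\text{for all partitions }\lambda.$$ $\rho\cup(m)$, $\rho\cup(r,s)$ denote the partition obtained by adding parts $m$, resp. $r$ and $s$; $\rho\setminus\rho_i$ denotes $\rho$ with one part equal to $\rho_i$ removed. *)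

theory Defs
  imports
    "HOL-Computational_Algebra.Fraction_Field"
    "HOL-Computational_Algebra.Polynomial"
    "HOL-Library.Multiset"
    "HOL-Library.Poly_Mapping"
begin

type_synonym qb = "rat poly fract"

definition b :: qb where
  "b = Fraction_Field.Fract [:0, 1:] 1"


section \<open>Partitions\<close>

text \<open>A partition is the multiset of its parts; so \<open>\<rho> \<union> (m)\<close> is \<^term>\<open>add_mset m \<rho>\<close>.\<close>

definition is_partition :: "nat multiset \<Rightarrow> bool" where
  "is_partition \<mu> \<longleftrightarrow> 0 \<notin># \<mu>"

definition partitions :: "nat \<Rightarrow> nat multiset set" where
  "partitions n = {\<mu>. is_partition \<mu> \<and> sum_mset \<mu> = n}"

text \<open>The parts \<open>\<lambda>\<^sub>1 \<ge> \<lambda>\<^sub>2 \<ge> \<dots>\<close>, numbered from 1 and continued by 0.\<close>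

definition part :: "nat multiset \<Rightarrow> nat \<Rightarrow> nat" where
  "part lam x =
     (if 1 \<le> x \<and> x \<le> size lam then rev (sorted_list_of_multiset lam) ! (x - 1) else 0)"

definition conj_part :: "nat multiset \<Rightarrow> nat \<Rightarrow> nat" where
  "conj_part lam y = card {x. 1 \<le> x \<and> x \<le> size lam \<and> y \<le> part lam x}"

definition dominance_less :: "nat multiset \<Rightarrow> nat multiset \<Rightarrow> bool" where
  "dominance_less \<nu> lam \<longleftrightarrow> \<nu> \<noteq> lam \<and> sum_mset \<nu> = sum_mset lam \<and>
     (\<forall>j. (\<Sum>x = 1..j. part \<nu> x) \<le> (\<Sum>x = 1..j. part lam x))"

definition boxes :: "nat multiset \<Rightarrow> (nat \<times> nat) set" where
  "boxes lam = {(x, y). 1 \<le> x \<and> x \<le> size lam \<and> 1 \<le> y \<and> y \<le> part lam x}"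

text \<open>The natural-number subtractions here are not truncated on boxes of \<open>lam\<close>.\<close>

definition arm :: "nat multiset \<Rightarrow> nat \<times> nat \<Rightarrow> nat" where
  "arm lam = (\<lambda>(x, y). part lam x - y)"

definition leg :: "nat multiset \<Rightarrow> nat \<times> nat \<Rightarrow> nat" where
  "leg lam = (\<lambda>(x, y). conj_part lam y - x)"

definition b_content :: "nat \<times> nat \<Rightarrow> qb" where
  "b_content = (\<lambda>(x, y). b * (of_nat y - 1) + of_nat y - of_nat x)"

definition hook_b :: "nat multiset \<Rightarrow> qb" where
  "hook_b lam = (\<Prod>s\<in>boxes lam. (1 + b) * of_nat (arm lam s) + of_nat (leg lam s) + 1)"

text \<open>
  \<open>h\<^sub>k\<close> evaluated at the finite family \<open>(c i)\<^sub>i\<^sub>\<in>\<^sub>I\<close>, i.e. at the multiset of its values: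
  each multiset \<open>M\<close> of \<open>k\<close> indices gives one monomial of degree \<open>k\<close>.
\<close>

definition complete_homogeneous :: "nat \<Rightarrow> 'i set \<Rightarrow> ('i \<Rightarrow> 'a::comm_semiring_1) \<Rightarrow> 'a" where
  "complete_homogeneous k I c = (\<Sum>M | set_mset M \<subseteq> I \<and> size M = k. \<Prod>i\<in>#M. c i)"


section \<open>Symmetric functions\<close>

text \<open>
  The ring \<open>\<rat>(b)[p\<^sub>1, p\<^sub>2, \<dots>]\<close> is the monoid algebra of the multisets of positive
  indices: the multiset \<open>\<mu>\<close> stands for \<open>p\<^sub>\<mu>\<close>, and \<open>lookup f \<mu>\<close> is the coefficient
  \<open>[p\<^sub>\<mu>] f\<close>. The type also contains polynomials in a spurious variable \<open>p\<^sub>0\<close>; the set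
  \<open>sym_functions\<close> excludes them.
\<close>

type_synonym psym = "nat multiset \<Rightarrow>\<^sub>0 qb"

definition sym_functions :: "psym set" where
  "sym_functions = {f. \<forall>\<mu>\<in>Poly_Mapping.keys f. is_partition \<mu>}"

definition p_const :: "qb \<Rightarrow> psym" where
  "p_const c = Poly_Mapping.single {#} c"

definition p_var :: "nat \<Rightarrow> psym" where
  "p_var i = Poly_Mapping.single {#i#} 1"

text \<open>\<open>p\<^sub>i\<^sup>* = i \<partial>/\<partial>p\<^sub>i\<close>\<close>

definition p_star :: "nat \<Rightarrow> psym \<Rightarrow> psym" where
  "p_star i f = (\<Sum>\<mu>\<in>Poly_Mapping.keys f.
     Poly_Mapping.single (\<mu> - {#i#}) (of_nat i * of_nat (count \<mu> i) * Poly_Mapping.lookup f \<mu>))"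

text \<open>
  Applied to a fixed \<open>f\<close>, all but finitely many summands of each of the three sums vanish,
  so that \<^const>\<open>Sum_any\<close> is the intended sum.
\<close>

definition D_b :: "psym \<Rightarrow> psym" where
  "D_b f = p_const (1 / 2) *
     (p_const (1 + b) *
        Sum_any (\<lambda>(i, j). if 1 \<le> i \<and> 1 \<le> j
          then p_var (i + j) * p_star i (p_star j f) else 0)
      + Sum_any (\<lambda>(i, j). if 1 \<le> i \<and> 1 \<le> j
          then p_var i * p_var j * p_star (i + j) f else 0)
      + p_const b *
        Sum_any (\<lambda>i. if 1 \<le> i
          then of_nat (i - 1) * p_var i * p_star i f else 0))"

text \<open>
  Polynomials in \<open>x\<^sub>0, x\<^sub>1, \<dots>\<close>: an exponent vector is a finitely supported function
  \<open>nat \<Rightarrow>\<^sub>0 nat\<close>. The substitution \<open>p\<^sub>i \<mapsto> x\<^sub>0\<^sup>i + \<dots> + x\<^bsub>N-1\<^esub>\<^sup>i\<close> sends a symmetric function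
  to its symmetric polynomial in \<open>N\<close> variables, and a symmetric function is determined by
  these polynomials for all \<open>N\<close>.
\<close>

type_synonym xpoly = "(nat \<Rightarrow>\<^sub>0 nat) \<Rightarrow>\<^sub>0 qb"

definition x_const :: "qb \<Rightarrow> xpoly" where
  "x_const c = Poly_Mapping.single 0 c"

definition x_var :: "nat \<Rightarrow> xpoly" where
  "x_var i = Poly_Mapping.single (Poly_Mapping.single i 1) 1"

definition restrict_vars :: "nat \<Rightarrow> psym \<Rightarrow> xpoly" where
  "restrict_vars N f = (\<Sum>\<mu>\<in>Poly_Mapping.keys f.
     x_const (Poly_Mapping.lookup f \<mu>) * (\<Prod>r\<in>#\<mu>. \<Sum>i<N. x_var i ^ r))"

text \<open>
  The monomial symmetric polynomial \<open>m\<^sub>\<nu>(x\<^sub>0, \<dots>, x\<^bsub>N-1\<^esub>)\<close>: the sum of all distinct monomials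
  whose multiset of nonzero exponents is \<open>\<nu>\<close>.
\<close>

definition monomial_sym :: "nat \<Rightarrow> nat multiset \<Rightarrow> xpoly" where
  "monomial_sym N \<nu> =
     (\<Sum>e | Poly_Mapping.keys e \<subseteq> {..<N} \<and>
           image_mset (Poly_Mapping.lookup e) (mset_set (Poly_Mapping.keys e)) = \<nu>.
        Poly_Mapping.single e 1)"


section \<open>Jack symmetric functions and Jack characters\<close>

text \<open>
  The coefficients \<open>u \<nu>\<close> do not depend on the number \<open>N\<close> of variables, so the last
  condition is the expansion in monomial symmetric functions.
\<close>

definition is_jack :: "nat multiset \<Rightarrow> psym \<Rightarrow> bool" where
  "is_jack lam f \<longleftrightarrow>
     f \<in> sym_functions \<and>
     D_b f = p_const (\<Sum>s\<in>boxes lam. b_content s) * f \<and>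
     (\<exists>u. \<forall>N. restrict_vars N f =
        x_const (hook_b lam) * monomial_sym N lam
        + (\<Sum>\<nu> | is_partition \<nu> \<and> dominance_less \<nu> lam. x_const (u \<nu>) * monomial_sym N \<nu>))"

definition jack_character ::
    "(nat multiset \<Rightarrow> psym) \<Rightarrow> nat multiset \<Rightarrow> nat multiset \<Rightarrow> qb" where
  "jack_character J \<mu> lam = Poly_Mapping.lookup (J lam) \<mu>"

text \<open>The defining property of the coefficients \<open>a\<^sup>k\<^sub>\<mu>\<close>, relative to the Jack functions \<open>J\<close>.\<close>

definition h_coefficients ::
    "(nat multiset \<Rightarrow> psym) \<Rightarrow> (nat \<Rightarrow> nat multiset \<Rightarrow> qb) \<Rightarrow> bool" where
  "h_coefficients J a \<longleftrightarrow>
     (\<forall>k lam. is_partition lam \<longrightarrow>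
        complete_homogeneous k (boxes lam) b_content =
        (\<Sum>\<mu>\<in>partitions (sum_mset lam). a k \<mu> * jack_character J \<mu> lam))"

end

theory Submission
  imports
    Defs
    "HOL-Combinatorics.Permutations"
    "HOL-Computational_Algebra.Polynomial_FPS"
begin

text \<open>
  Write \<open>\<alpha> = 1 + b\<close> and let the Lax operator \<open>L\<close> of Nazarov and Sklyanin act on
  \<open>\<Lambda>[y\<^sub>1, y\<^sub>2, \<dots>]\<close>, linear in the \<open>y\<^sub>m\<close>, by
  \<open>L (y\<^sub>m f) = \<Sum>\<^bsub>r+s=m\<^esub> p\<^sub>r y\<^sub>s f + \<alpha> \<Sum>\<^sub>j y\<^bsub>m+j\<^esub> p\<^sub>j\<^sup>* f + b (m - 1) y\<^sub>m f\<close>.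
  With \<open>\<Theta> y\<^sub>m = p\<^sub>m\<close>, \<open>\<nabla> f = \<Sum>\<^sub>m y\<^sub>m p\<^sub>m\<^sup>* f\<close> and \<open>\<epsilon>\<close> the coefficient of \<open>y\<^sub>1\<close>, the
  claim for the linear form \<open>a\<^sup>k : p\<^sub>\<mu> \<mapsto> a\<^sup>k\<^sub>\<mu>\<close> says \<open>a\<^sup>k \<Theta> = a\<^sup>k \<epsilon> + a\<^bsup>k-1\<^esup> \<Theta> L\<close>, that is,
  \<open>a\<^sup>k \<Theta> = \<Sum>\<^sub>i a\<^bsup>k-i\<^esup> \<epsilon> L\<^sup>i\<close>.

  The operators \<open>T\<^sub>k = \<Theta> L\<^sup>k \<nabla>\<close> commute with \<open>2 D\<^sub>b = T\<^sub>1\<close> and are triangular on monomials, so the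
  Jack functions are eigenvectors of all \<open>T\<^sub>k\<close>; the eigenvalues are read off from the action of \<open>L\<close>
  as a Dunkl operator in the variables \<open>x\<close>, and they determine the multiset of contents.
  The operators \<open>\<epsilon> L\<^sup>k \<nabla>\<close> are the iterated commutators of \<open>p\<^sub>1\<^sup>*\<close> with \<open>D\<^sub>b\<close>. Commuting \<open>p\<^sub>1\<^sup>*\<close> past
  \<open>T\<^sub>k\<close> shows that \<open>p\<^sub>1\<^sup>* J\<^sub>\<lambda>\<close> contains only those \<open>J\<^sub>\<nu>\<close> whose contents are the contents of \<open>\<lambda>\<close> less
  one, \<open>c\<close>, and that \<open>\<epsilon> L\<^sup>k \<nabla>\<close> acts on this term with the factor \<open>c\<^sup>k\<close>. Since
  \<open>h\<^sub>k(C \<union> {c}) = \<Sum>\<^sub>i c\<^sup>i h\<^bsub>k-i\<^esub>(C)\<close>, and since \<open>[p\<^sub>1\<^sup>n] J\<^sub>\<lambda> = 1\<close>, both sides of the second form of the claim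
  agree on all \<open>L\<^sup>j \<nabla> J\<^sub>\<lambda>\<close>, and these vectors span.

  The normalisation \<open>[p\<^sub>1\<^sup>n] J\<^sub>\<lambda> = 1\<close> follows by comparing the specialisation \<open>p\<^sub>i = \<ell>(\<lambda>)\<close> of \<open>J\<^sub>\<lambda>\<close>, which is
  \<open>[p\<^sub>1\<^sup>n] J\<^sub>\<lambda> \<cdot> \<Prod>\<^sub>c (\<ell>(\<lambda>) + c)\<close>, with that of the Jack function of \<open>\<lambda>\<close> without its first column: in
  \<open>\<ell>(\<lambda>)\<close> variables the two differ by \<open>x\<^sub>1 \<cdots> x\<^sub>\<ell>\<close> and the ratio of the hook products.
\<close>

text \<open>All that is known of J_\<lambda> is its eigenvalue under D_b and its triangular
  expansion, and this shapes the proof twice. The eigenvalue does not separate partitions: (3,3) and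
  (4,1,1) both have content sum 6b + 3. Uniqueness of eigenvectors therefore combines it with the
  dominance order: the coefficient of b in the eigenvalue of 2 D_b is the sum of x(x-1) over the
  parts x, and two comparable partitions with the same such sum coincide. Moreover, it is unknown at
  the start which J_\<nu> occur in p_1^* J_\<lambda>. What is established about them is an equation
  between the multisets of contents, and it has to be extracted from the eigenvalues of all T_k
  together, hence the generating series. As h_k depends on the contents alone, this equation is
  enough for the recursion.\<close>

instance fract :: ("{idom,ring_char_0}") field_char_0
proof
  show "inj (of_nat :: nat \<Rightarrow> 'a fract)"
  proof (rule injI)
    fix m n :: nat
    assume "of_nat m = (of_nat n :: 'a fract)"
    then have "Fraction_Field.Fract (of_nat m :: 'a) 1 = Fraction_Field.Fract (of_nat n) 1"
      by (simp only: Fraction_Field.Fract_of_nat_eq)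
    then show "m = n" by (simp add: eq_fract)
  qed
qed

section \<open>Weighted sums over the parts of a partition\<close>

text \<open>Since p_j^* p_\<mu> is p_{\<mu> - j} times j times the multiplicity of j, this is the
  value at p_\<mu> of the transpose of the family of all p_j^* at once.\<close>

definition psum :: "(nat \<Rightarrow> nat multiset \<Rightarrow> 'a::comm_semiring_1) \<Rightarrow> nat multiset \<Rightarrow> 'a" where
  "psum F \<mu> = (\<Sum>j\<in>#\<mu>. of_nat j * F j (\<mu> - {#j#}))"

lemma psum_empty [simp]: "psum F {#} = 0"
  by (simp add: psum_def)

lemma psum_add_mset:
  "psum F (add_mset r \<mu>) = of_nat r * F r \<mu> + psum (\<lambda>j \<nu>. F j (add_mset r \<nu>)) \<mu>"
proof -
  have "image_mset (\<lambda>j. of_nat j * F j (add_mset r \<mu> - {#j#})) \<mu> =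
        image_mset (\<lambda>j. of_nat j * F j (add_mset r (\<mu> - {#j#}))) \<mu>"
    by (rule image_mset_cong) simp
  then show ?thesis by (simp add: psum_def)
qed

lemma psum_cong:
  assumes "\<And>j \<nu>. \<mu> = add_mset j \<nu> \<Longrightarrow> F j \<nu> = G j \<nu>"
  shows "psum F \<mu> = psum G \<mu>"
  unfolding psum_def by (intro arg_cong[of _ _ sum_mset] image_mset_cong) (simp add: assms)

lemma psum_cong_pos:
  assumes "\<And>j \<nu>. \<mu> = add_mset j \<nu> \<Longrightarrow> 0 < j \<Longrightarrow> F j \<nu> = G j \<nu>"
  shows "psum F \<mu> = psum G \<mu>"
proof -
  have "of_nat j * F j (\<mu> - {#j#}) = of_nat j * G j (\<mu> - {#j#})" if "j \<in># \<mu>" for j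
    using that assms[of j "\<mu> - {#j#}"] by (cases "j = 0") auto
  then show ?thesis
    unfolding psum_def by (intro arg_cong[of _ _ sum_mset] image_mset_cong) simp
qed

lemma psum_add: "psum (\<lambda>j \<nu>. F j \<nu> + G j \<nu>) = (\<lambda>\<mu>. psum F \<mu> + psum G \<mu>)"
  by (rule ext) (simp add: psum_def distrib_left sum_mset.distrib)

lemma psum_cmult: "psum (\<lambda>j \<nu>. c * F j \<nu>) = (\<lambda>\<mu>. c * psum F \<mu>)"
  by (rule ext) (simp add: psum_def sum_mset_distrib_left mult.left_commute)

lemma psum_zero [simp]: "psum (\<lambda>j \<nu>. 0) = (\<lambda>\<mu>. 0)"
  by (rule ext) (simp add: psum_def)

lemma psum_sum: "psum (\<lambda>j \<nu>. \<Sum>i\<in>A. F i j \<nu>) = (\<lambda>\<mu>. \<Sum>i\<in>A. psum (F i) \<mu>)"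
  by (induction A rule: infinite_finite_induct) (simp_all add: psum_add)

text \<open>The operators p_i^* and p_j^* commute. The symmetrisations in two removed parts rest on
  this.\<close>

lemma psum_swap: "psum (\<lambda>i. psum (F i)) \<mu> = psum (\<lambda>i. psum (\<lambda>j. F j i)) \<mu>"
proof (induction \<mu> arbitrary: F)
  case (add r \<mu>)
  show ?case
    by (simp add: psum_add_mset psum_add psum_cmult add.IH[of "\<lambda>i j \<nu>. F i j (add_mset r \<nu>)"] ac_simps)
qed simp

lemma psum_const: "psum (\<lambda>j \<nu>. c) \<mu> = of_nat (sum_mset \<mu>) * c"
  by (induction \<mu>) (simp_all add: psum_add_mset algebra_simps)

section \<open>The Lax operator\<close>

text \<open>
  All operators are transposed: they act on linear forms, which are arbitrary functions on the
  basis \<open>p\<^sub>\<mu>\<close>, so that every sum is finite. The index \<open>m\<close> of a form on \<open>\<Lambda>[y]\<close> stands for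
  \<open>y\<^bsub>m+1\<^esub>\<close>. The truncated \<open>j - 1\<close> at \<open>j = 0\<close> is harmless because \<^const>\<open>psum\<close> weights it by 0.
\<close>

type_synonym fnl = "nat multiset \<Rightarrow> qb"
type_synonym yfnl = "nat \<Rightarrow> nat multiset \<Rightarrow> qb"

abbreviation (input) \<alpha> :: qb where "\<alpha> \<equiv> 1 + b"

definition Theta :: "fnl \<Rightarrow> yfnl" where
  "Theta \<phi> m \<mu> = \<phi> (add_mset (Suc m) \<mu>)"

definition Nabla :: "yfnl \<Rightarrow> fnl" where
  "Nabla \<psi> \<mu> = psum (\<lambda>j. \<psi> (j - 1)) \<mu>"

definition Eps :: "fnl \<Rightarrow> yfnl" where
  "Eps \<phi> m \<mu> = (if m = 0 then \<phi> \<mu> else 0)"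

text \<open>Transpose of y_{m+1} \<mapsto> y_m, y_1 \<mapsto> 0. It is the commutator of p_1^* with
  L: only the term p_1 y_m of L y_{m+1} contains p_1 explicitly.\<close>

definition Shift :: "yfnl \<Rightarrow> yfnl" where
  "Shift \<psi> m \<mu> = (if m = 0 then 0 else \<psi> (m - 1) \<mu>)"

definition splitting :: "yfnl \<Rightarrow> yfnl" where
  "splitting \<psi> m \<mu> = (\<Sum>s<m. \<psi> s (add_mset (m - s) \<mu>))"

definition joining :: "yfnl \<Rightarrow> yfnl" where
  "joining \<psi> m \<mu> = psum (\<lambda>j. \<psi> (m + j)) \<mu>"

definition Lax :: "yfnl \<Rightarrow> yfnl" where
  "Lax \<psi> m \<mu> = splitting \<psi> m \<mu> + \<alpha> * joining \<psi> m \<mu> + b * of_nat m * \<psi> m \<mu>"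

definition Tk :: "nat \<Rightarrow> fnl \<Rightarrow> fnl" where
  "Tk k \<phi> = Nabla ((Lax ^^ k) (Theta \<phi>))"

definition Rk :: "nat \<Rightarrow> fnl \<Rightarrow> fnl" where
  "Rk k \<phi> = Nabla ((Lax ^^ k) (Eps \<phi>))"

text \<open>The transposes of the three sums of 2 D_b, kept apart so that later identities can be
  compared coefficient by coefficient in \<alpha> and b.\<close>

definition Djoin :: "fnl \<Rightarrow> fnl" where
  "Djoin \<phi> \<mu> = psum (\<lambda>i. psum (\<lambda>j \<nu>. \<phi> (add_mset (i + j) \<nu>))) \<mu>"

definition Dsplit :: "fnl \<Rightarrow> fnl" where
  "Dsplit \<phi> \<mu> = psum (\<lambda>j \<nu>. \<Sum>s<j-1. \<phi> (add_mset (Suc s) (add_mset (j - 1 - s) \<nu>))) \<mu>"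

definition Ddiag :: "fnl \<Rightarrow> fnl" where
  "Ddiag \<phi> \<mu> = psum (\<lambda>j \<nu>. of_nat (j - 1)) \<mu> * \<phi> \<mu>"

lemma T1_eq: "Tk 1 \<phi> \<mu> = \<alpha> * Djoin \<phi> \<mu> + Dsplit \<phi> \<mu> + b * Ddiag \<phi> \<mu>"
proof -
  have "Tk 1 \<phi> \<mu> = psum (\<lambda>j \<nu>. (\<Sum>s<j-1. \<phi> (add_mset (Suc s) (add_mset (j - 1 - s) \<nu>)))
      + \<alpha> * psum (\<lambda>i \<kappa>. \<phi> (add_mset (j + i) \<kappa>)) \<nu> + b * (\<phi> \<mu> * of_nat (j - 1))) \<mu>"
    unfolding Tk_def Nabla_def
    by (intro psum_cong_pos) (auto simp: Lax_def Theta_def splitting_def joining_def intro!: psum_cong)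
  also have "\<dots> = \<alpha> * Djoin \<phi> \<mu> + Dsplit \<phi> \<mu> + b * Ddiag \<phi> \<mu>"
    by (simp only: psum_add psum_cmult Djoin_def Dsplit_def Ddiag_def) (simp add: algebra_simps)
  finally show ?thesis .
qed

lemma Djoin_add_mset:
  "Djoin \<phi> (add_mset r \<mu>) = Djoin (\<lambda>\<nu>. \<phi> (add_mset r \<nu>)) \<mu>
     + 2 * of_nat r * psum (\<lambda>j \<nu>. \<phi> (add_mset (r + j) \<nu>)) \<mu>"
  by (simp add: Djoin_def psum_add_mset psum_add psum_cmult add_mset_commute[of r] add.commute[of _ r])

lemma Dsplit_add_mset:
  "Dsplit \<phi> (add_mset r \<mu>) = Dsplit (\<lambda>\<nu>. \<phi> (add_mset r \<nu>)) \<mu>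
     + of_nat r * (\<Sum>s<r-1. \<phi> (add_mset (Suc s) (add_mset (r - 1 - s) \<mu>)))"
  by (simp add: Dsplit_def psum_add_mset add_mset_commute[of r] add.commute)

lemma Ddiag_add_mset:
  "Ddiag \<phi> (add_mset r \<mu>) = Ddiag (\<lambda>\<nu>. \<phi> (add_mset r \<nu>)) \<mu>
     + of_nat r * of_nat (r - 1) * \<phi> (add_mset r \<mu>)"
  by (simp add: Ddiag_def psum_add_mset algebra_simps)

section \<open>The lift of 2 D_b to \<Lambda>[y] and its commutation with L\<close>

definition yweight :: "yfnl \<Rightarrow> yfnl" where
  "yweight \<psi> m \<mu> = of_nat m * \<psi> m \<mu>"

text \<open>The diagonal part of 2 D_b gives p_{m+1} the weight (m+1)m; taking off the 2m that
  belongs to 2 L leaves m(m-1).\<close>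

definition ysq :: "yfnl \<Rightarrow> yfnl" where
  "ysq \<psi> m \<mu> = of_nat m * (of_nat m - 1) * \<psi> m \<mu>"

definition Djoin_ext :: "yfnl \<Rightarrow> yfnl" where
  "Djoin_ext \<psi> m \<mu> = Djoin (\<psi> m) \<mu> + 2 * of_nat m * joining \<psi> m \<mu>"

definition Dsplit_ext :: "yfnl \<Rightarrow> yfnl" where
  "Dsplit_ext \<psi> m \<mu> = Dsplit (\<psi> m) \<mu> + 2 * splitting (yweight \<psi>) m \<mu>"

definition Ddiag_ext :: "yfnl \<Rightarrow> yfnl" where
  "Ddiag_ext \<psi> m \<mu> = Ddiag (\<psi> m) \<mu> + ysq \<psi> m \<mu>"

text \<open>The lift of \<open>2 D\<^sub>b\<close> to \<open>\<Lambda>[y]\<close>, reduced by \<open>2 L\<close>; it commutes with \<open>L\<close>.\<close>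

definition Dext :: "yfnl \<Rightarrow> yfnl" where
  "Dext \<psi> m \<mu> = \<alpha> * Djoin_ext \<psi> m \<mu> + Dsplit_ext \<psi> m \<mu> + b * Ddiag_ext \<psi> m \<mu>"

text \<open>The part removed by \<open>psum F\<close> is either the newly joined i + j or a part not
  touched by the joining.\<close>

lemma Djoin_psum: "Djoin (psum F) \<mu> =
   psum (\<lambda>i. psum (\<lambda>j \<nu>. of_nat (i + j) * F (i + j) \<nu>)) \<mu> + psum (\<lambda>k. Djoin (F k)) \<mu>"
proof -
  have "Djoin (psum F) \<mu> = psum (\<lambda>i. psum (\<lambda>j \<nu>. of_nat (i + j) * F (i + j) \<nu>)) \<mu>
     + psum (\<lambda>i. psum (\<lambda>j. psum (\<lambda>k \<nu>. F k (add_mset (i + j) \<nu>)))) \<mu>"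
    by (simp add: Djoin_def psum_add_mset psum_add)
  also have "psum (\<lambda>i. psum (\<lambda>j. psum (\<lambda>k \<nu>. F k (add_mset (i + j) \<nu>)))) \<mu>
     = psum (\<lambda>i. psum (\<lambda>k. psum (\<lambda>j \<nu>. F k (add_mset (i + j) \<nu>)))) \<mu>"
    by (intro psum_cong psum_swap)
  also have "\<dots> = psum (\<lambda>k. Djoin (F k)) \<mu>"
    by (subst psum_swap) (simp add: Djoin_def[abs_def])
  finally show ?thesis .
qed

text \<open>The part removed by \<open>psum F\<close> is one of the two pieces of the split part,
  which contribute equally by reflection, or an untouched part.\<close>

lemma Dsplit_psum: "Dsplit (psum F) \<mu> =
   psum (\<lambda>j \<nu>. 2 * (\<Sum>s<j-1. of_nat (Suc s) * F (Suc s) (add_mset (j - 1 - s) \<nu>))) \<mu>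
   + psum (\<lambda>k. Dsplit (F k)) \<mu>"
proof -
  let ?B = "\<lambda>j s \<nu>. of_nat (Suc s) * F (Suc s) (add_mset (j - 1 - s) \<nu>)"
  let ?R = "\<lambda>j s \<nu>. of_nat (j - 1 - s) * F (j - 1 - s) (add_mset (Suc s) \<nu>)"
  let ?D = "\<lambda>j k \<nu>. \<Sum>s<j-1. F k (add_mset (Suc s) (add_mset (j - 1 - s) \<nu>))"
  have reflect: "(\<Sum>s<j-1. ?R j s \<nu>) = (\<Sum>s<j-1. ?B j s \<nu>)" for j :: nat and \<nu>
  proof (subst sum.nat_diff_reindex[symmetric], rule sum.cong[OF refl])
    fix s assume "s \<in> {..<j-1}"
    then have "Suc s = j - 1 - (j - 1 - Suc s)" "Suc (j - 1 - Suc s) = j - 1 - s" by auto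
    then show "?R j (j - 1 - Suc s) \<nu> = ?B j s \<nu>" by (simp only:)
  qed
  have "Dsplit (psum F) \<mu> =
      psum (\<lambda>j \<nu>. (\<Sum>s<j-1. ?B j s \<nu>) + (\<Sum>s<j-1. ?R j s \<nu>) + psum (?D j) \<nu>) \<mu>"
    by (simp add: Dsplit_def psum_add_mset sum.distrib psum_sum add.assoc)
  also have "\<dots> = psum (\<lambda>j \<nu>. 2 * (\<Sum>s<j-1. ?B j s \<nu>)) \<mu> + psum (\<lambda>j. psum (?D j)) \<mu>"
    by (simp only: reflect psum_add mult_2)
  also have "psum (\<lambda>j. psum (?D j)) \<mu> = psum (\<lambda>k. Dsplit (F k)) \<mu>"
    by (subst psum_swap) (simp add: Dsplit_def[abs_def])
  finally show ?thesis .
qed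

text \<open>Both sides let two parts i and j join y; the weights 2(m + i) and 2m + i + j agree after
  symmetrising in i and j.\<close>

lemma joining_Djoin_ext: "Djoin_ext (joining \<psi>) m \<mu> = joining (Djoin_ext \<psi>) m \<mu>"
proof -
  let ?F = "\<lambda>i j. \<psi> (m + i + j)"
  have *: "psum (\<lambda>i. psum (\<lambda>j \<nu>. of_nat i * ?F i j \<nu>)) \<mu> = psum (\<lambda>i. psum (\<lambda>j \<nu>. of_nat j * ?F i j \<nu>)) \<mu>"
    by (subst psum_swap) (simp add: add.commute add.left_commute)
  have 1: "Djoin_ext (joining \<psi>) m \<mu> = psum (\<lambda>i. psum (\<lambda>j \<nu>. of_nat (i + j) * ?F i j \<nu>)) \<mu>
     + psum (\<lambda>k. Djoin (\<psi> (m + k))) \<mu> + 2 * of_nat m * psum (\<lambda>i. psum (\<lambda>j. ?F i j)) \<mu>"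
    unfolding Djoin_ext_def joining_def[abs_def] by (subst Djoin_psum) (simp add: add.assoc)
  have 2: "joining (Djoin_ext \<psi>) m \<mu> = psum (\<lambda>k. Djoin (\<psi> (m + k))) \<mu>
     + psum (\<lambda>i. psum (\<lambda>j \<nu>. 2 * of_nat (m + i) * ?F i j \<nu>)) \<mu>"
    unfolding joining_def Djoin_ext_def by (simp add: psum_add psum_cmult)
  show ?thesis
    unfolding 1 2 using *
    by (simp add: distrib_right distrib_left psum_add psum_cmult mult.assoc)
qed


text \<open>Under the reflection t \<mapsto> n - 1 - t the weights t + 1 and n - t are exchanged,
  and their sum is n + 1.\<close>

lemma sum_reflect_symmetric:
  fixes H :: "nat \<Rightarrow> 'a::comm_ring_1"
  assumes "\<And>t. t < n \<Longrightarrow> H (n - Suc t) = H t"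
  shows "(\<Sum>t<n. 2 * of_nat (Suc t) * H t) = of_nat (Suc n) * (\<Sum>t<n. H t)"
proof -
  have "(\<Sum>t<n. of_nat (Suc t) * H t) = (\<Sum>t<n. of_nat (n - t) * H t)"
    by (subst sum.nat_diff_reindex[symmetric]) (auto intro!: sum.cong simp: assms Suc_diff_Suc)
  then have "(\<Sum>t<n. 2 * of_nat (Suc t) * H t)
      = (\<Sum>t<n. of_nat (Suc t) * H t) + (\<Sum>t<n. of_nat (n - t) * H t)"
    by (simp only: mult_2 distrib_right sum.distrib)
  also have "\<dots> = (\<Sum>t<n. of_nat (Suc n) * H t)"
    by (auto simp: sum.distrib[symmetric] of_nat_diff algebra_simps intro!: sum.cong)
  finally show ?thesis by (simp add: sum_distrib_left)
qed

lemma sum_lessThan_add: "(\<Sum>s<m + n. f s) = (\<Sum>s<m. f s) + (\<Sum>t<n::nat. f (m + t) :: 'a::comm_monoid_add)"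
  by (induction n) (simp_all add: add.assoc)

lemma sum_triangle_shift:
  "(\<Sum>s<m. \<Sum>s'<s. F s s') = (\<Sum>s'<m. \<Sum>t<m - s' - 1. F (s' + Suc t) s')"
proof (induction m)
  case (Suc m)
  have "(\<Sum>s'<m. \<Sum>t<Suc m - s' - 1. F (s' + Suc t) s')
      = (\<Sum>s'<m. (\<Sum>t<m - s' - 1. F (s' + Suc t) s') + F m s')"
  proof (rule sum.cong[OF refl])
    fix s' assume "s' \<in> {..<m}"
    then have "Suc m - s' - 1 = Suc (m - s' - 1)" "s' + Suc (m - s' - 1) = m" by auto
    then show "(\<Sum>t<Suc m - s' - 1. F (s' + Suc t) s') = (\<Sum>t<m - s' - 1. F (s' + Suc t) s') + F m s'"
      by (simp only: sum.lessThan_Suc)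
  qed
  with Suc show ?case by (simp add: sum.distrib)
qed simp

lemma splitting_joining_ext:
  "Djoin_ext (splitting \<psi>) m \<mu> + Dsplit_ext (joining \<psi>) m \<mu> =
   splitting (Djoin_ext \<psi>) m \<mu> + joining (Dsplit_ext \<psi>) m \<mu>"
proof -
  let ?A = "\<lambda>j s \<nu>. \<psi> s (add_mset (m + j - s) \<nu>)"
  have 1: "splitting (Djoin_ext \<psi>) m \<mu> = Djoin (splitting \<psi> m) \<mu>
      + psum (\<lambda>j \<nu>. \<Sum>s<m. 2 * of_nat (m - s) * ?A j s \<nu>) \<mu>
      + 2 * splitting (\<lambda>s \<mu>. of_nat s * joining \<psi> s \<mu>) m \<mu>"
  proof -
    have "Djoin (splitting \<psi> m) \<mu> = (\<Sum>s<m. Djoin (\<lambda>\<nu>. \<psi> s (add_mset (m - s) \<nu>)) \<mu>)"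
      by (simp add: Djoin_def splitting_def psum_sum add_mset_commute)
    moreover have "add_mset (m - s + j) \<nu> = add_mset (m + j - s) \<nu>" if "s < m" for s j :: nat and \<nu>
      using that by simp
    ultimately show ?thesis
      by (simp add: splitting_def Djoin_ext_def Djoin_add_mset sum.distrib psum_sum psum_cmult
          sum_distrib_left mult.assoc)
  qed
  have 2: "Djoin_ext (splitting \<psi>) m \<mu> = Djoin (splitting \<psi> m) \<mu>
      + psum (\<lambda>j \<nu>. \<Sum>s<m+j. 2 * of_nat m * ?A j s \<nu>) \<mu>"
    by (simp add: Djoin_ext_def joining_def splitting_def[abs_def] psum_cmult sum_distrib_left[symmetric])
  have 3: "Dsplit_ext (joining \<psi>) m \<mu> = joining (\<lambda>m. Dsplit (\<psi> m)) m \<mu>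
      + psum (\<lambda>j \<nu>. \<Sum>t<j-1. 2 * of_nat (Suc t) * \<psi> (m + Suc t) (add_mset (j - 1 - t) \<nu>)) \<mu>
      + 2 * splitting (\<lambda>s \<mu>. of_nat s * joining \<psi> s \<mu>) m \<mu>"
  proof -
    have "Dsplit (joining \<psi> m) = Dsplit (psum (\<lambda>j. \<psi> (m + j)))" by (simp add: joining_def[abs_def])
    then show ?thesis
      unfolding Dsplit_ext_def yweight_def[abs_def]
      by (simp only: Dsplit_psum sum_distrib_left mult.assoc joining_def add.commute)
  qed
  have 4: "joining (Dsplit_ext \<psi>) m \<mu> = joining (\<lambda>m. Dsplit (\<psi> m)) m \<mu>
      + psum (\<lambda>j \<nu>. \<Sum>s<m+j. 2 * of_nat s * ?A j s \<nu>) \<mu>"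
    by (simp add: joining_def Dsplit_ext_def[abs_def] psum_add splitting_def yweight_def sum_distrib_left mult.assoc)
  \<comment> \<open>Compare the coefficients of \<open>?A j s\<close>: for s < m one has m = (m - s)
    + s, for s = m both are m, and for s = m + t + 1 the second sum supplies the missing t +
    1.\<close>
  have 5: "(\<Sum>s<m+j. 2 * of_nat m * ?A j s \<nu>)
      + (\<Sum>t<j-1. 2 * of_nat (Suc t) * \<psi> (m + Suc t) (add_mset (j - 1 - t) \<nu>))
      = (\<Sum>s<m. 2 * of_nat (m - s) * ?A j s \<nu>) + (\<Sum>s<m+j. 2 * of_nat s * ?A j s \<nu>)" for j \<nu>
  proof (cases j)
    case 0
    then show ?thesis
      by (auto simp: sum.distrib[symmetric] of_nat_diff algebra_simps intro!: sum.cong)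
  next
    case (Suc j')
    have split: "(\<Sum>s<m+j. f s) = (\<Sum>s<m. f s) + f m + (\<Sum>t<j'. f (m + Suc t))" for f :: "nat \<Rightarrow> qb"
      unfolding Suc sum_lessThan_add by (simp only: sum.lessThan_Suc_shift add_0_right add.assoc)
    show ?thesis
      unfolding split using Suc
      by (simp add: sum.distrib[symmetric] of_nat_diff algebra_simps)
  qed
  have 6: "psum (\<lambda>j \<nu>. \<Sum>s<m+j. 2 * of_nat m * ?A j s \<nu>) \<mu>
      + psum (\<lambda>j \<nu>. \<Sum>t<j-1. 2 * of_nat (Suc t) * \<psi> (m + Suc t) (add_mset (j - 1 - t) \<nu>)) \<mu>
      = psum (\<lambda>j \<nu>. \<Sum>s<m. 2 * of_nat (m - s) * ?A j s \<nu>) \<mu>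
      + psum (\<lambda>j \<nu>. \<Sum>s<m+j. 2 * of_nat s * ?A j s \<nu>) \<mu>"
    using arg_cong[where f="\<lambda>F. psum F \<mu>", OF ext[OF ext[OF 5]]] by (simp only: psum_add)
  show ?thesis unfolding 1 2 3 4 using 6 by algebra
qed

text \<open>Splitting y twice leaves two power sums of degrees s - s' and m - s that may be
  exchanged. The excess weight 2(s - s') thus averages to m - s', which is the weight of
  \<open>Dsplit\<close> on the part m - s'.\<close>

lemma splitting_Dsplit_ext: "Dsplit_ext (splitting \<psi>) m \<mu> = splitting (Dsplit_ext \<psi>) m \<mu>"
proof -
  define G where "G s r r' = \<psi> s (add_mset r (add_mset r' \<mu>))" for s r r'
  have G_sym: "G s r r' = G s r' r" for s r r'
    by (simp add: G_def add_mset_commute)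
  have 1: "splitting (Dsplit_ext \<psi>) m \<mu> = Dsplit (splitting \<psi> m) \<mu>
      + (\<Sum>s<m. of_nat (m - s) * (\<Sum>t<m - s - 1. G s (Suc t) (m - s - 1 - t)))
      + (\<Sum>s<m. \<Sum>s'<s. 2 * of_nat s' * G s' (s - s') (m - s))"
  proof -
    have "Dsplit (splitting \<psi> m) \<mu> = (\<Sum>s<m. Dsplit (\<lambda>\<nu>. \<psi> s (add_mset (m - s) \<nu>)) \<mu>)"
      unfolding Dsplit_def splitting_def
      by (simp add: sum.swap[of _ "{..<m}"] psum_sum add_mset_commute[of "m - _"])
    then show ?thesis
      by (simp add: splitting_def Dsplit_ext_def Dsplit_add_mset sum.distrib yweight_def G_def
          sum_distrib_left mult.assoc)
  qed
  have 2: "Dsplit_ext (splitting \<psi>) m \<mu> = Dsplit (splitting \<psi> m) \<mu>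
      + (\<Sum>s<m. \<Sum>s'<s. 2 * of_nat s * G s' (s - s') (m - s))"
    by (simp add: Dsplit_ext_def splitting_def yweight_def G_def sum_distrib_left mult.assoc)
  have "(\<Sum>s<m. \<Sum>s'<s. 2 * of_nat s * G s' (s - s') (m - s))
      - (\<Sum>s<m. \<Sum>s'<s. 2 * of_nat s' * G s' (s - s') (m - s))
      = (\<Sum>s<m. \<Sum>s'<s. 2 * of_nat (s - s') * G s' (s - s') (m - s))"
    by (auto simp: sum_subtractf[symmetric] of_nat_diff algebra_simps intro!: sum.cong)
  also have "\<dots> = (\<Sum>s<m. \<Sum>t<m - s - 1. 2 * of_nat (Suc t) * G s (Suc t) (m - s - 1 - t))"
    by (subst sum_triangle_shift) simp
  also have "\<dots> = (\<Sum>s<m. of_nat (m - s) * (\<Sum>t<m - s - 1. G s (Suc t) (m - s - 1 - t)))"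
  proof (rule sum.cong[OF refl])
    fix s assume "s \<in> {..<m}"
    then have "of_nat (m - s) = (of_nat (Suc (m - s - 1)) :: qb)" by simp
    then show "(\<Sum>t<m - s - 1. 2 * of_nat (Suc t) * G s (Suc t) (m - s - 1 - t))
        = of_nat (m - s) * (\<Sum>t<m - s - 1. G s (Suc t) (m - s - 1 - t))"
    proof (simp only:, intro sum_reflect_symmetric)
      fix t assume "t < m - s - 1"
      then have "Suc (m - s - 1 - Suc t) = m - s - 1 - t" "m - s - 1 - (m - s - 1 - Suc t) = Suc t"
        by auto
      then show "G s (Suc (m - s - 1 - Suc t)) (m - s - 1 - (m - s - 1 - Suc t)) = G s (Suc t) (m - s - 1 - t)"
        by (simp only: G_sym)
    qed
  qed
  finally show ?thesis unfolding 1 2 by (simp add: algebra_simps)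
qed

lemma Ddiag_psum:
  "Ddiag (psum F) \<mu> = psum (\<lambda>j \<nu>. of_nat j * of_nat (j - 1) * F j \<nu> + Ddiag (F j) \<nu>) \<mu>"
proof -
  let ?d = "psum (\<lambda>j \<nu>. of_nat (j - 1))"
  have "Ddiag (psum F) \<mu> = psum (\<lambda>j \<nu>. ?d \<mu> * F j \<nu>) \<mu>"
    by (simp add: Ddiag_def psum_cmult)
  also have "\<dots> = psum (\<lambda>j \<nu>. of_nat j * of_nat (j - 1) * F j \<nu> + Ddiag (F j) \<nu>) \<mu>"
    by (rule psum_cong) (simp add: Ddiag_def psum_add_mset algebra_simps)
  finally show ?thesis .
qed

lemma joining_weights:
  "Djoin_ext (yweight \<psi>) m \<mu> + Ddiag_ext (joining \<psi>) m \<mu> =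
   yweight (Djoin_ext \<psi>) m \<mu> + joining (Ddiag_ext \<psi>) m \<mu>"
proof -
  let ?P = "\<lambda>c. psum (\<lambda>j \<nu>. c j * \<psi> (m + j) \<nu>) \<mu>"
  have of_pred: "of_nat j * of_nat (j - 1) = (of_nat j * (of_nat j - 1) :: qb)" for j
    by (cases j) auto
  have D: "Djoin (\<lambda>\<nu>. c * \<phi> \<nu>) \<mu> = c * Djoin \<phi> \<mu>" for c \<phi>
    by (simp add: Djoin_def psum_cmult)
  have 1: "Djoin_ext (yweight \<psi>) m \<mu> = of_nat m * Djoin (\<psi> m) \<mu> + ?P (\<lambda>j. 2 * of_nat m * of_nat (m + j))"
    by (simp add: Djoin_ext_def yweight_def[abs_def] joining_def D mult.assoc psum_cmult)
  have 2: "Ddiag_ext (joining \<psi>) m \<mu> = ?P (\<lambda>j. of_nat j * (of_nat j - 1)) + psum (\<lambda>j. Ddiag (\<psi> (m + j))) \<mu>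
      + ?P (\<lambda>j. of_nat m * (of_nat m - 1))"
    unfolding Ddiag_ext_def joining_def[abs_def]
    by (simp add: Ddiag_psum psum_add ysq_def psum_cmult of_pred[unfolded One_nat_def])
  have 3: "yweight (Djoin_ext \<psi>) m \<mu> = of_nat m * Djoin (\<psi> m) \<mu> + ?P (\<lambda>j. 2 * of_nat m * of_nat m)"
    by (simp add: Djoin_ext_def yweight_def joining_def mult.assoc psum_cmult distrib_left)
  have 4: "joining (Ddiag_ext \<psi>) m \<mu> = psum (\<lambda>j. Ddiag (\<psi> (m + j))) \<mu>
      + ?P (\<lambda>j. of_nat (m + j) * (of_nat (m + j) - 1))"
    by (simp add: joining_def Ddiag_ext_def[abs_def] psum_add ysq_def)
  have "?P (\<lambda>j. 2 * of_nat m * of_nat (m + j)) + (?P (\<lambda>j. of_nat j * (of_nat j - 1)) + ?P (\<lambda>j. of_nat m * (of_nat m - 1)))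
      = ?P (\<lambda>j. 2 * of_nat m * of_nat m) + ?P (\<lambda>j. of_nat (m + j) * (of_nat (m + j) - 1))"
    unfolding fun_cong[OF psum_add, symmetric] by (rule psum_cong) (simp add: algebra_simps)
  then show ?thesis unfolding 1 2 3 4 by algebra
qed

lemma splitting_weights:
  "Dsplit_ext (yweight \<psi>) m \<mu> + Ddiag_ext (splitting \<psi>) m \<mu> =
   yweight (Dsplit_ext \<psi>) m \<mu> + splitting (Ddiag_ext \<psi>) m \<mu>"
proof -
  let ?P = "\<lambda>c. \<Sum>s<m. c s * \<psi> s (add_mset (m - s) \<mu>)"
  have D: "Dsplit (\<lambda>\<nu>. c * \<phi> \<nu>) \<mu> = c * Dsplit \<phi> \<mu>" for c \<phi>
    by (simp add: Dsplit_def psum_cmult sum_distrib_left[symmetric])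
  have 1: "Dsplit_ext (yweight \<psi>) m \<mu> = of_nat m * Dsplit (\<psi> m) \<mu> + ?P (\<lambda>s. 2 * of_nat s * of_nat s)"
    by (simp add: Dsplit_ext_def yweight_def[abs_def] splitting_def D mult.assoc sum_distrib_left)
  have 2: "Ddiag_ext (splitting \<psi>) m \<mu> = (\<Sum>s<m. Ddiag (\<lambda>\<nu>. \<psi> s (add_mset (m - s) \<nu>)) \<mu>)
      + ?P (\<lambda>s. of_nat m * (of_nat m - 1))"
    by (simp add: Ddiag_ext_def Ddiag_def splitting_def ysq_def sum_distrib_left)
  have 3: "yweight (Dsplit_ext \<psi>) m \<mu> = of_nat m * Dsplit (\<psi> m) \<mu> + ?P (\<lambda>s. 2 * of_nat m * of_nat s)"
    by (simp add: Dsplit_ext_def yweight_def splitting_def sum_distrib_left algebra_simps)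
  have 4: "splitting (Ddiag_ext \<psi>) m \<mu> = (\<Sum>s<m. Ddiag (\<lambda>\<nu>. \<psi> s (add_mset (m - s) \<nu>)) \<mu>)
      + ?P (\<lambda>s. of_nat (m - s) * of_nat (m - s - 1) + of_nat s * (of_nat s - 1))"
    by (simp add: Ddiag_ext_def splitting_def ysq_def Ddiag_add_mset sum.distrib distrib_right)
  have "?P (\<lambda>s. 2 * of_nat s * of_nat s) + ?P (\<lambda>s. of_nat m * (of_nat m - 1))
      = ?P (\<lambda>s. 2 * of_nat m * of_nat s)
        + ?P (\<lambda>s. of_nat (m - s) * of_nat (m - s - 1) + of_nat s * (of_nat s - 1))"
    unfolding sum.distrib[symmetric]
  proof (rule sum.cong[OF refl])
    fix s assume "s \<in> {..<m}"
    then obtain d where "m = Suc (s + d)" by (auto dest: less_imp_Suc_add)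
    then show "2 * of_nat s * of_nat s * \<psi> s (add_mset (m - s) \<mu>)
        + of_nat m * (of_nat m - 1) * \<psi> s (add_mset (m - s) \<mu>)
        = 2 * of_nat m * of_nat s * \<psi> s (add_mset (m - s) \<mu>)
        + (of_nat (m - s) * of_nat (m - s - 1) + of_nat s * (of_nat s - 1)) * \<psi> s (add_mset (m - s) \<mu>)"
      by (simp add: algebra_simps)
  qed
  then show ?thesis unfolding 1 2 3 4 by algebra
qed

lemma Djoin_ext_add_scale: "Djoin_ext (\<lambda>m \<mu>. f m \<mu> + c * g m \<mu> + d * h m \<mu>) m \<mu> =
    Djoin_ext f m \<mu> + c * Djoin_ext g m \<mu> + d * Djoin_ext h m \<mu>"
  by (simp add: Djoin_ext_def Djoin_def joining_def psum_add psum_cmult algebra_simps)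

lemma Dsplit_ext_add_scale: "Dsplit_ext (\<lambda>m \<mu>. f m \<mu> + c * g m \<mu> + d * h m \<mu>) m \<mu> =
    Dsplit_ext f m \<mu> + c * Dsplit_ext g m \<mu> + d * Dsplit_ext h m \<mu>"
  by (simp add: Dsplit_ext_def Dsplit_def splitting_def yweight_def sum.distrib psum_add
      psum_cmult algebra_simps sum_distrib_left) (simp add: sum_distrib_left[symmetric] psum_cmult)

lemma Ddiag_ext_add_scale: "Ddiag_ext (\<lambda>m \<mu>. f m \<mu> + c * g m \<mu> + d * h m \<mu>) m \<mu> =
    Ddiag_ext f m \<mu> + c * Ddiag_ext g m \<mu> + d * Ddiag_ext h m \<mu>"
  by (simp add: Ddiag_ext_def Ddiag_def ysq_def algebra_simps)

text \<open>The commutator vanishes already with \<alpha> and b independent: its coefficients at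
  \<alpha>^2, \<alpha>, 1, \<alpha> b, b and b^2 are the six identities used.\<close>

lemma Lax_Dext: "Dext (Lax \<psi>) = Lax (Dext \<psi>)"
proof (rule ext, rule ext)
  fix m \<mu>
  have L: "Lax \<psi> = (\<lambda>m \<mu>. splitting \<psi> m \<mu> + \<alpha> * joining \<psi> m \<mu> + b * yweight \<psi> m \<mu>)" for \<psi>
    by (intro ext) (simp add: Lax_def yweight_def mult.assoc)
  have split: "splitting (\<lambda>m \<mu>. \<alpha> * f m \<mu> + g m \<mu> + b * h m \<mu>) m \<mu>
      = \<alpha> * splitting f m \<mu> + splitting g m \<mu> + b * splitting h m \<mu>" for f g h
    by (simp add: splitting_def sum.distrib sum_distrib_left)
  have join: "joining (\<lambda>m \<mu>. \<alpha> * f m \<mu> + g m \<mu> + b * h m \<mu>) m \<mu>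
      = \<alpha> * joining f m \<mu> + joining g m \<mu> + b * joining h m \<mu>" for f g h
    by (simp only: joining_def psum_add psum_cmult)
  have weight: "yweight (\<lambda>m \<mu>. \<alpha> * f m \<mu> + g m \<mu> + b * h m \<mu>) m \<mu>
      = \<alpha> * yweight f m \<mu> + yweight g m \<mu> + b * yweight h m \<mu>" for f g h
    by (simp add: yweight_def algebra_simps)
  have diag: "Ddiag_ext (yweight \<psi>) m \<mu> = yweight (Ddiag_ext \<psi>) m \<mu>"
    by (simp add: Ddiag_ext_def Ddiag_def yweight_def ysq_def algebra_simps)
  have lhs: "Dext (Lax \<psi>) m \<mu> =
     \<alpha> * (Djoin_ext (splitting \<psi>) m \<mu> + \<alpha> * Djoin_ext (joining \<psi>) m \<mu> + b * Djoin_ext (yweight \<psi>) m \<mu>)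
     + (Dsplit_ext (splitting \<psi>) m \<mu> + \<alpha> * Dsplit_ext (joining \<psi>) m \<mu> + b * Dsplit_ext (yweight \<psi>) m \<mu>)
     + b * (Ddiag_ext (splitting \<psi>) m \<mu> + \<alpha> * Ddiag_ext (joining \<psi>) m \<mu> + b * Ddiag_ext (yweight \<psi>) m \<mu>)"
    unfolding L Dext_def Djoin_ext_add_scale Dsplit_ext_add_scale Ddiag_ext_add_scale ..
  have rhs: "Lax (Dext \<psi>) m \<mu> =
     \<alpha> * splitting (Djoin_ext \<psi>) m \<mu> + splitting (Dsplit_ext \<psi>) m \<mu> + b * splitting (Ddiag_ext \<psi>) m \<mu>
     + \<alpha> * (\<alpha> * joining (Djoin_ext \<psi>) m \<mu> + joining (Dsplit_ext \<psi>) m \<mu> + b * joining (Ddiag_ext \<psi>) m \<mu>)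
     + b * (\<alpha> * yweight (Djoin_ext \<psi>) m \<mu> + yweight (Dsplit_ext \<psi>) m \<mu> + b * yweight (Ddiag_ext \<psi>) m \<mu>)"
    unfolding L Dext_def[abs_def] split join weight ..
  show "Dext (Lax \<psi>) m \<mu> = Lax (Dext \<psi>) m \<mu>"
    unfolding lhs rhs
    using splitting_joining_ext[of \<psi> m \<mu>] splitting_Dsplit_ext[of \<psi> m \<mu>] joining_weights[of \<psi> m \<mu>]
      splitting_weights[of \<psi> m \<mu>] joining_Djoin_ext[of \<psi> m \<mu>] diag by algebra
qed


section \<open>Intertwining relations of \<Theta>, \<nabla>, \<epsilon> and the shift\<close>

lemma T1_eq_fun: "Tk 1 \<phi> = (\<lambda>\<mu>. \<alpha> * Djoin \<phi> \<mu> + Dsplit \<phi> \<mu> + b * Ddiag \<phi> \<mu>)"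
  by (rule ext) (rule T1_eq)

text \<open>The lift treats y_{m+1} like the power sum p_{m+1}, except that the two pieces of a
  split are ordered. Once y is again a power sum, the weight 2(s + 1) of the ordered pieces
  symmetrises to m + 1.\<close>

lemma Dext_Theta: "Dext (Theta \<phi>) m \<mu> + 2 * Lax (Theta \<phi>) m \<mu> = Theta (Tk 1 \<phi>) m \<mu>"
proof -
  have "2 * (\<Sum>s<m. of_nat (Suc s) * \<phi> (add_mset (Suc s) (add_mset (m - s) \<mu>)))
      = of_nat (Suc m) * (\<Sum>s<m. \<phi> (add_mset (Suc s) (add_mset (m - s) \<mu>)))"
    using sum_reflect_symmetric[of m "\<lambda>s. \<phi> (add_mset (Suc s) (add_mset (m - s) \<mu>))"]
    by (simp only: sum_distrib_left mult.assoc) (simp add: Suc_diff_Suc add_mset_commute)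
  moreover have "(\<Sum>s<m. of_nat (Suc s) * \<phi> (add_mset (Suc s) (add_mset (m - s) \<mu>)))
     = (\<Sum>s<m. of_nat s * \<phi> (add_mset (Suc s) (add_mset (m - s) \<mu>)))
     + (\<Sum>s<m. \<phi> (add_mset (Suc s) (add_mset (m - s) \<mu>)))"
    by (simp add: sum.distrib[symmetric] algebra_simps)
  moreover have "psum (\<lambda>j. Theta \<phi> (m + j)) \<mu> = psum (\<lambda>j \<nu>. \<phi> (add_mset (Suc m + j) \<nu>)) \<mu>"
    by (rule psum_cong) (simp add: Theta_def)
  ultimately show ?thesis
    unfolding Theta_def[of "Tk 1 \<phi>"] T1_eq Djoin_add_mset Dsplit_add_mset Ddiag_add_mset
      Dext_def Djoin_ext_def Dsplit_ext_def Ddiag_ext_def Lax_def splitting_def yweight_def ysq_def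
      joining_def
    by (simp add: Theta_def[abs_def]) algebra
qed

lemma Nabla_Dext: "Nabla (Dext \<psi>) \<mu> + 2 * Nabla (Lax \<psi>) \<mu> = Tk 1 (Nabla \<psi>) \<mu>"
proof -
  define D where "D \<phi> \<mu> = \<alpha> * Djoin \<phi> \<mu> + Dsplit \<phi> \<mu> + b * Ddiag \<phi> \<mu>" for \<phi> \<mu>
  let ?pair = "psum (\<lambda>i. psum (\<lambda>j \<nu>. of_nat (i + j) * \<psi> (i + j - 1) \<nu>)) \<mu>"
  have sym: "psum (\<lambda>i. psum (\<lambda>j \<nu>. of_nat i * \<psi> (i + j - 1) \<nu>)) \<mu> =
     psum (\<lambda>i. psum (\<lambda>j \<nu>. of_nat j * \<psi> (i + j - 1) \<nu>)) \<mu>"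
    by (subst psum_swap) (simp add: add.commute)
  have "?pair = psum (\<lambda>i. psum (\<lambda>j \<nu>. of_nat i * \<psi> (i + j - 1) \<nu>)) \<mu>
      + psum (\<lambda>i. psum (\<lambda>j \<nu>. of_nat j * \<psi> (i + j - 1) \<nu>)) \<mu>"
    by (simp add: distrib_right psum_add)
  with sym have pair: "?pair = psum (\<lambda>i \<nu>. 2 * of_nat i * psum (\<lambda>j \<nu>. \<psi> (i + j - 1) \<nu>) \<nu>) \<mu>"
    by (simp only: psum_cmult mult.assoc mult_2[symmetric])
  have join: "Djoin (Nabla \<psi>) \<mu> = psum (\<lambda>i \<nu>. 2 * of_nat i * psum (\<lambda>j \<nu>. \<psi> (i + j - 1) \<nu>) \<nu>) \<mu>
      + psum (\<lambda>k. Djoin (\<psi> (k - 1))) \<mu>"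
    unfolding Nabla_def[abs_def] by (subst Djoin_psum) (simp only: pair)
  have split: "Dsplit (Nabla \<psi>) \<mu> = psum (\<lambda>j \<nu>. 2 * (\<Sum>s<j-1. of_nat (Suc s) * \<psi> s (add_mset (j - 1 - s) \<nu>))) \<mu>
      + psum (\<lambda>k. Dsplit (\<psi> (k - 1))) \<mu>"
    unfolding Nabla_def[abs_def] by (subst Dsplit_psum) (simp only: diff_Suc_1)
  have diag: "Ddiag (Nabla \<psi>) \<mu> = psum (\<lambda>j \<nu>. of_nat j * of_nat (j - 1) * \<psi> (j - 1) \<nu>) \<mu>
      + psum (\<lambda>k. Ddiag (\<psi> (k - 1))) \<mu>"
    unfolding Nabla_def[abs_def] Ddiag_psum psum_add ..
  have "psum (\<lambda>j \<nu>. Dext \<psi> (j - 1) \<nu> + 2 * Lax \<psi> (j - 1) \<nu>) \<mu> =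
      psum (\<lambda>j \<nu>. \<alpha> * (2 * of_nat j * psum (\<lambda>i \<nu>. \<psi> (j + i - 1) \<nu>) \<nu> + Djoin (\<psi> (j - 1)) \<nu>)
        + (2 * (\<Sum>s<j-1. of_nat (Suc s) * \<psi> s (add_mset (j - 1 - s) \<nu>)) + Dsplit (\<psi> (j - 1)) \<nu>)
        + b * (of_nat j * of_nat (j - 1) * \<psi> (j - 1) \<nu> + Ddiag (\<psi> (j - 1)) \<nu>)) \<mu>"
  proof (rule psum_cong_pos)
    fix j :: nat and \<nu> assume "0 < j"
    then obtain i where j: "j = Suc i" using gr0_implies_Suc by blast
    have s: "(\<Sum>s<i. of_nat (Suc s) * \<psi> s (add_mset (i - s) \<nu>))
       = (\<Sum>s<i. of_nat s * \<psi> s (add_mset (i - s) \<nu>)) + (\<Sum>s<i. \<psi> s (add_mset (i - s) \<nu>))"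
      by (simp add: sum.distrib[symmetric] algebra_simps)
    show "Dext \<psi> (j - 1) \<nu> + 2 * Lax \<psi> (j - 1) \<nu> =
      \<alpha> * (2 * of_nat j * psum (\<lambda>i \<nu>. \<psi> (j + i - 1) \<nu>) \<nu> + Djoin (\<psi> (j - 1)) \<nu>)
        + (2 * (\<Sum>s<j-1. of_nat (Suc s) * \<psi> s (add_mset (j - 1 - s) \<nu>)) + Dsplit (\<psi> (j - 1)) \<nu>)
        + b * (of_nat j * of_nat (j - 1) * \<psi> (j - 1) \<nu> + Ddiag (\<psi> (j - 1)) \<nu>)"
      unfolding j diff_Suc_1 s Dext_def Djoin_ext_def Dsplit_ext_def Ddiag_ext_def Lax_def
        splitting_def yweight_def ysq_def joining_def add_Suc
      by (simp add: algebra_simps)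
  qed
  then show ?thesis
    unfolding T1_eq join split diag Nabla_def fun_cong[OF psum_add] fun_cong[OF psum_cmult]
    by (simp only: psum_add psum_cmult)
qed

text \<open>This is the purpose of the reduction by 2 L: splitting off y_1 now has weight 0, so has
  the diagonal term at y_1, and joining never produces y_1. On the coefficient of y_1 only 2 D_b is
  left.\<close>

lemma Dext_Eps: "Dext (Eps \<phi>) = Eps (Tk 1 \<phi>)"
proof (rule ext, rule ext)
  fix m \<mu>
  have "joining (Eps \<phi>) m \<mu> = 0" if "m \<noteq> 0"
    using that by (simp add: joining_def Eps_def[abs_def])
  moreover have "splitting (yweight (Eps \<phi>)) m \<mu> = 0"
    by (auto simp: splitting_def yweight_def Eps_def intro!: sum.neutral)
  moreover have "Djoin (Eps \<phi> m) \<mu> = (if m = 0 then Djoin \<phi> \<mu> else 0)"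
    "Dsplit (Eps \<phi> m) \<mu> = (if m = 0 then Dsplit \<phi> \<mu> else 0)"
    by (simp_all add: Djoin_def Dsplit_def Eps_def)
  ultimately show "Dext (Eps \<phi>) m \<mu> = Eps (Tk 1 \<phi>) m \<mu>"
    by (cases "m = 0") (simp_all add: Dext_def Djoin_ext_def Dsplit_ext_def Ddiag_ext_def Ddiag_def
        Eps_def T1_eq[unfolded One_nat_def] ysq_def)
qed

text \<open>For m \<ge> 1, y_1 occurs in L y_{m+1} only in the splitting term p_m y_1.\<close>

lemma Shift_Theta: "Shift (Theta \<phi>) = Lax (Eps \<phi>)"
proof (rule ext, rule ext)
  fix m \<mu>
  have "joining (Eps \<phi>) m \<mu> = 0"
    unfolding joining_def by (subst psum_cong_pos[where G = "\<lambda>_ _. 0"]) (simp_all add: Eps_def)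
  moreover have "splitting (Eps \<phi>) m \<mu> = (if m = 0 then 0 else \<phi> (add_mset m \<mu>))"
    by (simp add: splitting_def Eps_def if_distrib[of "\<lambda>f. f _"] cong: if_cong)
  ultimately show "Shift (Theta \<phi>) m \<mu> = Lax (Eps \<phi>) m \<mu>"
    by (simp add: Shift_def Theta_def Lax_def Eps_def)
qed

text \<open>Shifting the index lowers the diagonal weight by one b. The remaining discrepancy sits
  at y_1: joining followed by the shift takes y_1 f to \<alpha> times \<nabla> f.\<close>

lemma Lax_Shift:
  "Lax (Shift \<psi>) m \<mu> = Shift (Lax \<psi>) m \<mu> + b * Shift \<psi> m \<mu> + \<alpha> * Eps (Nabla \<psi>) m \<mu>"
proof (cases m)
  case 0
  have "joining (Shift \<psi>) 0 \<mu> = Nabla \<psi> \<mu>"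
    unfolding joining_def Nabla_def by (rule psum_cong_pos) (simp add: Shift_def)
  then show ?thesis
    by (simp add: 0 Lax_def Shift_def Eps_def splitting_def)
next
  case (Suc n)
  have "joining (Shift \<psi>) (Suc n) \<mu> = joining \<psi> n \<mu>"
    unfolding joining_def by (rule psum_cong) (simp add: Shift_def)
  moreover have "splitting (Shift \<psi>) (Suc n) \<mu> = splitting \<psi> n \<mu>"
    unfolding splitting_def by (subst sum.lessThan_Suc_shift) (simp add: Shift_def)
  ultimately show ?thesis
    by (simp add: Suc Lax_def Shift_def Eps_def algebra_simps)
qed

section \<open>The operator p_1^* = \<epsilon> \<nabla>, transposed to \<open>lower\<close>, against
  L\<close>

abbreviation lower :: "fnl \<Rightarrow> fnl" where "lower \<equiv> Rk 0"

lemma lower_def: "lower \<phi> = psum (\<lambda>j. Eps \<phi> (j - 1))"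
  by (rule ext) (simp add: Rk_def Nabla_def)

lemma lower_add_mset:
  "lower \<phi> (add_mset r \<mu>) = of_nat r * Eps \<phi> (r - 1) \<mu> + lower (\<lambda>\<nu>. \<phi> (add_mset r \<nu>)) \<mu>"
  by (simp add: lower_def psum_add_mset Eps_def[abs_def])

lemma lower_linear:
  "lower (\<lambda>\<mu>. \<phi> \<mu> + \<phi>' \<mu>) \<mu> = lower \<phi> \<mu> + lower \<phi>' \<mu>"
  "lower (\<lambda>\<mu>. c * \<phi> \<mu>) \<mu> = c * lower \<phi> \<mu>"
  "lower (\<lambda>\<mu>. \<Sum>i\<in>A. f i \<mu>) \<mu> = (\<Sum>i\<in>A. lower (f i) \<mu>)"
proof -
  have 1: "Eps (\<lambda>\<mu>. \<phi> \<mu> + \<phi>' \<mu>) (j - 1) = (\<lambda>\<mu>. Eps \<phi> (j - 1) \<mu> + Eps \<phi>' (j - 1) \<mu>)" for j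
    by (auto simp: Eps_def)
  show "lower (\<lambda>\<mu>. \<phi> \<mu> + \<phi>' \<mu>) \<mu> = lower \<phi> \<mu> + lower \<phi>' \<mu>"
    unfolding lower_def 1 psum_add ..
  have 2: "Eps (\<lambda>\<mu>. c * \<phi> \<mu>) (j - 1) = (\<lambda>\<mu>. c * Eps \<phi> (j - 1) \<mu>)" for j
    by (auto simp: Eps_def)
  show "lower (\<lambda>\<mu>. c * \<phi> \<mu>) \<mu> = c * lower \<phi> \<mu>"
    unfolding lower_def 2 psum_cmult ..
  have 3: "Eps (\<lambda>\<mu>. \<Sum>i\<in>A. f i \<mu>) (j - 1) = (\<lambda>\<mu>. \<Sum>i\<in>A. Eps (f i) (j - 1) \<mu>)" for j
    by (auto simp: Eps_def)
  show "lower (\<lambda>\<mu>. \<Sum>i\<in>A. f i \<mu>) \<mu> = (\<Sum>i\<in>A. lower (f i) \<mu>)"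
    unfolding lower_def 3 psum_sum ..
qed

lemma lower_psum: "lower (psum F) \<mu> = psum (\<lambda>j. lower (F j)) \<mu>"
proof -
  have "Eps (psum F) (i - 1) = psum (\<lambda>j. Eps (F j) (i - 1))" for i
    by (rule ext) (simp add: Eps_def[abs_def])
  then show ?thesis
    unfolding lower_def by (subst psum_swap) simp
qed

lemma Theta_lower: "Theta (lower \<phi>) m \<mu> = lower (Theta \<phi> m) \<mu> + Eps \<phi> m \<mu>"
  unfolding Theta_def[abs_def] by (simp add: lower_add_mset Eps_def)

text \<open>As p_1^* is a derivation that takes p_r to 1 for r = 1 and to 0 otherwise, it meets the
  coefficients of L only in the splitting term with r = 1.\<close>

lemma Lax_lower: "Lax (\<lambda>m. lower (\<psi> m)) m \<mu> = lower (Lax \<psi> m) \<mu> + Shift \<psi> m \<mu>"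
proof -
  have "splitting (\<lambda>m. lower (\<psi> m)) m \<mu>
     = (\<Sum>s<m. of_nat (m - s) * Eps (\<psi> s) (m - s - 1) \<mu>) + lower (splitting \<psi> m) \<mu>"
    by (simp add: splitting_def[abs_def] lower_add_mset lower_linear sum.distrib)
  also have "(\<Sum>s<m. of_nat (m - s) * Eps (\<psi> s) (m - s - 1) \<mu>) = Shift \<psi> m \<mu>"
  proof (cases m)
    case (Suc n)
    have "(\<Sum>s<Suc n. of_nat (Suc n - s) * Eps (\<psi> s) (Suc n - s - 1) \<mu>) = (\<Sum>s<Suc n. if s = n then \<psi> n \<mu> else 0)"
      by (rule sum.cong) (auto simp: Eps_def)
    then show ?thesis by (simp add: Suc Shift_def)
  qed (simp add: Shift_def)
  finally have "splitting (\<lambda>m. lower (\<psi> m)) m \<mu> = Shift \<psi> m \<mu> + lower (splitting \<psi> m) \<mu>" .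
  moreover have "joining (\<lambda>m. lower (\<psi> m)) m \<mu> = lower (joining \<psi> m) \<mu>"
    by (simp add: joining_def[abs_def] lower_psum)
  ultimately show ?thesis
    by (simp add: Lax_def[abs_def] lower_linear mult.assoc)
qed

lemma lower_Nabla: "lower (Nabla \<psi>) = Nabla (\<lambda>m. lower (\<psi> m))"
  by (rule ext) (simp add: Nabla_def[abs_def] lower_psum)

lemma Nabla_add: "Nabla (\<lambda>m \<mu>. f m \<mu> + g m \<mu>) \<mu> = Nabla f \<mu> + Nabla g \<mu>"
  by (simp add: Nabla_def psum_add)

lemma Nabla_cmult: "Nabla (\<lambda>m \<mu>. c * f m \<mu>) \<mu> = c * Nabla f \<mu>"
  by (simp add: Nabla_def psum_cmult)

lemma Nabla_sum: "Nabla (\<lambda>m \<mu>. \<Sum>i\<in>A. f i m \<mu>) \<mu> = (\<Sum>i\<in>A. Nabla (f i) \<mu>)"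
  by (simp add: Nabla_def psum_sum)

lemma Lax_add: "Lax (\<lambda>m \<mu>. f m \<mu> + g m \<mu>) = (\<lambda>m \<mu>. Lax f m \<mu> + Lax g m \<mu>)"
  by (intro ext) (simp add: Lax_def splitting_def joining_def sum.distrib psum_add algebra_simps)

lemma Lax_cmult: "Lax (\<lambda>m \<mu>. c * f m \<mu>) = (\<lambda>m \<mu>. c * Lax f m \<mu>)"
  by (intro ext) (simp add: Lax_def splitting_def joining_def sum_distrib_left psum_cmult algebra_simps)

lemma Lax_sum: "Lax (\<lambda>m \<mu>. \<Sum>i\<in>A. f i m \<mu>) = (\<lambda>m \<mu>. \<Sum>i\<in>A. Lax (f i) m \<mu>)"
proof (induction A rule: infinite_finite_induct)
  have z: "Lax (\<lambda>m \<mu>. 0) = (\<lambda>m \<mu>. 0)"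
    using Lax_cmult[of 0] by simp
  { case infinite then show ?case by (simp add: z) }
  { case empty then show ?case by (simp add: z) }
qed (simp add: Lax_add)

lemma Laxpow_add: "(Lax ^^ k) (\<lambda>m \<mu>. f m \<mu> + g m \<mu>) = (\<lambda>m \<mu>. (Lax ^^ k) f m \<mu> + (Lax ^^ k) g m \<mu>)"
  by (induction k arbitrary: f g) (simp_all add: Lax_add)

lemma Laxpow_cmult: "(Lax ^^ k) (\<lambda>m \<mu>. c * f m \<mu>) = (\<lambda>m \<mu>. c * (Lax ^^ k) f m \<mu>)"
  by (induction k arbitrary: f) (simp_all add: Lax_cmult)

lemma Laxpow_sum: "(Lax ^^ k) (\<lambda>m \<mu>. \<Sum>i\<in>A. f i m \<mu>) = (\<lambda>m \<mu>. \<Sum>i\<in>A. (Lax ^^ k) (f i) m \<mu>)"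
  by (induction k) (simp_all add: Lax_sum)

lemma Laxpow_Dext: "Dext ((Lax ^^ k) \<psi>) = (Lax ^^ k) (Dext \<psi>)"
  by (induction k) (simp_all add: Lax_Dext)

lemma Laxpow_Lax: "(Lax ^^ k) (Lax \<psi>) = Lax ((Lax ^^ k) \<psi>)"
  by (simp add: funpow_swap1)

text \<open>Passing 2 D_b through \<Theta> and through \<nabla> costs the same correction 2 L, and
  this commutes with L^k.\<close>

lemma Tk_T1: "Tk k (Tk 1 \<phi>) = Tk 1 (Tk k \<phi>)"
proof (rule ext)
  fix \<mu>
  have 1: "Theta (Tk 1 \<phi>) = (\<lambda>m \<mu>. Dext (Theta \<phi>) m \<mu> + 2 * Lax (Theta \<phi>) m \<mu>)"
    by (intro ext) (simp only: Dext_Theta)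
  have "Tk k (Tk 1 \<phi>) \<mu> = Nabla ((Lax ^^ k) (Dext (Theta \<phi>))) \<mu> + 2 * Nabla ((Lax ^^ k) (Lax (Theta \<phi>))) \<mu>"
    unfolding Tk_def[of k] 1 Laxpow_add Laxpow_cmult Nabla_add Nabla_cmult ..
  also have "\<dots> = Tk 1 (Tk k \<phi>) \<mu>"
    unfolding Laxpow_Dext[symmetric] Laxpow_Lax Tk_def[of k] Nabla_Dext ..
  finally show "Tk k (Tk 1 \<phi>) \<mu> = Tk 1 (Tk k \<phi>) \<mu>" .
qed

text \<open>Here only the \<nabla> side carries the correction 2 L, by \<open>Dext_Eps\<close>; the
  commutator with 2 D_b therefore inserts one more factor 2 L.\<close>

lemma Rk_Suc: "2 * Rk (Suc k) \<phi> \<mu> = Tk 1 (Rk k \<phi>) \<mu> - Rk k (Tk 1 \<phi>) \<mu>"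
proof -
  have "Rk k (Tk 1 \<phi>) \<mu> = Nabla (Dext ((Lax ^^ k) (Eps \<phi>))) \<mu>"
    by (simp only: Rk_def Dext_Eps[symmetric] Laxpow_Dext)
  then show ?thesis
    using Nabla_Dext[of "(Lax ^^ k) (Eps \<phi>)" \<mu>] by (simp add: Rk_def)
qed

text \<open>\<open>Bk i j\<close> arises from commuting \<^const>\<open>lower\<close> past a power of \<^const>\<open>Lax\<close>.\<close>

definition Bk :: "nat \<Rightarrow> nat \<Rightarrow> fnl \<Rightarrow> fnl" where
  "Bk i j \<phi> = Nabla ((Lax ^^ j) (Shift ((Lax ^^ i) (Theta \<phi>))))"

lemma Bk_0: "Bk 0 j \<phi> = Rk (Suc j) \<phi>"
  by (simp add: Bk_def Rk_def Shift_Theta funpow_swap1)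

lemma Bk_Suc: "Bk i (Suc j) \<phi> \<mu> = Bk (Suc i) j \<phi> \<mu> + b * Bk i j \<phi> \<mu> + \<alpha> * Rk j (Tk i \<phi>) \<mu>"
proof -
  let ?\<psi> = "(Lax ^^ i) (Theta \<phi>)"
  have 1: "Lax (Shift ?\<psi>) = (\<lambda>m \<mu>. Shift (Lax ?\<psi>) m \<mu> + b * Shift ?\<psi> m \<mu> + \<alpha> * Eps (Nabla ?\<psi>) m \<mu>)"
    by (intro ext) (rule Lax_Shift)
  have "Bk i (Suc j) \<phi> \<mu> = Nabla ((Lax ^^ j) (Lax (Shift ?\<psi>))) \<mu>"
    by (simp add: Bk_def funpow_swap1)
  then show ?thesis
    unfolding 1 Laxpow_add Laxpow_cmult Nabla_add Nabla_cmult
    by (simp add: Bk_def Rk_def Tk_def)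
qed

text \<open>Moving p_1^* past \<Theta> leaves the term \<open>Rk k\<close>; moving it past each of
  the k factors L leaves one \<open>Shift\<close> in the place of that factor.\<close>

lemma Tk_lower: "Tk k (lower \<phi>) \<mu> = lower (Tk k \<phi>) \<mu> + Rk k \<phi> \<mu> + (\<Sum>i<k. Bk i (k - 1 - i) \<phi> \<mu>)"
proof -
  have *: "(Lax ^^ k) (\<lambda>m. lower (\<psi> m)) =
      (\<lambda>m \<mu>. lower ((Lax ^^ k) \<psi> m) \<mu> + (\<Sum>i<k. (Lax ^^ (k - 1 - i)) (Shift ((Lax ^^ i) \<psi>)) m \<mu>))" for \<psi>
  proof (induction k)
    case (Suc k)
    have "Suc k - 1 - i = Suc (k - 1 - i)" if "i < k" for i
      using that by simp
    moreover have "Lax (\<lambda>m. lower (\<psi> m)) = (\<lambda>m \<mu>. lower (Lax \<psi> m) \<mu> + Shift \<psi> m \<mu>)" for \<psi>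
      by (intro ext) (rule Lax_lower)
    ultimately show ?case
      by (simp add: Suc Lax_add Lax_sum add_ac)
  qed simp
  have 1: "Theta (lower \<phi>) = (\<lambda>m \<mu>. lower (Theta \<phi> m) \<mu> + Eps \<phi> m \<mu>)"
    by (intro ext) (rule Theta_lower)
  show ?thesis
    unfolding Tk_def[of k] 1 Laxpow_add * Nabla_add Nabla_sum lower_Nabla
    by (simp add: Rk_def Bk_def)
qed

section \<open>Functionals vanishing on the span of the Lax orbit\<close>

lemma psum_delta: "psum (\<lambda>j \<nu>. if j = 1 then c else 0) \<mu> = of_nat (count \<mu> 1) * c"
  by (induction \<mu>) (simp_all add: psum_add_mset algebra_simps)

lemma size_le_sum_mset: "is_partition \<mu> \<Longrightarrow> size \<mu> \<le> sum_mset \<mu>"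
  by (induction \<mu>) (auto simp: is_partition_def)

lemma is_partition_add_mset [simp]: "is_partition (add_mset r \<mu>) \<longleftrightarrow> r \<noteq> 0 \<and> is_partition \<mu>"
  by (auto simp: is_partition_def)

lemma one_plus_b_nonzero: "1 + b \<noteq> 0"
proof
  assume "1 + b = 0"
  then have "Fraction_Field.Fract ([:1:] + [:0, 1:]) 1 = (0 :: qb)"
    by (simp add: b_def Fraction_Field.One_fract_def one_pCons)
  then show False by (simp add: Fraction_Field.Zero_fract_def eq_fract)
qed

text \<open>
  The joining part of \<open>L\<close> is the only one that does not increase the length, so a descending
  induction on the length leaves \<open>\<Sum>\<^sub>j j \<psi>(m + j, \<nu> - j) = 0\<close> for all \<open>\<nu>\<close>. For \<open>\<nu> = \<kappa> \<union> (1)\<close> this expresses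
  \<open>\<psi>\<close> at \<open>\<kappa>\<close> by values at partitions with more parts equal to 1.
\<close>

lemma Nabla_Lax_orbit_zero:
  assumes "\<And>j \<mu>. \<mu> \<in> partitions n \<Longrightarrow> Nabla ((Lax ^^ j) \<psi>) \<mu> = 0"
  assumes "is_partition \<kappa>" "sum_mset \<kappa> + Suc m = n"
  shows "\<psi> m \<kappa> = 0"
proof -
  have "\<psi> m \<kappa> = 0"
    if "\<And>j \<mu>. \<mu> \<in> partitions n \<Longrightarrow> Nabla ((Lax ^^ j) \<psi>) \<mu> = 0"
      "is_partition \<kappa>" "sum_mset \<kappa> + Suc m = n" "n \<le> size \<kappa> + d" for d \<psi> m \<kappa>
    using that
  proof (induction d arbitrary: \<psi> m \<kappa>)
    case 0
    then show ?case using size_le_sum_mset[of \<kappa>] by simp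
  next
    case (Suc d)
    note Z = Suc.prems(1)
    \<comment> \<open>\<open>Lax \<psi>\<close> satisfies the same hypothesis, so the induction
      applies to both forms. On longer partitions L \<psi>, its splitting part and \<psi> vanish,
      which isolates the joining part.\<close>
    have ZL: "Nabla ((Lax ^^ j) (Lax \<psi>)) \<mu> = 0" if "\<mu> \<in> partitions n" for j \<mu>
      using Z[OF that, of "Suc j"] by (simp add: funpow_swap1)
    have longer: "\<psi> m \<kappa> = 0" "Lax \<psi> m \<kappa> = 0"
      if "is_partition \<kappa>" "sum_mset \<kappa> + Suc m = n" "n \<le> size \<kappa> + d" for m \<kappa>
      using Suc.IH[of \<psi>] Suc.IH[of "Lax \<psi>"] Z ZL that by blast+
    from Suc.prems(2-) show ?case
    proof (induction "size (filter_mset (\<lambda>x. x \<noteq> 1) \<kappa>)" arbitrary: m \<kappa> rule: less_induct)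
      case less
      have "psum (\<lambda>j. \<psi> (m + j - 1)) (add_mset 1 \<kappa>) = 0"
      proof (cases m)
        case 0
        with less.prems have "Nabla \<psi> (add_mset 1 \<kappa>) = 0"
          using Z[of "add_mset 1 \<kappa>" 0] by (simp add: partitions_def)
        then show ?thesis by (simp add: 0 Nabla_def)
      next
        case (Suc m')
        have "splitting \<psi> m' (add_mset 1 \<kappa>) = 0"
          unfolding splitting_def
        proof (rule sum.neutral, rule ballI)
          fix s assume "s \<in> {..<m'}"
          with less.prems Suc show "\<psi> s (add_mset (m' - s) (add_mset 1 \<kappa>)) = 0"
            by (intro longer) auto
        qed
        moreover have "\<psi> m' (add_mset 1 \<kappa>) = 0" "Lax \<psi> m' (add_mset 1 \<kappa>) = 0"
          using less.prems Suc by (auto intro!: longer)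
        ultimately have "joining \<psi> m' (add_mset 1 \<kappa>) = 0"
          by (simp add: Lax_def one_plus_b_nonzero)
        then show ?thesis by (simp add: Suc joining_def)
      qed
      moreover have "psum (\<lambda>j \<nu>. \<psi> (m + j - 1) (add_mset 1 \<nu>)) \<kappa> = psum (\<lambda>j \<nu>. if j = 1 then \<psi> m \<kappa> else 0) \<kappa>"
      proof (rule psum_cong_pos)
        fix j \<nu> assume *: "\<kappa> = add_mset j \<nu>" "0 < j"
        show "\<psi> (m + j - 1) (add_mset 1 \<nu>) = (if j = 1 then \<psi> m \<kappa> else 0)"
        proof (cases "j = 1")
          case False
          with * less.prems show ?thesis
            by (simp) (rule less.hyps, auto)
        qed (use * in simp)
      qed
      ultimately have "(1 + of_nat (count \<kappa> 1)) * \<psi> m \<kappa> = 0"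
        by (simp add: psum_add_mset psum_delta[unfolded One_nat_def] distrib_right)
      moreover have "(1 + of_nat (count \<kappa> 1) :: qb) \<noteq> 0"
        using of_nat_0_eq_iff[of "Suc (count \<kappa> 1)", where ?'a = qb] by simp
      ultimately show ?case by simp
    qed
  qed
  from this[of \<psi> \<kappa> m n] assms show ?thesis by simp
qed

section \<open>Coefficients of the power sums at monomials\<close>

definition expo :: "nat \<Rightarrow> (nat \<Rightarrow> nat) \<Rightarrow> (nat \<Rightarrow>\<^sub>0 nat)" where
  "expo N e = Abs_poly_mapping (\<lambda>i. if i < N then e i else 0)"

lemma lookup_expo [simp]: "Poly_Mapping.lookup (expo N e) i = (if i < N then e i else 0)"
proof -
  have "finite {i. (if i < N then e i else 0) \<noteq> 0}"
    by (rule finite_subset[of _ "{..<N}"]) auto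
  then show ?thesis by (simp add: expo_def)
qed

text \<open>The linear form that takes f to the coefficient of x^e in f(x_0, ..., x_{N-1}).\<close>

definition mono_coeff :: "nat \<Rightarrow> (nat \<Rightarrow> nat) \<Rightarrow> fnl" where
  "mono_coeff N e \<mu> = Poly_Mapping.lookup (\<Prod>r\<in>#\<mu>. \<Sum>i<N. x_var i ^ r) (expo N e)"

lemma x_var_power: "x_var i ^ r = Poly_Mapping.single (Poly_Mapping.single i r) 1"
  by (induction r) (simp_all add: x_var_def mult_single single_add[symmetric])

lemma lookup_single_mult:
  "Poly_Mapping.lookup (Poly_Mapping.single k c * p) (k + f) = c * Poly_Mapping.lookup p f"
  for k f :: "'a::cancel_comm_monoid_add" and c :: "'b::comm_semiring_0"
  by (simp add: lookup_mult lookup_single when_mult)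

lemma lookup_single_mult_0:
  assumes "\<And>f. e \<noteq> k + f"
  shows "Poly_Mapping.lookup (Poly_Mapping.single k c * p) e = 0"
  using assms by (simp add: lookup_mult lookup_single when_mult)

lemma lookup_const_mult:
  "Poly_Mapping.lookup (Poly_Mapping.single 0 c * p) e = c * Poly_Mapping.lookup p e"
  for e :: "'a::cancel_comm_monoid_add" and c :: "'b::comm_semiring_0"
  using lookup_single_mult[of 0 c p e] by simp

lemma mono_coeff_empty: "mono_coeff N e {#} = (if \<forall>i<N. e i = 0 then 1 else 0)"
proof -
  have "expo N e = 0 \<longleftrightarrow> (\<forall>i<N. e i = 0)"
    by (auto simp: poly_mapping_eq_iff fun_eq_iff)
  then show ?thesis by (simp add: mono_coeff_def lookup_one)
qed

lemma mono_coeff_add_mset: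
  "mono_coeff N e (add_mset r \<mu>) = (\<Sum>i<N. if r \<le> e i then mono_coeff N (e(i := e i - r)) \<mu> else 0)"
proof -
  let ?p = "\<Prod>r\<in>#\<mu>. \<Sum>i<N. x_var i ^ r"
  have "Poly_Mapping.lookup (x_var i ^ r * ?p) (expo N e) =
      (if r \<le> e i then mono_coeff N (e(i := e i - r)) \<mu> else 0)" if "i < N" for i
  proof (cases "r \<le> e i")
    case True
    then have eq: "expo N e = Poly_Mapping.single i r + expo N (e(i := e i - r))"
      using that by (auto simp: poly_mapping_eq_iff fun_eq_iff lookup_add lookup_single when_def)
    have "Poly_Mapping.lookup (x_var i ^ r * ?p) (expo N e)
        = 1 * Poly_Mapping.lookup ?p (expo N (e(i := e i - r)))"
      unfolding x_var_power[of i r] by (subst eq) (rule lookup_single_mult)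
    then show ?thesis unfolding mono_coeff_def if_P[OF True] by (simp only: mult_1)
  next
    case False
    have "expo N e \<noteq> Poly_Mapping.single i r + f" for f
    proof
      assume "expo N e = Poly_Mapping.single i r + f"
      then have "Poly_Mapping.lookup (expo N e) i = Poly_Mapping.lookup (Poly_Mapping.single i r + f) i"
        by simp
      with that have "e i = r + Poly_Mapping.lookup f i" by (simp add: lookup_add)
      with False show False by simp
    qed
    then show ?thesis
      unfolding x_var_power[of i r] if_not_P[OF False] by (rule lookup_single_mult_0)
  qed
  then have "(\<Sum>i<N. Poly_Mapping.lookup (x_var i ^ r * ?p) (expo N e))
      = (\<Sum>i<N. if r \<le> e i then mono_coeff N (e(i := e i - r)) \<mu> else 0)"
    by (intro sum.cong) simp_all
  then show ?thesis
    by (simp only: mono_coeff_def image_mset_add_mset prod_mset.add_mset sum_distrib_right lookup_sum)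
qed

lemma mono_coeff_cong:
  assumes "\<And>i. i < N \<Longrightarrow> e i = e' i" shows "mono_coeff N e = mono_coeff N e'"
proof -
  have "expo N e = expo N e'" using assms by (auto simp: poly_mapping_eq_iff fun_eq_iff)
  then show ?thesis by (simp add: mono_coeff_def[abs_def])
qed

lemma mono_coeff_permute:
  assumes "p permutes {..<N}"
  shows "mono_coeff N (e \<circ> p) \<mu> = mono_coeff N e \<mu>"
proof (induction \<mu> arbitrary: e)
  case empty
  have "(\<forall>i<N. (e \<circ> p) i = 0) \<longleftrightarrow> (\<forall>i<N. e i = 0)"
  proof
    assume *: "\<forall>i<N. (e \<circ> p) i = 0"
    show "\<forall>i<N. e i = 0"
    proof (intro allI impI)
      fix i assume "i < N"
      then have "inv p i < N" using permutes_in_image[OF permutes_inv[OF assms]] by auto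
      with * show "e i = 0" using permutes_inverses(1)[OF assms] by (metis comp_apply)
    qed
  next
    assume "\<forall>i<N. e i = 0"
    then show "\<forall>i<N. (e \<circ> p) i = 0" using permutes_in_image[OF assms] by auto
  qed
  then show ?case by (simp add: mono_coeff_empty)
next
  case (add r \<mu>)
  let ?f = "\<lambda>i. if r \<le> e i then mono_coeff N (e(i := e i - r)) \<mu> else 0"
  have upd: "(e \<circ> p)(i := v) = e(p i := v) \<circ> p" for i v
    using permutes_inj[OF assms] by (auto simp: fun_eq_iff inj_def)
  have "mono_coeff N (e \<circ> p) (add_mset r \<mu>) = (\<Sum>i<N. ?f (p i))"
    unfolding mono_coeff_add_mset upd add.IH comp_apply ..
  also have "\<dots> = (\<Sum>i<N. ?f i)"
    using sum.permute[OF assms, of ?f] by (simp add: comp_def)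
  also have "\<dots> = mono_coeff N e (add_mset r \<mu>)"
    by (simp only: mono_coeff_add_mset[of N e])
  finally show ?case .
qed

text \<open>Zeros are kept, because a variable with exponent 0 still takes part in the exchange
  terms of the Dunkl operator.\<close>

definition shape :: "nat \<Rightarrow> (nat \<Rightarrow> nat) \<Rightarrow> nat multiset" where
  "shape N e = image_mset e (mset_set {..<N})"

lemma mono_coeff_shape:
  assumes "shape N e = shape N e'"
  shows "mono_coeff N e = mono_coeff N e'"
proof -
  obtain p where p: "p permutes {..<N}" "\<forall>i\<in>{..<N}. e i = e' (p i)"
    by (rule image_mset_eq_implies_permutes[OF finite_lessThan assms[unfolded shape_def]])
  have "mono_coeff N e = mono_coeff N (e' \<circ> p)"
    by (rule mono_coeff_cong) (simp add: p(2))
  also have "\<dots> = mono_coeff N e'"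
    by (rule ext) (rule mono_coeff_permute[OF p(1)])
  finally show ?thesis .
qed

lemma mono_coeff_add_mset_nonzeroE:
  assumes "mono_coeff N e (add_mset r \<mu>) \<noteq> 0"
  obtains i where "i < N" "r \<le> e i" "mono_coeff N (e(i := e i - r)) \<mu> \<noteq> 0"
proof -
  obtain i where "i \<in> {..<N}" "(if r \<le> e i then mono_coeff N (e(i := e i - r)) \<mu> else 0) \<noteq> 0"
    using assms unfolding mono_coeff_add_mset by (rule sum.not_neutral_contains_not_neutral)
  then show thesis by (intro that[of i]) (simp_all split: if_splits)
qed

lemma sum_fun_upd_diff:
  fixes e :: "nat \<Rightarrow> nat"
  assumes "i < N" "r \<le> e i"
  shows "(\<Sum>j<N. e j) = (\<Sum>j<N. (e(i := e i - r)) j) + r"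
proof -
  have "(\<Sum>j\<in>{..<N}-{i}. (e(i := e i - r)) j) = (\<Sum>j\<in>{..<N}-{i}. e j)"
    by (rule sum.cong) auto
  then show ?thesis using assms by (simp add: sum.remove[of "{..<N}" i])
qed

lemma mono_coeff_degree:
  "mono_coeff N e \<mu> \<noteq> 0 \<Longrightarrow> sum_mset \<mu> = (\<Sum>i<N. e i)"
proof (induction \<mu> arbitrary: e)
  case empty
  then have "\<forall>i<N. e i = 0" unfolding mono_coeff_empty by presburger
  then show ?case by simp
next
  case (add r \<mu>)
  from add.prems obtain i where i: "i < N" "r \<le> e i" "mono_coeff N (e(i := e i - r)) \<mu> \<noteq> 0"
    by (rule mono_coeff_add_mset_nonzeroE)
  have "sum_mset (add_mset r \<mu>) = (\<Sum>j<N. (e(i := e i - r)) j) + r"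
    using add.IH[OF i(3)] by simp
  then show ?case using sum_fun_upd_diff[of i N r e] i(1,2) by linarith
qed

text \<open>The coefficient of x^e after the substitution y_{m+1} \<mapsto> x_i^{m+1}, under which L
  becomes a Dunkl operator.\<close>

definition ymono :: "nat \<Rightarrow> nat \<Rightarrow> (nat \<Rightarrow> nat) \<Rightarrow> yfnl" where
  "ymono N i e m \<mu> = (if Suc m \<le> e i then mono_coeff N (e(i := e i - Suc m)) \<mu> else 0)"

lemma Theta_mono_coeff: "Theta (mono_coeff N e) = (\<lambda>m \<mu>. \<Sum>i<N. ymono N i e m \<mu>)"
  by (intro ext) (simp add: Theta_def mono_coeff_add_mset ymono_def)

text \<open>By the chain rule the sum of x_i^j p_j^* over all j is x_i \<partial>/\<partial>x_i,
  which multiplies x^e by its exponent e_i.\<close>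

lemma psum_mono_coeff:
  assumes "i < N"
  shows "psum (\<lambda>j \<nu>. if j \<le> e i then mono_coeff N (e(i := e i - j)) \<nu> else 0) \<mu> = of_nat (e i) * mono_coeff N e \<mu>"
proof (induction \<mu> arbitrary: e)
  case empty
  show ?case
  proof (cases "e i = 0")
    case False
    with assms have "\<not> (\<forall>i<N. e i = 0)" by metis
    then have "mono_coeff N e {#} = 0" unfolding mono_coeff_empty by (rule if_not_P)
    then show ?thesis by (simp only: psum_empty mult_zero_right)
  next
    case True
    then show ?thesis by (simp only: psum_empty of_nat_0 mult_zero_left)
  qed
next
  case (add r \<mu>)
  let ?X = "mono_coeff N"
  \<comment> \<open>The factor p_r takes x_l^r from some variable; l = i competes with j for the
    exponent of x_i, the other l do not.\<close>
  have inner: "(if j \<le> e i then ?X (e(i := e i - j)) (add_mset r \<nu>) else 0)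
     = (if r \<le> e i then (if j \<le> e i - r then ?X (e(i := e i - r, i := e i - r - j)) \<nu> else 0) else 0)
     + (\<Sum>l\<in>{..<N}-{i}. if r \<le> e l then
          (if j \<le> e i then ?X (e(l := e l - r, i := e i - j)) \<nu> else 0) else 0)" for j \<nu>
  proof (cases "j \<le> e i")
    case True
    let ?g = "\<lambda>l. if r \<le> (e(i := e i - j)) l
      then ?X (e(i := e i - j, l := (e(i := e i - j)) l - r)) \<nu> else 0"
    have "?X (e(i := e i - j)) (add_mset r \<nu>) = ?g i + (\<Sum>l\<in>{..<N}-{i}. ?g l)"
      unfolding mono_coeff_add_mset using assms by (subst sum.remove[of _ i]) auto
    moreover have "(\<Sum>l\<in>{..<N}-{i}. ?g l) = (\<Sum>l\<in>{..<N}-{i}. if r \<le> e l then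
          (if j \<le> e i then ?X (e(l := e l - r, i := e i - j)) \<nu> else 0) else 0)"
      using True by (intro sum.cong refl) (auto simp: fun_upd_twist)
    moreover have "?g i = (if r \<le> e i then (if j \<le> e i - r then ?X (e(i := e i - r, i := e i - r - j)) \<nu> else 0) else 0)"
      using True by (auto simp: add.commute[of r j])
    ultimately show ?thesis unfolding if_P[OF True] by (simp only:)
  next
    case False
    then have "\<not> j \<le> e i - r" by linarith
    with False show ?thesis by (simp cong: if_cong)
  qed
  have 1: "psum (\<lambda>j \<nu>. if r \<le> e i then (if j \<le> e i - r then ?X (e(i := e i - r, i := e i - r - j)) \<nu> else 0) else 0) \<mu>
     = (if r \<le> e i then of_nat (e i - r) * ?X (e(i := e i - r)) \<mu> else 0)"
    using add.IH[of "e(i := e i - r)"] unfolding fun_upd_same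
    by (cases "r \<le> e i") (simp_all only: if_True if_False psum_zero)
  have 2: "psum (\<lambda>j \<nu>. if r \<le> e l then (if j \<le> e i then ?X (e(l := e l - r, i := e i - j)) \<nu> else 0) else 0) \<mu>
     = (if r \<le> e l then of_nat (e i) * ?X (e(l := e l - r)) \<mu> else 0)" if "l \<noteq> i" for l
    using add.IH[of "e(l := e l - r)"] unfolding fun_upd_other[OF that[symmetric]]
    by (cases "r \<le> e l") (simp_all only: if_True if_False psum_zero)
  have "psum (\<lambda>j \<nu>. if j \<le> e i then ?X (e(i := e i - j)) \<nu> else 0) (add_mset r \<mu>)
     = of_nat r * (if r \<le> e i then ?X (e(i := e i - r)) \<mu> else 0)
     + ((if r \<le> e i then of_nat (e i - r) * ?X (e(i := e i - r)) \<mu> else 0)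
     + (\<Sum>l\<in>{..<N}-{i}. if r \<le> e l then of_nat (e i) * ?X (e(l := e l - r)) \<mu> else 0))"
    proof -
    have "(\<Sum>l\<in>{..<N}-{i}. psum (\<lambda>j \<nu>. if r \<le> e l then
        (if j \<le> e i then ?X (e(l := e l - r, i := e i - j)) \<nu> else 0) else 0) \<mu>)
      = (\<Sum>l\<in>{..<N}-{i}. if r \<le> e l then of_nat (e i) * ?X (e(l := e l - r)) \<mu> else 0)"
      by (intro sum.cong refl 2) simp
    then show ?thesis unfolding psum_add_mset inner psum_add psum_sum 1 by (simp only:)
  qed
  also have "\<dots> = of_nat (e i) * ?X e (add_mset r \<mu>)"
  proof -
    have "?X e (add_mset r \<mu>) = (if r \<le> e i then ?X (e(i := e i - r)) \<mu> else 0)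
        + (\<Sum>l\<in>{..<N}-{i}. if r \<le> e l then ?X (e(l := e l - r)) \<mu> else 0)"
      unfolding mono_coeff_add_mset using assms by (subst sum.remove[of _ i]) auto
    moreover have "(\<Sum>l\<in>{..<N}-{i}. if r \<le> e l then of_nat (e i) * ?X (e(l := e l - r)) \<mu> else 0)
        = of_nat (e i) * (\<Sum>l\<in>{..<N}-{i}. if r \<le> e l then ?X (e(l := e l - r)) \<mu> else 0)"
      unfolding sum_distrib_left by (intro sum.cong) auto
    moreover have "of_nat r * (if r \<le> e i then ?X (e(i := e i - r)) \<mu> else 0)
        + (if r \<le> e i then of_nat (e i - r) * ?X (e(i := e i - r)) \<mu> else 0)
        = of_nat (e i) * (if r \<le> e i then ?X (e(i := e i - r)) \<mu> else 0)"
      by (cases "r \<le> e i") (simp_all add: of_nat_diff ring_distribs)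
    ultimately show ?thesis
      by (simp only: distrib_left add.assoc[symmetric])
  qed
  finally show ?case .
qed

lemma Nabla_ymono:
  assumes "i < N" shows "Nabla (ymono N i e) \<mu> = of_nat (e i) * mono_coeff N e \<mu>"
proof -
  have "Nabla (ymono N i e) \<mu> =
      psum (\<lambda>j \<nu>. if j \<le> e i then mono_coeff N (e(i := e i - j)) \<nu> else 0) \<mu>"
    unfolding Nabla_def
  proof (rule psum_cong_pos)
    fix j :: nat and \<nu> :: "nat multiset" assume "0 < j"
    then have "Suc (j - 1) = j" by simp
    then show "ymono N i e (j - 1) \<nu> = (if j \<le> e i then mono_coeff N (e(i := e i - j)) \<nu> else 0)"
      unfolding ymono_def by (simp only:)
  qed
  also have "\<dots> = of_nat (e i) * mono_coeff N e \<mu>"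
    by (rule psum_mono_coeff[OF assms])
  finally show ?thesis .
qed

section \<open>The Lax operator on monomials\<close>

lemma sum_reflect_atMost:
  "(\<Sum>p | p \<le> D \<and> Q (D - p). g (D - p)) = (\<Sum>p | p \<le> D \<and> Q p. g p)" for D :: nat
  by (rule sum.reindex_bij_witness[of _ "\<lambda>p. D - p" "\<lambda>p. D - p"]) auto

text \<open>In coefficients, with k = m + 1: the sum of x_i^{s+1} x_j^{m-s} over s < m equals (x_j
  x_i^k - x_i x_j^k) / (x_i - x_j). Here g collects coefficients of a symmetric function and p
  \<mapsto> D - p exchanges the two variables.\<close>

lemma sum_cross_symmetric:
  fixes g :: "nat \<Rightarrow> 'a::ab_group_add"
  assumes sym: "\<And>p. p \<le> D \<Longrightarrow> g (D - p) = g p" and D: "D + k = x + y" and k: "0 < k"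
  shows "(\<Sum>p | p \<le> D \<and> x < p + k \<and> p < x. g p) =
    (\<Sum>p | p \<le> D \<and> max x y < p + k. g p) - (\<Sum>p | p \<le> D \<and> p + k \<le> min x y. g p)"
proof -
  have reflect: "(\<Sum>p | p \<le> D \<and> Q (D - p). g p) = (\<Sum>p | p \<le> D \<and> Q p. g p)" for Q
  proof -
    have "(\<Sum>p | p \<le> D \<and> Q (D - p). g p) = (\<Sum>p | p \<le> D \<and> Q (D - p). g (D - p))"
      by (rule sum.cong) (simp_all add: sym)
    then show ?thesis by (simp only: sum_reflect_atMost)
  qed
  have "(\<Sum>p | p \<le> D \<and> p + k \<le> min x y. g p) = (\<Sum>p | p \<le> D \<and> max x y \<le> D - p. g p)"
  proof (rule arg_cong[where f = "sum g"])
    show "{p. p \<le> D \<and> p + k \<le> min x y} = {p. p \<le> D \<and> max x y \<le> D - p}"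
      using D by (auto simp: min_def max_def)
  qed
  then have 1: "(\<Sum>p | p \<le> D \<and> p + k \<le> min x y. g p) = (\<Sum>p | p \<le> D \<and> max x y \<le> p. g p)"
    using reflect[of "\<lambda>p. max x y \<le> p"] by (simp only:)
  have 2: "(\<Sum>p | p \<le> D \<and> max x y < p + k. g p) =
      (\<Sum>p | p \<le> D \<and> max x y < p + k \<and> p < max x y. g p) + (\<Sum>p | p \<le> D \<and> max x y \<le> p. g p)"
  proof (subst sum.union_disjoint[symmetric])
    show "(\<Sum>p | p \<le> D \<and> max x y < p + k. g p) =
      sum g ({p. p \<le> D \<and> max x y < p + k \<and> p < max x y} \<union> {p. p \<le> D \<and> max x y \<le> p})"
      using k by (intro arg_cong[where f = "sum g"]) auto
  qed auto
  have 3: "(\<Sum>p | p \<le> D \<and> max x y < p + k \<and> p < max x y. g p) = (\<Sum>p | p \<le> D \<and> x < p + k \<and> p < x. g p)"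
  proof (cases "y \<le> x")
    case False
    then have m: "max x y = y" by simp
    \<comment> \<open>Because (D - p) + k = x + y - p, the window of length k - 1 below y is the
      mirror image of the one below x.\<close>
    have "{p. p \<le> D \<and> y < p + k \<and> p < y} = {p. p \<le> D \<and> (x < (D - p) + k \<and> D - p < x)}"
      using D by auto
    then show ?thesis
      unfolding m using reflect[of "\<lambda>p. x < p + k \<and> p < x"] by (simp only:)
  qed (simp add: max_def)
  show ?thesis unfolding 1 2 3 by simp
qed

definition transfer :: "(nat \<Rightarrow> nat) \<Rightarrow> nat \<Rightarrow> nat \<Rightarrow> nat \<Rightarrow> nat \<Rightarrow> nat" where
  "transfer e i j a = e(i := a, j := e i + e j - a)"

lemma shape_upd2:
  assumes "i < N" "j < N" "i \<noteq> j"
  shows "\<exists>M. shape N e = add_mset (e i) (add_mset (e j) M) \<and>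
    (\<forall>p q. shape N (e(i := p, j := q)) = add_mset p (add_mset q M))"
proof (intro exI conjI allI)
  have *: "mset_set {..<N} = add_mset i (add_mset j (mset_set ({..<N} - {i} - {j})))"
    using assms mset_set.remove[of "{..<N}" i] mset_set.remove[of "{..<N} - {i}" j] by simp
  let ?M = "image_mset e (mset_set ({..<N} - {i} - {j}))"
  have "image_mset (e(i := p, j := q)) (mset_set ({..<N} - {i} - {j})) = ?M" for p q
    by (rule image_mset_cong) auto
  with assms show "shape N (e(i := p, j := q)) = add_mset p (add_mset q ?M)" for p q
    unfolding shape_def * by simp
  show "shape N e = add_mset (e i) (add_mset (e j) ?M)"
    unfolding shape_def * by simp
qed

lemma shape_swap_upd:
  assumes "i < N" "j < N" "i \<noteq> j"
  shows "shape N (e(i := p, j := q)) = shape N (e(i := q, j := p))"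
  using shape_upd2[OF assms, of e] by (auto simp: add_mset_commute)

text \<open>The contribution of \<open>x\<^sub>i, x\<^sub>j\<close> to the Dunkl operator,
  \<open>g \<mapsto> (x\<^sub>j g - x\<^sub>i s\<^bsub>ij\<^esub> g) / (x\<^sub>i - x\<^sub>j)\<close>, in terms of coefficients.\<close>

definition exchange :: "(nat \<Rightarrow> (nat \<Rightarrow> nat) \<Rightarrow> 'a::ab_group_add) \<Rightarrow> (nat \<Rightarrow> nat) \<Rightarrow> nat \<Rightarrow> nat \<Rightarrow> 'a" where
  "exchange F e i j = (\<Sum>a\<in>{max (e i) (e j)<..e i + e j}. F a (transfer e i j a))
     - (\<Sum>a\<le>min (e i) (e j). F a (transfer e i j a))"

lemma exchange_eq_0:
  assumes "\<And>a. a \<le> e i + e j \<Longrightarrow> max (e i) (e j) < a \<or> a \<le> min (e i) (e j) \<Longrightarrow> F a (transfer e i j a) = 0"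
  shows "exchange F e i j = 0"
proof -
  have "(\<Sum>a\<in>{max (e i) (e j)<..e i + e j}. F a (transfer e i j a)) = 0"
    "(\<Sum>a\<le>min (e i) (e j). F a (transfer e i j a)) = 0"
    using assms by (auto intro!: sum.neutral)
  then show ?thesis by (simp add: exchange_def)
qed

text \<open>The transfer at a = min keeps or swaps the two exponents; it is the only one in
  \<open>exchange\<close> that does not spread them apart.\<close>

lemma exchange_top:
  assumes "\<And>a. a \<le> e i + e j \<Longrightarrow> max (e i) (e j) < a \<or> a < min (e i) (e j) \<Longrightarrow> F a (transfer e i j a) = 0"
  shows "exchange F e i j = - F (min (e i) (e j)) (transfer e i j (min (e i) (e j)))"
proof -
  have "(\<Sum>a\<in>{max (e i) (e j)<..e i + e j}. F a (transfer e i j a)) = 0"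
    "(\<Sum>a<min (e i) (e j). F a (transfer e i j a)) = 0"
    using assms by (auto intro!: sum.neutral)
  then show ?thesis by (simp add: exchange_def lessThan_Suc_atMost[symmetric])
qed

lemma splitting_ymono:
  assumes "i < N"
  shows "splitting (ymono N i e) m \<mu> = of_nat m * ymono N i e m \<mu>
    + (\<Sum>j\<in>{..<N}-{i}. \<Sum>s<m. if Suc s \<le> e i then if m - s \<le> e j
        then mono_coeff N (e(i := e i - Suc s, j := e j - (m - s))) \<mu> else 0 else 0)"
proof -
  have "ymono N i e s (add_mset (m - s) \<mu>) = ymono N i e m \<mu>
      + (\<Sum>j\<in>{..<N}-{i}. if Suc s \<le> e i then if m - s \<le> e j
          then mono_coeff N (e(i := e i - Suc s, j := e j - (m - s))) \<mu> else 0 else 0)" if "s < m" for s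
  proof (cases "Suc s \<le> e i")
    case True
    let ?e = "e(i := e i - Suc s)"
    let ?g = "\<lambda>l. if m - s \<le> ?e l then mono_coeff N (?e(l := ?e l - (m - s))) \<mu> else 0"
    have "ymono N i e s (add_mset (m - s) \<mu>) = ?g i + (\<Sum>l\<in>{..<N}-{i}. ?g l)"
      unfolding ymono_def if_P[OF True] mono_coeff_add_mset using assms by (intro sum.remove) auto
    moreover have "?g i = ymono N i e m \<mu>"
    proof -
      have "m - s \<le> e i - Suc s \<longleftrightarrow> Suc m \<le> e i" "e i - Suc s - (m - s) = e i - Suc m"
        using that True by auto
      then show ?thesis unfolding ymono_def fun_upd_same fun_upd_upd by (simp only:)
    qed
    moreover have "(\<Sum>l\<in>{..<N}-{i}. ?g l) = (\<Sum>j\<in>{..<N}-{i}. if m - s \<le> e j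
          then mono_coeff N (e(i := e i - Suc s, j := e j - (m - s))) \<mu> else 0)"
      by (rule sum.cong) auto
    ultimately show ?thesis unfolding if_P[OF True] by (simp only:)
  next
    case False
    with that show ?thesis by (simp add: ymono_def)
  qed
  then have "splitting (ymono N i e) m \<mu> = (\<Sum>s<m. ymono N i e m \<mu>
      + (\<Sum>j\<in>{..<N}-{i}. if Suc s \<le> e i then if m - s \<le> e j
          then mono_coeff N (e(i := e i - Suc s, j := e j - (m - s))) \<mu> else 0 else 0))"
    unfolding splitting_def by (intro sum.cong) simp_all
  then show ?thesis
    unfolding sum.distrib by (subst sum.swap) simp
qed

text \<open>After x_i^{m+1} is taken out, x_i \<partial>/\<partial>x_i acts on the exponent e_i - m
  - 1 that is left.\<close>

lemma joining_ymono:
  assumes "i < N"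
  shows "joining (ymono N i e) m \<mu> = (of_nat (e i) - of_nat (Suc m)) * ymono N i e m \<mu>"
proof (cases "Suc m \<le> e i")
  case True
  let ?e = "e(i := e i - Suc m)"
  have "joining (ymono N i e) m \<mu> = psum (\<lambda>j \<nu>. if j \<le> ?e i then mono_coeff N (?e(i := ?e i - j)) \<nu> else 0) \<mu>"
    unfolding joining_def
  proof (rule psum_cong)
    fix j :: nat and \<nu> :: "nat multiset"
    have "Suc (m + j) \<le> e i \<longleftrightarrow> j \<le> e i - Suc m" "e i - Suc (m + j) = e i - Suc m - j"
      using True by auto
    then show "ymono N i e (m + j) \<nu> = (if j \<le> ?e i then mono_coeff N (?e(i := ?e i - j)) \<nu> else 0)"
      unfolding ymono_def fun_upd_same fun_upd_upd by (simp only:)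
  qed
  also have "\<dots> = of_nat (?e i) * mono_coeff N ?e \<mu>"
    by (rule psum_mono_coeff[OF assms])
  finally show ?thesis
    using True by (simp add: ymono_def of_nat_diff)
next
  case False
  have "joining (ymono N i e) m \<mu> = psum (\<lambda>j \<nu>. 0) \<mu>"
    unfolding joining_def by (rule psum_cong) (use False in \<open>simp add: ymono_def\<close>)
  with False show ?thesis by (simp add: ymono_def)
qed

lemma cross_ymono:
  assumes "i < N" "j < N" "i \<noteq> j"
  shows "(\<Sum>s<m. if Suc s \<le> e i then if m - s \<le> e j
        then mono_coeff N (e(i := e i - Suc s, j := e j - (m - s))) \<mu> else 0 else 0)
    = exchange (\<lambda>a e. ymono N i e m \<mu>) e i j"
proof (cases "Suc m \<le> e i + e j")
  case False
  then have "\<not> (Suc s \<le> e i \<and> m - s \<le> e j)" if "s < m" for s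
    using that by auto
  then have "(\<Sum>s<m. if Suc s \<le> e i then if m - s \<le> e j
        then mono_coeff N (e(i := e i - Suc s, j := e j - (m - s))) \<mu> else 0 else 0) = 0"
    by (intro sum.neutral) auto
  moreover have "ymono N i (transfer e i j a) m \<mu> = 0" if "a \<le> e i + e j" for a
    using False that assms by (simp add: ymono_def transfer_def)
  ultimately show ?thesis
    by (simp add: exchange_eq_0)
next
  case True
  define x y D where "x = e i" "y = e j" "D = e i + e j - Suc m"
  note defs = x_y_D_def
  define g where "g p = mono_coeff N (e(i := p, j := D - p)) \<mu>" for p
  have D: "D + Suc m = x + y" using True by (simp add: defs)
  have sym: "g (D - p) = g p" if "p \<le> D" for p
    using mono_coeff_shape[OF shape_swap_upd[OF assms, of e p "D - p"]] that by (simp add: g_def)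
  have "(\<Sum>s<m. if Suc s \<le> e i then if m - s \<le> e j
        then mono_coeff N (e(i := e i - Suc s, j := e j - (m - s))) \<mu> else 0 else 0)
      = (\<Sum>s<m. if Suc s \<le> x \<and> m - s \<le> y then g (x - Suc s) else 0)"
  proof (rule sum.cong[OF refl])
    fix s assume "s \<in> {..<m}"
    then have "e j - (m - s) = D - (x - Suc s)" if "Suc s \<le> e i" "m - s \<le> e j"
      using that True by (simp add: defs)
    then show "(if Suc s \<le> e i then if m - s \<le> e j
        then mono_coeff N (e(i := e i - Suc s, j := e j - (m - s))) \<mu> else 0 else 0)
      = (if Suc s \<le> x \<and> m - s \<le> y then g (x - Suc s) else 0)"
      unfolding g_def by (simp add: defs(1,2))
  qed
  also have "\<dots> = (\<Sum>s\<in>{s\<in>{..<m}. Suc s \<le> x \<and> m - s \<le> y}. g (x - Suc s))"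
    by (rule sum.inter_filter[symmetric]) simp
  also have "\<dots> = (\<Sum>p | p \<le> D \<and> x < p + Suc m \<and> p < x. g p)"
    by (rule sum.reindex_bij_witness[of _ "\<lambda>p. x - Suc p" "\<lambda>s. x - Suc s"]) (use D in auto)
  also have "\<dots> = (\<Sum>p | p \<le> D \<and> max x y < p + Suc m. g p) - (\<Sum>p | p \<le> D \<and> p + Suc m \<le> min x y. g p)"
    by (rule sum_cross_symmetric[of D g, OF sym D zero_less_Suc])
  also have "(\<Sum>p | p \<le> D \<and> max x y < p + Suc m. g p)
      = (\<Sum>a\<in>{a\<in>{max x y<..x + y}. Suc m \<le> a}. g (a - Suc m))"
    by (rule sum.reindex_bij_witness[of _ "\<lambda>a. a - Suc m" "\<lambda>p. p + Suc m"]) (use D in auto)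
  also have "\<dots> = (\<Sum>a\<in>{max x y<..x + y}. if Suc m \<le> a then g (a - Suc m) else 0)"
    by (rule sum.inter_filter) simp
  also have "(\<Sum>p | p \<le> D \<and> p + Suc m \<le> min x y. g p)
      = (\<Sum>a\<in>{a\<in>{..min x y}. Suc m \<le> a}. g (a - Suc m))"
    by (rule sum.reindex_bij_witness[of _ "\<lambda>a. a - Suc m" "\<lambda>p. p + Suc m"]) (use D in auto)
  also have "\<dots> = (\<Sum>a\<le>min x y. if Suc m \<le> a then g (a - Suc m) else 0)"
    by (rule sum.inter_filter) simp
  finally have *: "(\<Sum>s<m. if Suc s \<le> e i then if m - s \<le> e j
        then mono_coeff N (e(i := e i - Suc s, j := e j - (m - s))) \<mu> else 0 else 0)
      = (\<Sum>a\<in>{max x y<..x + y}. if Suc m \<le> a then g (a - Suc m) else 0)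
        - (\<Sum>a\<le>min x y. if Suc m \<le> a then g (a - Suc m) else 0)" .
  have "ymono N i (transfer e i j a) m \<mu> = (if Suc m \<le> a then g (a - Suc m) else 0)" if "a \<le> x + y" for a
  proof -
    have "e i + e j - a = D - (a - Suc m)" if "Suc m \<le> a"
      using that \<open>a \<le> x + y\<close> D by (simp add: defs(1,2))
    then show ?thesis
      using assms(3) by (simp add: ymono_def transfer_def g_def fun_upd_twist)
  qed
  then show ?thesis
    unfolding * exchange_def unfolding defs(1,2)[symmetric] by (intro arg_cong2[of _ _ _ _ "(-)"] sum.cong) auto
qed

text \<open>The diagonal contributions m + \<alpha> (e_i - m - 1) + b m reduce to \<alpha> (e_i -
  1), free of m, because \<alpha> = 1 + b. This makes L act on monomials independently of the degree
  of y.\<close>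

lemma Lax_ymono:
  assumes "i < N"
  shows "Lax (ymono N i e) = (\<lambda>m \<mu>. \<alpha> * (of_nat (e i) - 1) * ymono N i e m \<mu>
    + (\<Sum>j\<in>{..<N}-{i}. exchange (\<lambda>a e. ymono N i e m \<mu>) e i j))"
proof (rule ext, rule ext)
  fix m \<mu>
  let ?C = "exchange (\<lambda>a e. ymono N i e m \<mu>) e i"
  have "splitting (ymono N i e) m \<mu> = of_nat m * ymono N i e m \<mu> + (\<Sum>j\<in>{..<N}-{i}. ?C j)"
    unfolding splitting_ymono[OF assms]
    by (intro arg_cong2[of _ _ _ _ "(+)"] refl sum.cong cross_ymono) (use assms in auto)
  then show "Lax (ymono N i e) m \<mu> = \<alpha> * (of_nat (e i) - 1) * ymono N i e m \<mu> + (\<Sum>j\<in>{..<N}-{i}. ?C j)"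
    unfolding Lax_def joining_ymono[OF assms] by (simp add: algebra_simps)
qed

section \<open>Triangularity\<close>

text \<open>The dominance order in the form of inequalities between the sums of \<open>max (x - t) 0\<close>
  (the natural-number subtraction is meant to be truncated), which ignores the order of the entries.\<close>

definition excess :: "nat multiset \<Rightarrow> nat \<Rightarrow> nat" where
  "excess A t = (\<Sum>x\<in>#A. x - t)"

definition below :: "nat multiset \<Rightarrow> nat multiset \<Rightarrow> bool" where
  "below A B \<longleftrightarrow> (\<forall>t. excess A t \<le> excess B t)"

definition strictly_below :: "nat multiset \<Rightarrow> nat multiset \<Rightarrow> bool" where
  "strictly_below A B \<longleftrightarrow> below A B \<and> \<not> below B A"

lemma below_refl [simp]: "below A A"
  by (simp add: below_def)

lemma below_trans: "below A B \<Longrightarrow> below B C \<Longrightarrow> below A C"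
  unfolding below_def by (meson le_trans)

lemma strictly_below_trans: "strictly_below A B \<Longrightarrow> below B C \<Longrightarrow> strictly_below A C"
  unfolding strictly_below_def using below_trans by blast

text \<open>Such a transfer moves two entries apart with their sum fixed, and x \<mapsto> max (x -
  t) 0 is convex.\<close>

lemma shape_transfer_below:
  assumes "i < N" "j < N" "i \<noteq> j" "a \<le> e i + e j" "max (e i) (e j) < a \<or> a \<le> min (e i) (e j)"
  shows "below (shape N e) (shape N (transfer e i j a))"
proof -
  obtain M where M: "shape N e = add_mset (e i) (add_mset (e j) M)"
    "\<And>p q. shape N (e(i := p, j := q)) = add_mset p (add_mset q M)"
    using shape_upd2[OF assms(1-3), of e] by blast
  have "(e i - t) + (e j - t) \<le> (a - t) + (e i + e j - a - t)" for t
    using assms(4,5) by arith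
  then show ?thesis
    unfolding below_def excess_def transfer_def M by simp
qed

lemma shape_transfer_strictly_below:
  assumes "i < N" "j < N" "i \<noteq> j" "a \<le> e i + e j" "max (e i) (e j) < a \<or> a < min (e i) (e j)"
  shows "strictly_below (shape N e) (shape N (transfer e i j a))"
proof -
  obtain M where M: "shape N e = add_mset (e i) (add_mset (e j) M)"
    "\<And>p q. shape N (e(i := p, j := q)) = add_mset p (add_mset q M)"
    using shape_upd2[OF assms(1-3), of e] by blast
  let ?t = "max (e i) (e j)"
  have "?t < a \<or> ?t < e i + e j - a"
    using assms(4,5) by (auto simp: max_def min_def)
  then have "0 < (a - ?t) + (e i + e j - a - ?t)" by linarith
  moreover have "e i - ?t = 0" "e j - ?t = 0" by simp_all
  ultimately have "(e i - ?t) + (e j - ?t) < (a - ?t) + (e i + e j - a - ?t)" by linarith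
  then have "\<not> excess (shape N (transfer e i j a)) ?t \<le> excess (shape N e) ?t"
    unfolding excess_def transfer_def M image_mset_add_mset sum_mset.add_mset by linarith
  then have "\<not> below (shape N (transfer e i j a)) (shape N e)"
    unfolding below_def by blast
  with shape_transfer_below[OF assms(1-4)] assms(5) show ?thesis
    unfolding strictly_below_def by auto
qed

lemma shape_transfer_min:
  assumes "i < N" "j < N" "i \<noteq> j"
  shows "shape N (transfer e i j (min (e i) (e j))) = shape N e"
proof -
  obtain M where M: "shape N e = add_mset (e i) (add_mset (e j) M)"
    "\<And>p q. shape N (e(i := p, j := q)) = add_mset p (add_mset q M)"
    using shape_upd2[OF assms, of e] by blast
  show ?thesis unfolding transfer_def M by (cases "e i \<le> e j") (simp_all add: min_def)
qed

lemma sum_transfer: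
  assumes "i < N" "j < N" "i \<noteq> j" "a \<le> e i + e j"
  shows "sum (transfer e i j a) {..<N} = sum e {..<N}"
proof -
  obtain M where M: "shape N e = add_mset (e i) (add_mset (e j) M)"
    "\<And>p q. shape N (e(i := p, j := q)) = add_mset p (add_mset q M)"
    using shape_upd2[OF assms(1-3), of e] by blast
  have "sum f {..<N} = sum_mset (shape N f)" for f
    by (simp add: shape_def sum_unfold_sum_mset)
  then show ?thesis using assms(4) unfolding transfer_def by (simp only: M) simp
qed

definition pairing :: "nat \<Rightarrow> fnl \<Rightarrow> fnl \<Rightarrow> qb" where
  "pairing n v \<phi> = (\<Sum>\<mu>\<in>partitions n. \<phi> \<mu> * v \<mu>)"

lemma pairing_add: "pairing n v (\<lambda>\<mu>. f \<mu> + g \<mu>) = pairing n v f + pairing n v g"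
  by (simp add: pairing_def distrib_right sum.distrib)

lemma pairing_diff: "pairing n v (\<lambda>\<mu>. f \<mu> - g \<mu>) = pairing n v f - pairing n v g"
  by (simp add: pairing_def left_diff_distrib sum_subtractf)

lemma pairing_cmult: "pairing n v (\<lambda>\<mu>. c * f \<mu>) = c * pairing n v f"
  by (simp add: pairing_def sum_distrib_left mult.assoc)

lemma pairing_sum: "pairing n v (\<lambda>\<mu>. \<Sum>i\<in>A. f i \<mu>) = (\<Sum>i\<in>A. pairing n v (f i))"
  unfolding pairing_def sum_distrib_right by (rule sum.swap)

lemma pairing_cong: "(\<And>\<mu>. \<mu> \<in> partitions n \<Longrightarrow> f \<mu> = g \<mu>) \<Longrightarrow> pairing n v f = pairing n v g"
  by (simp add: pairing_def cong: sum.cong)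

definition ypairing :: "nat \<Rightarrow> fnl \<Rightarrow> nat \<Rightarrow> yfnl \<Rightarrow> qb" where
  "ypairing n v k \<psi> = pairing n v (Nabla ((Lax ^^ k) \<psi>))"

lemma ypairing_add: "ypairing n v k (\<lambda>m \<mu>. f m \<mu> + g m \<mu>) = ypairing n v k f + ypairing n v k g"
  unfolding ypairing_def Laxpow_add pairing_add[symmetric]
  by (rule arg_cong[where f = "pairing n v"]) (rule ext, rule Nabla_add)

lemma ypairing_cmult: "ypairing n v k (\<lambda>m \<mu>. c * f m \<mu>) = c * ypairing n v k f"
  unfolding ypairing_def Laxpow_cmult pairing_cmult[symmetric]
  by (rule arg_cong[where f = "pairing n v"]) (rule ext, rule Nabla_cmult)

lemma ypairing_sum: "ypairing n v k (\<lambda>m \<mu>. \<Sum>i\<in>A. f i m \<mu>) = (\<Sum>i\<in>A. ypairing n v k (f i))"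
  unfolding ypairing_def Laxpow_sum pairing_sum[symmetric]
  by (rule arg_cong[where f = "pairing n v"]) (rule ext, rule Nabla_sum)

lemma ypairing_diff: "ypairing n v k (\<lambda>m \<mu>. f m \<mu> - g m \<mu>) = ypairing n v k f - ypairing n v k g"
  using ypairing_add[of n v k f "\<lambda>m \<mu>. - 1 * g m \<mu>"] ypairing_cmult[of n v k "- 1" g] by simp

lemma ypairing_exchange:
  "ypairing n v k (\<lambda>m \<mu>. exchange (\<lambda>a e. f e m \<mu>) e i j) = exchange (\<lambda>a e. ypairing n v k (f e)) e i j"
  unfolding exchange_def ypairing_diff ypairing_sum ..

lemma ypairing_Suc: "ypairing n v (Suc k) \<psi> = ypairing n v k (Lax \<psi>)"
  by (simp add: ypairing_def funpow_swap1)

text \<open>The Lax operator on the leading block: \<open>qv N e k (e i)\<close> is the value of \<open>L\<^sup>k \<nabla>\<close> at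
  the monomials of shape \<open>e\<close> with distinguished variable \<open>x\<^sub>i\<close>.\<close>

fun qv :: "nat \<Rightarrow> (nat \<Rightarrow> nat) \<Rightarrow> nat \<Rightarrow> nat \<Rightarrow> qb" where
  "qv N e 0 a = of_nat a"
| "qv N e (Suc k) a = \<alpha> * (of_nat a - 1) * qv N e k a
     - ((\<Sum>j<N. qv N e k (min a (e j))) - qv N e k a)"

definition tval :: "nat \<Rightarrow> (nat \<Rightarrow> nat) \<Rightarrow> nat \<Rightarrow> qb" where
  "tval N e k = (\<Sum>i<N. qv N e k (e i))"

lemma sum_shape: "(\<Sum>j<N. f (e j)) = (\<Sum>x\<in>#shape N e. f x)"
  by (simp add: shape_def sum_unfold_sum_mset image_mset.compositionality comp_def)

lemma qv_shape: "shape N e = shape N e' \<Longrightarrow> qv N e k = qv N e' k"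
proof (induction k)
  case (Suc k)
  have "qv N e (Suc k) a = qv N e' (Suc k) a" for a
    unfolding qv.simps sum_shape[of "\<lambda>x. qv N _ k (min a x)"] Suc.prems Suc.IH[OF Suc.prems] ..
  then show ?case by (rule ext)
qed (rule ext, simp)

lemma tval_shape: "shape N e = shape N e' \<Longrightarrow> tval N e k = tval N e' k"
  unfolding tval_def sum_shape[of "qv N _ k"] by (simp only: qv_shape[of N e e'])

text \<open>If v has no coefficients strictly above the shape of e, all exchange terms except a =
  min contribute 0. The two claims are proved together, because the transfers lead from the first
  case into the second.\<close>

lemma ypairing_ymono:
  assumes zero: "\<And>e'. strictly_below (shape N e) (shape N e') \<Longrightarrow> pairing n v (mono_coeff N e') = 0"
    and i: "i < N"
  shows "(shape N e' = shape N e \<longrightarrow>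
      ypairing n v k (ymono N i e') = qv N e k (e' i) * pairing n v (mono_coeff N e)) \<and>
    (strictly_below (shape N e) (shape N e') \<longrightarrow> ypairing n v k (ymono N i e') = 0)"
proof (induction k arbitrary: e')
  case 0
  have "ypairing n v 0 (ymono N i e') = of_nat (e' i) * pairing n v (mono_coeff N e')"
    unfolding ypairing_def funpow_0 pairing_cmult[symmetric]
    by (rule pairing_cong) (rule Nabla_ymono[OF i])
  then show ?case using zero[of e'] mono_coeff_shape[of N e' e] by auto
next
  case (Suc k)
  note IH = Suc.IH[THEN conjunct1, rule_format] Suc.IH[THEN conjunct2, rule_format]
  let ?Y = "\<lambda>e. ypairing n v k (ymono N i e)"
  have step: "ypairing n v (Suc k) (ymono N i e') = \<alpha> * (of_nat (e' i) - 1) * ?Y e'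
    + (\<Sum>j\<in>{..<N}-{i}. exchange (\<lambda>a. ?Y) e' i j)"
    unfolding ypairing_Suc Lax_ymono[OF i] ypairing_add ypairing_cmult ypairing_sum ypairing_exchange ..
  have below_zero: "ypairing n v (Suc k) (ymono N i e') = 0" if "strictly_below (shape N e) (shape N e')"
  proof -
    have "exchange (\<lambda>a. ?Y) e' i j = 0" if "j \<in> {..<N} - {i}" for j
      using that i \<open>strictly_below (shape N e) (shape N e')\<close>
      by (intro exchange_eq_0 IH(2) strictly_below_trans[OF _ shape_transfer_below]) auto
    then show ?thesis
      unfolding step using IH(2)[OF that] by (simp add: sum.neutral)
  qed
  have same: "ypairing n v (Suc k) (ymono N i e') = qv N e (Suc k) (e' i) * pairing n v (mono_coeff N e)"
    if sh: "shape N e' = shape N e"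
  proof -
    let ?C = "pairing n v (mono_coeff N e)"
    have "exchange (\<lambda>a. ?Y) e' i j = - (qv N e k (min (e' i) (e' j)) * ?C)" if j: "j \<in> {..<N} - {i}" for j
    proof -
      have "exchange (\<lambda>a. ?Y) e' i j = - ?Y (transfer e' i j (min (e' i) (e' j)))"
        using i j shape_transfer_strictly_below[of i N j _ e'] unfolding sh by (intro exchange_top IH(2)) auto
      moreover have "shape N (transfer e' i j (min (e' i) (e' j))) = shape N e"
        using shape_transfer_min[of i N j e'] i j sh by auto
      moreover have "transfer e' i j (min (e' i) (e' j)) i = min (e' i) (e' j)"
        using j by (simp add: transfer_def)
      ultimately show ?thesis using IH(1) by metis
    qed
    then have "ypairing n v (Suc k) (ymono N i e') = \<alpha> * (of_nat (e' i) - 1) * (qv N e k (e' i) * ?C)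
      + (\<Sum>j\<in>{..<N}-{i}. - (qv N e k (min (e' i) (e' j)) * ?C))"
      unfolding step IH(1)[OF sh] by (intro arg_cong2[of _ _ _ _ "(+)"] sum.cong) auto
    \<comment> \<open>Summing over all j adds the term j = i, which is \<open>qv\<close> at min a a
      = a; the recursion of \<open>qv\<close> takes it off again.\<close>
    also have "(\<Sum>j\<in>{..<N}-{i}. - (qv N e k (min (e' i) (e' j)) * ?C))
        = - ((\<Sum>j<N. qv N e k (min (e' i) (e' j))) - qv N e k (e' i)) * ?C"
      using i by (simp add: sum_diff1 sum_negf sum_distrib_right left_diff_distrib)
    also have "(\<Sum>j<N. qv N e k (min (e' i) (e' j))) = (\<Sum>j<N. qv N e k (min (e' i) (e j)))"
      unfolding sum_shape[of "\<lambda>x. qv N e k (min (e' i) x)"] sh ..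
    finally show ?thesis by (simp add: algebra_simps)
  qed
  show ?case using same below_zero by blast
qed

lemma pairing_Tk_mono_coeff:
  assumes "\<And>e'. strictly_below (shape N e) (shape N e') \<Longrightarrow> pairing n v (mono_coeff N e') = 0"
  shows "pairing n v (Tk k (mono_coeff N e)) = tval N e k * pairing n v (mono_coeff N e)"
proof -
  have "pairing n v (Tk k (mono_coeff N e)) = (\<Sum>i<N. ypairing n v k (ymono N i e))"
    unfolding Tk_def Theta_mono_coeff ypairing_def[symmetric] ypairing_sum ..
  also have "\<dots> = (\<Sum>i<N. qv N e k (e i) * pairing n v (mono_coeff N e))"
    by (rule sum.cong) (use ypairing_ymono[OF assms] in auto)
  finally show ?thesis by (simp add: tval_def sum_distrib_right)
qed

section \<open>Uniqueness of triangular eigenvectors\<close>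

lemma nat_b_independent:
  assumes "of_nat x + of_nat y * b = of_nat x' + of_nat y' * b"
  shows "x = x' \<and> y = y'"
proof -
  have "of_nat x + of_nat y * b = Fraction_Field.Fract [:of_nat x, of_nat y:] 1" for x y
  proof -
    have "[:of_nat x, of_nat y :: rat:] = of_nat x + of_nat y * [:0, 1:]"
      by (simp add: of_nat_poly)
    then show ?thesis
      unfolding b_def by (simp add: Fraction_Field.Fract_of_nat_eq[symmetric])
  qed
  with assms have "[:of_nat x, of_nat y :: rat:] = [:of_nat x', of_nat y':]"
    by (simp add: eq_fract)
  then show ?thesis by simp
qed

text \<open>T_1 on coefficient functions of exponent vectors. It is stated for an arbitrary u
  because it is also applied to the coefficients of x_1 ... x_N times a Jack polynomial.\<close>

definition raising :: "nat \<Rightarrow> ((nat \<Rightarrow> nat) \<Rightarrow> qb) \<Rightarrow> (nat \<Rightarrow> nat) \<Rightarrow> qb" where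
  "raising N u e = (\<Sum>i<N. \<alpha> * (of_nat (e i) - 1) * (of_nat (e i) * u e)
    + (\<Sum>j\<in>{..<N}-{i}. exchange (\<lambda>a e. of_nat a * u e) e i j))"

lemma pairing_T1_mono_coeff:
  "pairing n v (Tk 1 (mono_coeff N e)) = raising N (\<lambda>e. pairing n v (mono_coeff N e)) e"
proof -
  have 0: "ypairing n v 0 (ymono N i e) = of_nat (e i) * pairing n v (mono_coeff N e)" if "i < N" for i e
    unfolding ypairing_def funpow_0 pairing_cmult[symmetric]
    by (rule pairing_cong) (rule Nabla_ymono[OF that])
  have tr: "transfer e i j a i = a" if "j \<in> {..<N} - {i}" for i j a
    using that by (simp add: transfer_def)
  have "pairing n v (Tk 1 (mono_coeff N e)) = (\<Sum>i<N. ypairing n v 1 (ymono N i e))"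
    unfolding Tk_def Theta_mono_coeff ypairing_def[symmetric] ypairing_sum ..
  also have "\<dots> = raising N (\<lambda>e. pairing n v (mono_coeff N e)) e"
    unfolding raising_def One_nat_def
  proof (rule sum.cong[OF refl])
    fix i assume "i \<in> {..<N}"
    then have i: "i < N" by simp
    show "ypairing n v (Suc 0) (ymono N i e) = \<alpha> * (of_nat (e i) - 1) * (of_nat (e i) * pairing n v (mono_coeff N e))
    + (\<Sum>j\<in>{..<N}-{i}. exchange (\<lambda>a e. of_nat a * pairing n v (mono_coeff N e)) e i j)"
      unfolding ypairing_Suc Lax_ymono[OF i] ypairing_add ypairing_cmult ypairing_sum ypairing_exchange 0[OF i]
      by (intro arg_cong2[of _ _ _ _ "(+)"] sum.cong refl) (simp only: exchange_def tr)
  qed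
  finally show ?thesis .
qed

text \<open>In the usual notation \<open>weight\<close> is 2 n(\<lambda>') and
  \<open>overlap\<close> is 2 n(\<lambda>), so \<alpha> times \<open>weight\<close> minus
  \<open>overlap\<close> is twice the sum of the contents.\<close>

definition weight :: "nat multiset \<Rightarrow> nat" where
  "weight A = (\<Sum>x\<in>#A. x * (x - 1))"

definition overlap :: "nat \<Rightarrow> (nat \<Rightarrow> nat) \<Rightarrow> nat" where
  "overlap N e = (\<Sum>i<N. \<Sum>j\<in>{..<N}-{i}. min (e i) (e j))"

lemma raising_top:
  assumes inv: "\<And>e e'. shape N e = shape N e' \<Longrightarrow> u e = u e'"
  assumes zero: "\<And>i j a. i < N \<Longrightarrow> j < N \<Longrightarrow> i \<noteq> j \<Longrightarrow> a \<le> e i + e j \<Longrightarrow>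
      max (e i) (e j) < a \<or> a < min (e i) (e j) \<Longrightarrow> u (transfer e i j a) = 0"
  shows "raising N u e = (\<alpha> * of_nat (weight (shape N e)) - of_nat (overlap N e)) * u e"
proof -
  have "exchange (\<lambda>a e. of_nat a * u e) e i j = - (of_nat (min (e i) (e j)) * u e)"
    if "i < N" "j < N" "i \<noteq> j" for i j
  proof -
    have "u (transfer e i j (min (e i) (e j))) = u e"
      using that by (intro inv shape_transfer_min)
    then show ?thesis using that zero[of i j] by (subst exchange_top) auto
  qed
  then have "raising N u e = (\<Sum>i<N. \<alpha> * (of_nat (e i) - 1) * (of_nat (e i) * u e)
    + (\<Sum>j\<in>{..<N}-{i}. - (of_nat (min (e i) (e j)) * u e)))"
    unfolding raising_def by (intro sum.cong refl arg_cong2[of _ _ _ _ "(+)"]) auto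
  also have "\<dots> = \<alpha> * (\<Sum>i<N. (of_nat (e i) - 1) * of_nat (e i)) * u e - of_nat (overlap N e) * u e"
    by (simp only: sum.distrib sum_negf overlap_def of_nat_sum sum_distrib_left sum_distrib_right mult.assoc)
  also have "(\<Sum>i<N. (of_nat (e i) - 1) * of_nat (e i)) = (of_nat (weight (shape N e)) :: qb)"
  proof -
    have "(of_nat x - 1) * of_nat x = (of_nat (x * (x - 1)) :: qb)" for x
      by (cases x) (simp_all add: algebra_simps)
    then show ?thesis
      unfolding weight_def sum_shape[of "\<lambda>x. x * (x - 1)", symmetric] of_nat_sum by (intro sum.cong) auto
  qed
  finally show ?thesis by (simp add: left_diff_distrib)
qed

lemma weight_transfer_less:
  assumes "i < N" "j < N" "i \<noteq> j" "a \<le> e i + e j" "max (e i) (e j) < a \<or> a < min (e i) (e j)"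
  shows "weight (shape N e) < weight (shape N (transfer e i j a))"
proof -
  obtain M where M: "shape N e = add_mset (e i) (add_mset (e j) M)"
    "\<And>p q. shape N (e(i := p, j := q)) = add_mset p (add_mset q M)"
    using shape_upd2[OF assms(1-3), of e] by blast
  have sq: "int (x * (x - 1)) = int x * int x - int x" for x
    by (cases x) (simp_all add: algebra_simps)
  define c where "c = e i + e j - a"
  have c: "int c = int (e i) + int (e j) - int a" using assms(4) by (simp add: c_def)
  \<comment> \<open>Twice this product is the growth of the weight: the linear terms cancel, as the
    sum of the two entries is fixed.\<close>
  have "0 < (int a - int (e i)) * (int a - int (e j))"
    using assms(5) by (auto simp: zero_less_mult_iff)
  then have "int (e i * (e i - 1)) + int (e j * (e j - 1)) < int (a * (a - 1)) + int (c * (c - 1))"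
    unfolding sq c by (simp add: algebra_simps)
  then have "e i * (e i - 1) + e j * (e j - 1) < a * (a - 1) + c * (c - 1)"
    by (simp only: of_nat_add[symmetric] of_nat_less_iff)
  then show ?thesis unfolding transfer_def M c_def[symmetric] weight_def by simp
qed

lemma weight_le: "weight A \<le> sum_mset A * sum_mset A"
proof (induction A)
  case (add x A)
  have "x * (x - 1) \<le> x * x" by simp
  with add show ?case by (simp add: weight_def algebra_simps)
qed (simp add: weight_def)

lemma sum_mset_shape: "sum_mset (shape N e) = sum e {..<N}"
  by (simp add: shape_def sum_unfold_sum_mset)

text \<open>At a vector e with u = 0 at all larger weights, \<open>raising\<close> is a scalar whose
  coefficient of b is the weight of e. It can match the eigenvalue only if this weight is W, which
  is excluded where u e is nonzero. Hence the induction descends in the weight.\<close>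

lemma raising_eigenvector_zero:
  assumes inv: "\<And>e e'. shape N e = shape N e' \<Longrightarrow> u e = u e'"
    and eig: "\<And>e. sum e {..<N} = n \<Longrightarrow> raising N u e = (\<alpha> * of_nat W - of_nat B) * u e"
    and supp: "\<And>e. sum e {..<N} = n \<Longrightarrow> u e \<noteq> 0 \<Longrightarrow> weight (shape N e) \<noteq> W"
    and deg: "sum e {..<N} = n"
  shows "u e = 0"
  using deg
proof (induction "n * n - weight (shape N e)" arbitrary: e rule: less_induct)
  case less
  have le: "weight (shape N e) \<le> n * n" if "sum e {..<N} = n" for e
    using weight_le[of "shape N e"] that by (simp add: sum_mset_shape)
  have "raising N u e = (\<alpha> * of_nat (weight (shape N e)) - of_nat (overlap N e)) * u e"
  proof (rule raising_top[OF inv])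
    fix i j a assume *: "i < N" "j < N" "i \<noteq> j" "a \<le> e i + e j" "max (e i) (e j) < a \<or> a < min (e i) (e j)"
    have "sum (transfer e i j a) {..<N} = n"
      using sum_transfer[OF *(1-4)] less.prems by simp
    moreover have "n * n - weight (shape N (transfer e i j a)) < n * n - weight (shape N e)"
      using weight_transfer_less[of i N j a e, OF *] le[OF \<open>sum (transfer e i j a) {..<N} = n\<close>] by linarith
    ultimately show "u (transfer e i j a) = 0" by (rule less.hyps[rotated])
  qed
  then have "(\<alpha> * of_nat (weight (shape N e)) - of_nat (overlap N e)) * u e = (\<alpha> * of_nat W - of_nat B) * u e"
    using eig[OF less.prems] by (rule trans[OF sym])
  moreover have "\<alpha> * of_nat (weight (shape N e)) - of_nat (overlap N e) \<noteq> \<alpha> * of_nat W - of_nat B" if "u e \<noteq> 0"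
  proof
    assume "\<alpha> * of_nat (weight (shape N e)) - of_nat (overlap N e) = \<alpha> * of_nat W - of_nat B"
    then have "of_nat (weight (shape N e) + B) + of_nat (weight (shape N e)) * b = of_nat (W + overlap N e) + of_nat W * b"
      unfolding of_nat_add by algebra
    then have "weight (shape N e) = W" by (rule nat_b_independent[THEN conjunct2])
    with supp[OF less.prems that] show False by (rule notE)
  qed
  ultimately show ?case unfolding mult_cancel_right by blast
qed

section \<open>Nondegeneracy of the monomial functionals\<close>

lemma finite_partitions [simp]: "finite (partitions n)"
proof (rule finite_subset)
  show "partitions n \<subseteq> (\<Union>k\<le>n. {M. set_mset M \<subseteq> {..n} \<and> size M = k})"
  proof
    fix \<mu> assume \<mu>: "\<mu> \<in> partitions n"
    have "x \<le> n" if "x \<in># \<mu>" for x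
      using multi_member_split[OF that] \<mu> by (auto simp: partitions_def)
    moreover have "size \<mu> \<le> n"
      using size_le_sum_mset[of \<mu>] \<mu> by (auto simp: partitions_def)
    ultimately show "\<mu> \<in> (\<Union>k\<le>n. {M. set_mset M \<subseteq> {..n} \<and> size M = k})" by auto
  qed
  show "finite (\<Union>k\<le>n. {M. set_mset M \<subseteq> {..n} \<and> size M = k})"
  proof (rule finite_UN_I[OF finite_atMost])
    show "finite {M. set_mset M \<subseteq> {..n} \<and> size M = k}" for k
      using finite_multisets_of_size[of "{..n}" k] by (simp add: multisets_of_size_def)
  qed
qed

section \<open>From shapes to partitions: discarding zero exponents\<close>

definition positive_parts :: "nat multiset \<Rightarrow> nat multiset" where
  "positive_parts A = filter_mset (\<lambda>x. x \<noteq> 0) A"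

lemma positive_parts_simps [simp]:
  "positive_parts {#} = {#}"
  "positive_parts (add_mset x A) = (if x = 0 then positive_parts A else add_mset x (positive_parts A))"
  by (simp_all add: positive_parts_def)

lemma positive_parts_union [simp]: "positive_parts (A + B) = positive_parts A + positive_parts B"
  by (simp add: positive_parts_def)

lemma in_positive_parts [simp]: "x \<in># positive_parts A \<longleftrightarrow> x \<in># A \<and> x \<noteq> 0"
  by (simp add: positive_parts_def)

lemma positive_parts_replicate_0 [simp]: "positive_parts (replicate_mset k 0) = {#}"
  by (induction k) auto

lemma positive_parts_id: "is_partition A \<Longrightarrow> positive_parts A = A"
  by (induction A) auto

lemma is_partition_positive_parts [simp]: "is_partition (positive_parts A)"
  by (simp add: positive_parts_def is_partition_def)

lemma sum_mset_positive_parts [simp]: "sum_mset (positive_parts A) = sum_mset A"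
  by (induction A) auto

lemma excess_positive_parts [simp]: "excess (positive_parts A) = excess A"
  by (rule ext, induction A) (auto simp: excess_def)

lemma weight_positive_parts [simp]: "weight (positive_parts A) = weight A"
  by (induction A) (auto simp: weight_def)

lemma shape_eq_if_positive_parts_eq:
  assumes "positive_parts (shape N e) = positive_parts (shape N e')"
  shows "shape N e = shape N e'"
proof (rule multiset_eqI)
  fix x
  have split: "A = positive_parts A + filter_mset (\<lambda>x. x = 0) A" for A
    using multiset_partition[of A "\<lambda>x. x \<noteq> 0"] by (simp add: positive_parts_def)
  have zeros: "filter_mset (\<lambda>x. x = 0) A = replicate_mset (size A - size (positive_parts A)) 0" for A :: "nat multiset"
  proof -
    have "size A = size (positive_parts A) + size (filter_mset (\<lambda>x. x = 0) A)"
      by (subst split[of A]) (rule size_union)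
    then have "count A 0 = size A - size (positive_parts A)"
      by (simp add: filter_eq_replicate_mset)
    then show ?thesis by (simp add: filter_eq_replicate_mset)
  qed
  have "size (shape N e) = size (shape N e')" by (simp add: shape_def)
  then have "shape N e = shape N e'"
    using split[of "shape N e"] split[of "shape N e'"] zeros[of "shape N e"] zeros[of "shape N e'"] assms
    by metis
  then show "count (shape N e) x = count (shape N e') x" by simp
qed

lemma shape_upd1:
  assumes "i < N"
  shows "\<exists>M. shape N e = add_mset (e i) M \<and> (\<forall>p. shape N (e(i := p)) = add_mset p M)"
proof (intro exI conjI allI)
  have *: "mset_set {..<N} = add_mset i (mset_set ({..<N} - {i}))"
    using assms mset_set.remove[of "{..<N}" i] by simp
  let ?M = "image_mset e (mset_set ({..<N} - {i}))"
  have "image_mset (e(i := p)) (mset_set ({..<N} - {i})) = ?M" for p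
    by (rule image_mset_cong) auto
  then show "shape N (e(i := p)) = add_mset p ?M" for p
    unfolding shape_def * by simp
  show "shape N e = add_mset (e i) ?M"
    unfolding shape_def * by simp
qed

text \<open>A monomial of p_\<mu> arises by distributing the parts of \<mu> over variables; two
  parts in the same variable merge and shorten the shape.\<close>

lemma mono_coeff_nonzero_size:
  assumes "is_partition \<mu>" "mono_coeff N e \<mu> \<noteq> 0"
  shows "size (positive_parts (shape N e)) < size \<mu> \<or> positive_parts (shape N e) = \<mu>"
  using assms
proof (induction \<mu> arbitrary: e)
  case empty
  then have "\<forall>i<N. e i = 0" unfolding mono_coeff_empty by presburger
  then have "shape N e = image_mset (\<lambda>_. 0) (mset_set {..<N})"
    unfolding shape_def by (intro image_mset_cong) simp
  also have "\<dots> = replicate_mset N 0"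
    by (simp add: image_mset_const_eq)
  finally show ?case by simp
next
  case (add r \<mu>)
  from add.prems(2) obtain i where i: "i < N" "r \<le> e i" "mono_coeff N (e(i := e i - r)) \<mu> \<noteq> 0"
    by (rule mono_coeff_add_mset_nonzeroE)
  obtain M where M: "shape N e = add_mset (e i) M" "\<And>p. shape N (e(i := p)) = add_mset p M"
    using shape_upd1[OF i(1)] by blast
  have IH: "size (positive_parts (add_mset (e i - r) M)) < size \<mu> \<or> positive_parts (add_mset (e i - r) M) = \<mu>"
    using add.IH[OF _ i(3)] add.prems(1) unfolding M by simp
  have r: "r \<noteq> 0" using add.prems(1) by simp
  show ?case
  proof (cases "e i = r")
    case True
    with IH r show ?thesis unfolding M by auto
  next
    case False
    with IH r i(2) have "size (positive_parts M) < size \<mu>"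
      by (auto split: if_splits)
    with False r i(2) show ?thesis unfolding M by auto
  qed
qed

text \<open>The natural number k rules out cancellation: one positive summand makes the coefficient
  nonzero.\<close>

lemma mono_coeff_of_nat:
  assumes "is_partition \<mu>"
  shows "\<exists>k. mono_coeff N e \<mu> = of_nat k \<and> (positive_parts (shape N e) = \<mu> \<longrightarrow> 0 < k)"
  using assms
proof (induction \<mu> arbitrary: e)
  case empty
  have "\<forall>i<N. e i = 0" if "positive_parts (shape N e) = {#}"
  proof (intro allI impI)
    fix i assume "i < N"
    then have "e i \<in># shape N e" by (simp add: shape_def)
    then show "e i = 0" using in_positive_parts[of "e i" "shape N e"] unfolding that by simp
  qed
  then show ?case
    unfolding mono_coeff_empty by (intro exI[of _ "if \<forall>i<N. e i = 0 then 1 else 0"]) auto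
next
  case (add r \<mu>)
  then have r: "r \<noteq> 0" and \<mu>: "is_partition \<mu>" by auto
  have "\<forall>i. \<exists>k. mono_coeff N (e(i := e i - r)) \<mu> = of_nat k \<and>
      (positive_parts (shape N (e(i := e i - r))) = \<mu> \<longrightarrow> 0 < k)"
    using add.IH[OF \<mu>] by blast
  then obtain k where "\<forall>i. mono_coeff N (e(i := e i - r)) \<mu> = of_nat (k i) \<and>
      (positive_parts (shape N (e(i := e i - r))) = \<mu> \<longrightarrow> 0 < k i)"
    by (rule choice[THEN exE])
  then have k: "mono_coeff N (e(i := e i - r)) \<mu> = of_nat (k i)"
    "positive_parts (shape N (e(i := e i - r))) = \<mu> \<Longrightarrow> 0 < k i" for i
    by blast+
  have "mono_coeff N e (add_mset r \<mu>) = of_nat (\<Sum>i<N. if r \<le> e i then k i else 0)"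
    unfolding mono_coeff_add_mset k(1) of_nat_sum by (intro sum.cong) auto
  moreover have "0 < (\<Sum>i<N. if r \<le> e i then k i else 0)" if *: "positive_parts (shape N e) = add_mset r \<mu>"
  proof -
    have "r \<in># shape N e" using in_positive_parts[of r "shape N e"] unfolding * by simp
    then obtain i where i: "i < N" "e i = r" by (auto simp: shape_def)
    obtain M where M: "shape N e = add_mset (e i) M" "\<And>p. shape N (e(i := p)) = add_mset p M"
      using shape_upd1[OF i(1)] by blast
    have "positive_parts (shape N (e(i := e i - r))) = \<mu>"
      using * r unfolding M by (simp add: i(2))
    then have "0 < k i" by (rule k(2))
    then have "0 < (if r \<le> e i then k i else 0)" using i by simp
    also have "\<dots> \<le> (\<Sum>i<N. if r \<le> e i then k i else 0)"
      by (rule member_le_sum) (use i in auto)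
    finally show ?thesis .
  qed
  ultimately show ?case by blast
qed

lemma exists_shape:
  assumes "is_partition \<mu>" "size \<mu> \<le> N"
  obtains e where "positive_parts (shape N e) = \<mu>"
proof -
  obtain xs where xs: "mset xs = \<mu>" using ex_mset by blast
  define ys where "ys = xs @ replicate (N - length xs) 0"
  have len: "length ys = N" using assms(2) xs by (auto simp: ys_def)
  have "shape N ((!) ys) = mset (map ((!) ys) [0..<N])"
    by (simp add: shape_def atLeast0LessThan)
  also have "\<dots> = mset ys" using map_nth[of ys] len by simp
  finally have "positive_parts (shape N ((!) ys)) = \<mu>"
    using assms(1) by (simp add: ys_def xs positive_parts_id)
  then show thesis by (rule that)
qed

text \<open>The transition from power sums to monomials is triangular in the length. At a monomial
  of shape \<kappa> only \<kappa> and longer \<mu> contribute, and v vanishes on the latter by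
  induction. The bound n \<le> N provides enough variables for every \<kappa>.\<close>

lemma pairing_mono_coeff_injective:
  assumes zero: "\<And>e. sum e {..<N} = n \<Longrightarrow> pairing n v (mono_coeff N e) = 0"
    and "n \<le> N" "\<kappa> \<in> partitions n"
  shows "v \<kappa> = 0"
  using assms(3)
proof (induction "n - size \<kappa>" arbitrary: \<kappa> rule: less_induct)
  case less
  have size: "size \<mu> \<le> n" if "\<mu> \<in> partitions n" for \<mu>
    using that size_le_sum_mset[of \<mu>] by (auto simp: partitions_def)
  have \<kappa>: "is_partition \<kappa>" "sum_mset \<kappa> = n" using less.prems by (auto simp: partitions_def)
  obtain e where e: "positive_parts (shape N e) = \<kappa>"
    using exists_shape[OF \<kappa>(1)] size[OF less.prems] assms(2) le_trans by blast
  have "sum e {..<N} = n"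
    using \<kappa>(2) sum_mset_positive_parts[of "shape N e"] unfolding e sum_mset_shape by simp
  then have "0 = pairing n v (mono_coeff N e)" by (rule zero[symmetric])
  also have "\<dots> = (\<Sum>\<mu>\<in>partitions n. if \<mu> = \<kappa> then mono_coeff N e \<kappa> * v \<kappa> else 0)"
    unfolding pairing_def
  proof (rule sum.cong[OF refl])
    fix \<mu> assume \<mu>: "\<mu> \<in> partitions n"
    show "mono_coeff N e \<mu> * v \<mu> = (if \<mu> = \<kappa> then mono_coeff N e \<kappa> * v \<kappa> else 0)"
    proof (cases "\<mu> = \<kappa> \<or> mono_coeff N e \<mu> = 0")
      case False
      then have "size \<kappa> < size \<mu>"
        using mono_coeff_nonzero_size[of \<mu> N e] \<mu> unfolding e by (auto simp: partitions_def)
      then have "v \<mu> = 0" using less.hyps[OF _ \<mu>] size[OF \<mu>] by simp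
      with False show ?thesis by simp
    qed auto
  qed
  also have "\<dots> = mono_coeff N e \<kappa> * v \<kappa>" using less.prems by simp
  finally show ?case
    using mono_coeff_of_nat[OF \<kappa>(1), of N e] e by auto
qed

section \<open>The dominance order\<close>

lemma excess_diff: "excess A t = excess A (Suc t) + size (filter_mset (\<lambda>x. t < x) A)"
  by (induction A) (auto simp: excess_def)

text \<open>The second differences of the excess in t are the multiplicities of the positive
  parts.\<close>

lemma excess_eq_imp_eq:
  assumes "\<And>t. excess A t = excess B t" "is_partition A" "is_partition B"
  shows "A = B"
proof (rule multiset_eqI)
  fix x
  have gt: "size (filter_mset (\<lambda>x. t < x) A) = size (filter_mset (\<lambda>x. t < x) B)" for t
    using excess_diff[of A t] excess_diff[of B t] assms(1)[of t] assms(1)[of "Suc t"] by simp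
  have count: "size (filter_mset (\<lambda>y. t < y) C) = size (filter_mset (\<lambda>y. Suc t < y) C) + count C (Suc t)" for C t
    by (induction C) auto
  show "count A x = count B x"
  proof (cases x)
    case 0
    with assms(2,3) show ?thesis by (simp add: is_partition_def not_in_iff)
  next
    case (Suc t)
    then show ?thesis using count[of t A] count[of t B] gt[of t] gt[of "Suc t"] by simp
  qed
qed

lemma weight_eq_excess:
  assumes "\<And>x. x \<in># A \<Longrightarrow> x \<le> n"
  shows "weight A = 2 * (\<Sum>t = 1..n. excess A t)"
  using assms
proof (induction A)
  case (add x A)
  have "x * (x - 1) = 2 * (\<Sum>t = 1..n. x - t)" if "x \<le> n" for x n :: nat
    using that
  proof (induction n arbitrary: x)
    case (Suc n)
    show ?case
    proof (cases "x = Suc n")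
      case True
      have "(\<Sum>t = 1..Suc n. Suc n - t) = (\<Sum>t = 0..n. t)"
        by (rule sum.reindex_bij_witness[of _ "\<lambda>t. Suc n - t" "\<lambda>t. Suc n - t"]) auto
      also have "\<dots> * 2 = n * Suc n" by (simp add: gauss_sum_nat)
      finally show ?thesis using True by simp
    qed (use Suc in auto)
  qed simp
  with add show ?case by (simp add: weight_def excess_def sum.distrib)
qed (simp add: weight_def excess_def)

text \<open>The weight is twice the sum of the excesses over t \<ge> 1; termwise inequality with
  equal sums forces termwise equality.\<close>

lemma below_weight_eq:
  assumes "is_partition A" "is_partition B" "sum_mset A = sum_mset B" "below A B" "weight A = weight B"
  shows "A = B"
proof (rule excess_eq_imp_eq)
  define n where "n = sum_mset A"
  have mem: "x \<le> sum_mset C" if "x \<in># C" for x and C :: "nat multiset"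
    using multi_member_split[OF that] by auto
  have big: "excess C t = 0" if "sum_mset C = n" "n \<le> t" for C t
    using that mem[of _ C] by (fastforce simp: excess_def)
  have "weight A = 2 * (\<Sum>t = 1..n. excess A t)"
    by (rule weight_eq_excess) (use mem[of _ A] in \<open>simp add: n_def\<close>)
  moreover have "weight B = 2 * (\<Sum>t = 1..n. excess B t)"
    by (rule weight_eq_excess) (use mem[of _ B] assms(3) in \<open>simp add: n_def\<close>)
  ultimately have "(\<Sum>t = 1..n. excess A t) = (\<Sum>t = 1..n. excess B t)"
    using assms(5) by linarith
  then have eq: "excess A t = excess B t" if "t \<in> {1..n}" for t
    using assms(4) by (intro sum_mono_inv[of "excess A" "{1..n}" "excess B" t] that) (simp_all add: below_def)
  show "excess A t = excess B t" for t
  proof -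
    have "t = 0 \<or> t \<in> {1..n} \<or> n \<le> t" by auto
    then consider "t = 0" | "t \<in> {1..n}" | "n \<le> t" by blast
    then show ?thesis
    proof cases
      case 1
      then show ?thesis using assms(3) by (simp add: excess_def)
    next
      case 2
      then show ?thesis by (rule eq)
    next
      case 3
      then show ?thesis using big[of A t] big[of B t] assms(3) by (simp add: n_def)
    qed
  qed
qed (use assms in auto)

lemma part_antimono:
  assumes "1 \<le> x" "x \<le> y" shows "part A y \<le> part A x"
proof (cases "y \<le> size A")
  case True
  let ?xs = "sorted_list_of_multiset A"
  have len: "length ?xs = size A" by (metis mset_sorted_list_of_multiset size_mset)
  have "sorted_wrt (\<ge>) (rev ?xs)"
    by (simp add: sorted_wrt_rev)
  then have "rev ?xs ! (y - 1) \<le> rev ?xs ! (x - 1)"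
    using True assms len by (cases "x = y") (auto intro: sorted_wrt_nth_less)
  with True assms show ?thesis by (simp add: part_def)
qed (simp add: part_def)

lemma image_part: "image_mset (part A) (mset_set {1..size A}) = A"
proof -
  let ?xs = "rev (sorted_list_of_multiset A)"
  have len: "length (sorted_list_of_multiset A) = size A" by (metis mset_sorted_list_of_multiset size_mset)
  have "image_mset (part A) (mset_set {1..size A}) = mset (map (part A) [1..<Suc (size A)])"
    by (simp add: atLeastLessThanSuc_atLeastAtMost[symmetric] del: upt_Suc)
  also have "map (part A) [1..<Suc (size A)] = ?xs"
    by (rule nth_equalityI) (auto simp: len part_def simp del: upt_Suc)
  finally show ?thesis by simp
qed

lemma sum_mset_part: "(\<Sum>x\<in>#A. f x) = (\<Sum>x = 1..size A. f (part A x))"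
  using arg_cong[OF image_part, of "\<lambda>M. \<Sum>x\<in>#M. f x" A]
  by (simp add: sum_unfold_sum_mset image_mset.compositionality comp_def)

lemma part_superlevel:
  "{x \<in> {1..size A}. t < part A x} = {1..size (filter_mset (\<lambda>x. t < x) A)}"
proof -
  let ?S = "{x \<in> {1..size A}. t < part A x}"
  have fin: "finite ?S" by simp
  have closed: "y \<in> ?S" if "x \<in> ?S" "1 \<le> y" "y \<le> x" for x y
    using that part_antimono[of y x A] by auto
  have "?S = {1..card ?S}"
  proof (cases "?S = {}")
    case False
    have "?S = {1..Max ?S}"
    proof (intro equalityI subsetI)
      fix x assume "x \<in> ?S"
      then show "x \<in> {1..Max ?S}" using Max_ge[OF fin, of x] by simp
    next
      fix y assume "y \<in> {1..Max ?S}"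
      then show "y \<in> ?S" using closed[OF Max_in[OF fin False], of y] by simp
    qed
    then show ?thesis by (metis card_atLeastAtMost diff_Suc_1)
  qed simp
  moreover have "card ?S = size (filter_mset (\<lambda>x. t < x) A)"
  proof -
    have "filter_mset (\<lambda>x. t < x) A = image_mset (part A) (mset_set ?S)"
      by (subst image_part[of A, symmetric]) (simp only: filter_mset_image_mset filter_mset_mset_set[OF finite_atLeastAtMost])
    then show ?thesis by simp
  qed
  ultimately show ?thesis by simp
qed

lemma dominance_less_below:
  assumes "dominance_less \<nu> lam" shows "below \<nu> lam"
  unfolding below_def
proof
  fix t
  \<comment> \<open>For this j the excess of \<nu> equals its j-th partial sum minus j t, while for
    \<open>lam\<close> that difference is only a lower bound of the excess.\<close>
  define j where "j = size (filter_mset (\<lambda>x. t < x) \<nu>)"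
  have down: "{x \<in> {1..size \<nu>}. t < part \<nu> x} = {1..j}"
    unfolding j_def by (rule part_superlevel)
  have "excess \<nu> t = (\<Sum>x = 1..size \<nu>. part \<nu> x - t)"
    unfolding excess_def by (rule sum_mset_part)
  also have "\<dots> = (\<Sum>x \<in> {x \<in> {1..size \<nu>}. t < part \<nu> x}. part \<nu> x - t)"
    by (rule sum.mono_neutral_right) auto
  finally have ex: "excess \<nu> t = (\<Sum>x = 1..j. part \<nu> x - t)" unfolding down .
  have "t < part \<nu> x" if "x \<in> {1..j}" for x using that down by blast
  then have "excess \<nu> t + j * t = (\<Sum>x = 1..j. part \<nu> x)"
  proof -
    assume *: "\<And>x. x \<in> {1..j} \<Longrightarrow> t < part \<nu> x"
    have "(\<Sum>x = 1..j. part \<nu> x) = (\<Sum>x = 1..j. (part \<nu> x - t) + t)"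
      by (rule sum.cong[OF refl]) (use * in \<open>simp add: less_imp_le\<close>)
    then show ?thesis unfolding ex by (simp add: sum.distrib)
  qed
  also have "\<dots> \<le> (\<Sum>x = 1..j. part lam x)" using assms by (simp add: dominance_less_def)
  also have "\<dots> \<le> (\<Sum>x = 1..j. (part lam x - t) + t)" by (rule sum_mono) simp
  also have "\<dots> = (\<Sum>x = 1..j. part lam x - t) + j * t" by (simp add: sum.distrib)
  also have "(\<Sum>x = 1..j. part lam x - t) \<le> (\<Sum>x = 1..max j (size lam). part lam x - t)"
    by (rule sum_mono2) auto
  also have "\<dots> = (\<Sum>x = 1..size lam. part lam x - t)"
    by (rule sum.mono_neutral_right) (auto simp: part_def)
  also have "\<dots> = excess lam t" unfolding excess_def by (rule sum_mset_part[symmetric])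
  finally show "excess \<nu> t \<le> excess lam t" by simp
qed

section \<open>Jack functions as linear forms\<close>

text \<open>Forms are functions on all multisets, including those with a part 0; in degree n only
  these values carry meaning. The degree of y_{m+1} p_\<kappa> is m + 1 plus the sum of
  \<kappa>.\<close>

definition yagree :: "nat \<Rightarrow> yfnl \<Rightarrow> yfnl \<Rightarrow> bool" where
  "yagree n \<psi> \<psi>' \<longleftrightarrow> (\<forall>m \<kappa>. is_partition \<kappa> \<longrightarrow> sum_mset \<kappa> + Suc m = n \<longrightarrow> \<psi> m \<kappa> = \<psi>' m \<kappa>)"

definition agree :: "nat \<Rightarrow> fnl \<Rightarrow> fnl \<Rightarrow> bool" where
  "agree n \<phi> \<phi>' \<longleftrightarrow> (\<forall>\<mu>\<in>partitions n. \<phi> \<mu> = \<phi>' \<mu>)"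

lemma yagreeD: "yagree n \<psi> \<psi>' \<Longrightarrow> is_partition \<kappa> \<Longrightarrow> sum_mset \<kappa> + Suc m = n \<Longrightarrow> \<psi> m \<kappa> = \<psi>' m \<kappa>"
  unfolding yagree_def by blast

lemma Lax_agree:
  assumes "yagree n \<psi> \<psi>'" shows "yagree n (Lax \<psi>) (Lax \<psi>')"
  unfolding yagree_def
proof (intro allI impI)
  fix m \<kappa> assume \<kappa>: "is_partition \<kappa>" "sum_mset \<kappa> + Suc m = n"
  have "splitting \<psi> m \<kappa> = splitting \<psi>' m \<kappa>"
    unfolding splitting_def
    by (rule sum.cong[OF refl], rule yagreeD[OF assms]) (use \<kappa> in auto)
  moreover have "joining \<psi> m \<kappa> = joining \<psi>' m \<kappa>"
    unfolding joining_def
    by (rule psum_cong_pos, rule yagreeD[OF assms]) (use \<kappa> in auto)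
  moreover have "\<psi> m \<kappa> = \<psi>' m \<kappa>" by (rule yagreeD[OF assms \<kappa>])
  ultimately show "Lax \<psi> m \<kappa> = Lax \<psi>' m \<kappa>" by (simp add: Lax_def)
qed

lemma Laxpow_agree: "yagree n \<psi> \<psi>' \<Longrightarrow> yagree n ((Lax ^^ k) \<psi>) ((Lax ^^ k) \<psi>')"
  by (induction k) (auto intro: Lax_agree)

lemma Nabla_agree:
  assumes "yagree n \<psi> \<psi>'" shows "agree n (Nabla \<psi>) (Nabla \<psi>')"
  unfolding agree_def Nabla_def
  by (intro ballI psum_cong_pos yagreeD[OF assms]) (auto simp: partitions_def)

lemma Theta_agree: "agree n \<phi> \<phi>' \<Longrightarrow> yagree n (Theta \<phi>) (Theta \<phi>')"
  by (auto simp: agree_def yagree_def Theta_def partitions_def)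

lemma Eps_agree: "agree n \<phi> \<phi>' \<Longrightarrow> yagree (Suc n) (Eps \<phi>) (Eps \<phi>')"
  by (auto simp: agree_def yagree_def Eps_def partitions_def)

lemma Tk_agree: "agree n \<phi> \<phi>' \<Longrightarrow> agree n (Tk k \<phi>) (Tk k \<phi>')"
  unfolding Tk_def by (intro Nabla_agree Laxpow_agree Theta_agree)

lemma Rk_agree: "agree n \<phi> \<phi>' \<Longrightarrow> agree (Suc n) (Rk k \<phi>) (Rk k \<phi>')"
  unfolding Rk_def by (intro Nabla_agree Laxpow_agree Eps_agree)

lemma pairing_agree: "agree n \<phi> \<phi>' \<Longrightarrow> pairing n v \<phi> = pairing n v \<phi>'"
  unfolding agree_def by (rule pairing_cong) blast

section \<open>Values of linear forms on symmetric functions; the transpose of D_b\<close>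

definition pval :: "psym \<Rightarrow> fnl \<Rightarrow> qb" where
  "pval f \<phi> = (\<Sum>\<mu>\<in>Poly_Mapping.keys f. Poly_Mapping.lookup f \<mu> * \<phi> \<mu>)"

lemma pval_superset:
  assumes "finite A" "Poly_Mapping.keys f \<subseteq> A"
  shows "pval f \<phi> = (\<Sum>\<mu>\<in>A. Poly_Mapping.lookup f \<mu> * \<phi> \<mu>)"
  unfolding pval_def using assms by (intro sum.mono_neutral_left) (auto simp: in_keys_iff)

lemma pval_add: "pval (f + g) \<phi> = pval f \<phi> + pval g \<phi>"
proof -
  let ?A = "Poly_Mapping.keys f \<union> Poly_Mapping.keys g"
  have "pval (f + g) \<phi> = (\<Sum>\<mu>\<in>?A. Poly_Mapping.lookup (f + g) \<mu> * \<phi> \<mu>)"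
    by (rule pval_superset) (simp_all add: keys_add)
  moreover have "pval f \<phi> = (\<Sum>\<mu>\<in>?A. Poly_Mapping.lookup f \<mu> * \<phi> \<mu>)"
    "pval g \<phi> = (\<Sum>\<mu>\<in>?A. Poly_Mapping.lookup g \<mu> * \<phi> \<mu>)"
    by (rule pval_superset; simp)+
  ultimately show ?thesis by (simp only: lookup_add distrib_right sum.distrib)
qed

lemma pval_0 [simp]: "pval 0 \<phi> = 0"
  by (simp add: pval_def)

lemma pval_sum: "pval (\<Sum>i\<in>A. f i) \<phi> = (\<Sum>i\<in>A. pval (f i) \<phi>)"
  by (induction A rule: infinite_finite_induct) (simp_all add: pval_add)

lemma pval_single: "pval (Poly_Mapping.single \<mu> c) \<phi> = c * \<phi> \<mu>"
  by (cases "c = 0") (simp_all add: pval_def)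

lemma pval_const_mult: "pval (p_const c * f) \<phi> = c * pval f \<phi>"
proof -
  have look: "Poly_Mapping.lookup (p_const c * f) \<mu> = c * Poly_Mapping.lookup f \<mu>" for \<mu>
    unfolding p_const_def by (rule lookup_const_mult)
  then have "Poly_Mapping.keys (p_const c * f) \<subseteq> Poly_Mapping.keys f"
    by (auto simp: in_keys_iff)
  then have "pval (p_const c * f) \<phi> = (\<Sum>\<mu>\<in>Poly_Mapping.keys f. Poly_Mapping.lookup (p_const c * f) \<mu> * \<phi> \<mu>)"
    by (intro pval_superset) auto
  then show ?thesis by (simp only: look pval_def sum_distrib_left mult.assoc)
qed

lemma psym_expand: "f = (\<Sum>\<mu>\<in>Poly_Mapping.keys f. Poly_Mapping.single \<mu> (Poly_Mapping.lookup f \<mu>))" for f :: psym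
proof (rule poly_mapping_eqI)
  fix k
  have "(\<Sum>\<mu>\<in>Poly_Mapping.keys f. Poly_Mapping.lookup (Poly_Mapping.single \<mu> (Poly_Mapping.lookup f \<mu>)) k)
     = (\<Sum>\<mu>\<in>Poly_Mapping.keys f. if \<mu> = k then Poly_Mapping.lookup f k else 0)"
    by (rule sum.cong) (auto simp: lookup_single when_def)
  then show "Poly_Mapping.lookup f k = Poly_Mapping.lookup (\<Sum>\<mu>\<in>Poly_Mapping.keys f.
      Poly_Mapping.single \<mu> (Poly_Mapping.lookup f \<mu>)) k"
    by (simp add: lookup_sum in_keys_iff)
qed

lemma pval_p_var: "pval (p_var i * f) \<phi> = pval f (\<lambda>\<mu>. \<phi> (add_mset i \<mu>))"
proof -
  have "p_var i * f = p_var i * (\<Sum>\<mu>\<in>Poly_Mapping.keys f. Poly_Mapping.single \<mu> (Poly_Mapping.lookup f \<mu>))"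
    using psym_expand[of f] by simp
  also have "\<dots> = (\<Sum>\<mu>\<in>Poly_Mapping.keys f. Poly_Mapping.single (add_mset i \<mu>) (Poly_Mapping.lookup f \<mu>))"
    by (simp add: p_var_def sum_distrib_left mult_single)
  finally show ?thesis by (simp only: pval_sum pval_single) (simp only: pval_def)
qed

lemma pval_p_star: "pval (p_star i f) \<phi> = pval f (\<lambda>\<mu>. of_nat i * of_nat (count \<mu> i) * \<phi> (\<mu> - {#i#}))"
  by (simp only: p_star_def pval_sum pval_single) (simp only: pval_def ac_simps)

lemma pval_cong: "(\<And>\<mu>. \<mu> \<in> Poly_Mapping.keys f \<Longrightarrow> \<phi> \<mu> = \<phi>' \<mu>) \<Longrightarrow> pval f \<phi> = pval f \<phi>'"
  unfolding pval_def by (rule sum.cong) auto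

lemma pval_fun_sum: "(\<Sum>i\<in>A. pval f (\<phi> i)) = pval f (\<lambda>\<mu>. \<Sum>i\<in>A. \<phi> i \<mu>)"
  unfolding pval_def sum_distrib_left by (rule sum.swap)

lemma pval_fun_cmult: "pval f (\<lambda>\<mu>. c * \<phi> \<mu>) = c * pval f \<phi>"
  unfolding pval_def sum_distrib_left by (simp only: mult.left_commute)

lemma pval_fun_add: "pval f (\<lambda>\<mu>. \<phi> \<mu> + \<phi>' \<mu>) = pval f \<phi> + pval f \<phi>'"
  unfolding pval_def by (simp only: distrib_left sum.distrib)

definition parts_le :: "nat \<Rightarrow> psym \<Rightarrow> bool" where
  "parts_le n f \<longleftrightarrow> (\<forall>\<mu>\<in>Poly_Mapping.keys f. set_mset \<mu> \<subseteq> {..n})"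

lemma exists_parts_le: "\<exists>n. parts_le n f"
proof -
  let ?S = "\<Union>\<mu>\<in>Poly_Mapping.keys f. set_mset \<mu>"
  have "finite ?S" by simp
  then have "\<forall>x\<in>?S. x \<le> Max (insert 0 ?S)" by simp
  then show ?thesis unfolding parts_le_def by (intro exI[of _ "Max (insert 0 ?S)"]) blast
qed

lemma p_star_eq_0:
  assumes "parts_le n f" "n < i" shows "p_star i f = 0"
  unfolding p_star_def
proof (rule sum.neutral, rule ballI)
  fix \<mu> assume "\<mu> \<in> Poly_Mapping.keys f"
  with assms have "i \<notin># \<mu>" unfolding parts_le_def by (meson atMost_iff leD subsetD)
  then have "count \<mu> i = 0" by (simp add: not_in_iff)
  then show "Poly_Mapping.single (\<mu> - {#i#}) (of_nat i * of_nat (count \<mu> i) * Poly_Mapping.lookup f \<mu>) = 0"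
    by simp
qed

lemma parts_le_p_star:
  assumes "parts_le n f" shows "parts_le n (p_star j f)"
proof -
  have "Poly_Mapping.keys (p_star j f) \<subseteq> (\<lambda>\<mu>. \<mu> - {#j#}) ` Poly_Mapping.keys f"
    unfolding p_star_def by (rule order_trans[OF keys_sum]) auto
  with assms show ?thesis
    unfolding parts_le_def by (auto dest!: in_diffD)
qed

lemma sum_count: "finite A \<Longrightarrow> set_mset \<mu> \<subseteq> A \<Longrightarrow> (\<Sum>j\<in>#\<mu>. g j) = (\<Sum>j\<in>A. of_nat (count \<mu> j) * g j)"
  for g :: "nat \<Rightarrow> 'a::comm_semiring_1"
proof (induction \<mu>)
  case (add x \<mu>)
  then have x: "x \<in> A" by simp
  have "(\<Sum>j\<in>A. of_nat (count (add_mset x \<mu>) j) * g j) = (\<Sum>j\<in>A. (if j = x then g j else 0) + of_nat (count \<mu> j) * g j)"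
    by (rule sum.cong) (auto simp: distrib_right)
  with add x show ?case by (simp add: sum.distrib)
qed simp

lemma psum_eq_sum:
  assumes "set_mset \<mu> \<subseteq> {..n}"
  shows "psum F \<mu> = (\<Sum>j=1..n. of_nat j * of_nat (count \<mu> j) * F j (\<mu> - {#j#}))"
proof -
  have "psum F \<mu> = (\<Sum>j\<le>n. of_nat (count \<mu> j) * (of_nat j * F j (\<mu> - {#j#})))"
    unfolding psum_def by (rule sum_count) (use assms in auto)
  also have "\<dots> = (\<Sum>j=1..n. of_nat (count \<mu> j) * (of_nat j * F j (\<mu> - {#j#})))"
    by (rule sum.mono_neutral_right) (auto simp: not_le)
  finally show ?thesis by (simp only: ac_simps)
qed

text \<open>A bound n on the parts of f confines all sums of D_b to indices at most n; each of the
  three is then transposed separately.\<close>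

lemma pval_D_b:
  assumes n: "parts_le n f"
  shows "pval (D_b f) \<phi> = 1/2 * pval f (Tk 1 \<phi>)"
proof -
  have mem: "set_mset \<mu> \<subseteq> {..n}" if "\<mu> \<in> Poly_Mapping.keys f" for \<mu>
    using n that by (auto simp: parts_le_def)
  have pairs: "Sum_any (\<lambda>(i, j). if 1 \<le> i \<and> 1 \<le> j then g i j else 0) = (\<Sum>i=1..n. \<Sum>j=1..n. g i j)"
    if "\<And>i j. n < i \<or> n < j \<Longrightarrow> g i j = 0" for g :: "nat \<Rightarrow> nat \<Rightarrow> psym"
  proof -
    let ?g = "\<lambda>(i, j). if 1 \<le> i \<and> 1 \<le> j then g i j else 0"
    have "Sum_any ?g = sum ?g ({1..n} \<times> {1..n})"
    proof (rule Sum_any.expand_superset)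
      show "{a. ?g a \<noteq> 0} \<subseteq> {1..n} \<times> {1..n}"
        using that by (auto split: if_splits simp: not_less[symmetric])
    qed simp
    also have "\<dots> = (\<Sum>i=1..n. \<Sum>j=1..n. if 1 \<le> i \<and> 1 \<le> j then g i j else 0)"
      by (rule sum.cartesian_product[symmetric])
    also have "\<dots> = (\<Sum>i=1..n. \<Sum>j=1..n. g i j)"
      by (intro sum.cong) auto
    finally show ?thesis .
  qed
  have 1: "pval (Sum_any (\<lambda>(i, j). if 1 \<le> i \<and> 1 \<le> j then p_var (i + j) * p_star i (p_star j f) else 0)) \<phi>
      = pval f (Djoin \<phi>)"
  proof -
    have "p_var (i + j) * p_star i (p_star j f) = 0" if "n < i \<or> n < j" for i j
      using that p_star_eq_0[OF n, of j] p_star_eq_0[OF parts_le_p_star[OF n], of i j]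
      by (auto simp: p_star_def)
    then have "pval (Sum_any (\<lambda>(i, j). if 1 \<le> i \<and> 1 \<le> j then p_var (i + j) * p_star i (p_star j f) else 0)) \<phi>
      = (\<Sum>i=1..n. \<Sum>j=1..n. pval (p_var (i + j) * p_star i (p_star j f)) \<phi>)"
      by (subst pairs) (simp_all only: pval_sum)
    also have "\<dots> = pval f (\<lambda>\<mu>. \<Sum>i=1..n. \<Sum>j=1..n. of_nat j * of_nat (count \<mu> j) *
        (of_nat i * of_nat (count (\<mu> - {#j#}) i) * \<phi> (add_mset (i + j) (\<mu> - {#j#} - {#i#}))))"
      by (simp only: pval_p_var pval_p_star pval_fun_sum)
    also have "\<dots> = pval f (Djoin \<phi>)"
    proof (rule pval_cong)
      fix \<mu> assume "\<mu> \<in> Poly_Mapping.keys f"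
      note m = mem[OF this]
      have m': "set_mset (\<mu> - {#j#}) \<subseteq> {..n}" for j using m by (auto dest!: in_diffD)
      have "Djoin \<phi> \<mu> = (\<Sum>j=1..n. of_nat j * of_nat (count \<mu> j) * (\<Sum>i=1..n. of_nat i * of_nat (count (\<mu> - {#j#}) i) *
          \<phi> (add_mset (j + i) (\<mu> - {#j#} - {#i#}))))"
        unfolding Djoin_def psum_eq_sum[OF m] psum_eq_sum[OF m'] ..
      then show "(\<Sum>i=1..n. \<Sum>j=1..n. of_nat j * of_nat (count \<mu> j) *
        (of_nat i * of_nat (count (\<mu> - {#j#}) i) * \<phi> (add_mset (i + j) (\<mu> - {#j#} - {#i#})))) = Djoin \<phi> \<mu>"
        by (subst sum.swap) (simp only: sum_distrib_left add.commute)
    qed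
    finally show ?thesis .
  qed
  have 2: "pval (Sum_any (\<lambda>(i, j). if 1 \<le> i \<and> 1 \<le> j then p_var i * p_var j * p_star (i + j) f else 0)) \<phi>
      = pval f (Dsplit \<phi>)"
  proof -
    have "p_var i * p_var j * p_star (i + j) f = 0" if "n < i \<or> n < j" for i j
      using that p_star_eq_0[OF n, of "i + j"] by auto
    then have "pval (Sum_any (\<lambda>(i, j). if 1 \<le> i \<and> 1 \<le> j then p_var i * p_var j * p_star (i + j) f else 0)) \<phi>
      = (\<Sum>i=1..n. \<Sum>j=1..n. pval (p_var i * (p_var j * p_star (i + j) f)) \<phi>)"
      by (subst pairs) (simp_all only: pval_sum mult.assoc)
    also have "\<dots> = pval f (\<lambda>\<mu>. \<Sum>i=1..n. \<Sum>j=1..n. of_nat (i + j) * of_nat (count \<mu> (i + j)) *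
        \<phi> (add_mset i (add_mset j (\<mu> - {#i + j#}))))"
      by (simp only: pval_p_var pval_p_star pval_fun_sum)
    also have "\<dots> = pval f (Dsplit \<phi>)"
    proof (rule pval_cong)
      fix \<mu> assume "\<mu> \<in> Poly_Mapping.keys f"
      note m = mem[OF this]
      let ?h = "\<lambda>i j. of_nat (i + j) * of_nat (count \<mu> (i + j)) * \<phi> (add_mset i (add_mset j (\<mu> - {#i + j#})))"
      have count0: "count \<mu> (i + j) = 0" if "n < i + j" for i j
      proof -
        have "i + j \<notin># \<mu>" using that m by auto
        then show ?thesis by (simp add: not_in_iff)
      qed
      have "(\<Sum>i=1..n. \<Sum>j=1..n. ?h i j) = (\<Sum>(i, j)\<in>{1..n} \<times> {1..n}. ?h i j)"
        by (rule sum.cartesian_product)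
      \<comment> \<open>The pair (i, j) becomes l = i + j, s = i - 1. Pairs with i + j > n have no
        counterpart, but their terms vanish since \<open>\<mu>\<close> has no such part.\<close>
      also have "\<dots> = (\<Sum>(l, s)\<in>Sigma {1..n} (\<lambda>l. {..<l - 1}). ?h (Suc s) (l - 1 - s))"
        by (rule sum.reindex_bij_witness_not_neutral[of "{(i, j). i \<in> {1..n} \<and> j \<in> {1..n} \<and> n < i + j}" "{}"
              _ "\<lambda>(l, s). (Suc s, l - 1 - s)" "\<lambda>(i, j). (i + j, i - 1)"])
           (auto intro: finite_subset[of _ "{1..n} \<times> {1..n}"] simp: count0)
      also have "\<dots> = (\<Sum>l=1..n. \<Sum>s<l - 1. ?h (Suc s) (l - 1 - s))"
        by (rule sum.Sigma[symmetric]) auto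
      also have "\<dots> = Dsplit \<phi> \<mu>"
        unfolding Dsplit_def psum_eq_sum[OF m] sum_distrib_left by (intro sum.cong) auto
      finally show "(\<Sum>i=1..n. \<Sum>j=1..n. ?h i j) = Dsplit \<phi> \<mu>" .
    qed
    finally show ?thesis .
  qed
  have 3: "pval (Sum_any (\<lambda>i. if 1 \<le> i then of_nat (i - 1) * p_var i * p_star i f else 0)) \<phi> = pval f (Ddiag \<phi>)"
  proof -
    have of_nat_const: "of_nat k = p_const (of_nat k)" for k
      unfolding p_const_def by (rule single_of_nat[symmetric])
    have "Sum_any (\<lambda>i. if 1 \<le> i then of_nat (i - 1) * p_var i * p_star i f else 0)
      = (\<Sum>i=1..n. if 1 \<le> i then of_nat (i - 1) * p_var i * p_star i f else 0)"
      by (rule Sum_any.expand_superset) (use p_star_eq_0[OF n] in \<open>auto simp: not_less[symmetric] split: if_splits\<close>)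
    also have "\<dots> = (\<Sum>i=1..n. p_const (of_nat (i - 1)) * (p_var i * p_star i f))"
      by (intro sum.cong refl) (simp only: atLeastAtMost_iff if_True mult.assoc of_nat_const[symmetric])
    finally have "pval (Sum_any (\<lambda>i. if 1 \<le> i then of_nat (i - 1) * p_var i * p_star i f else 0)) \<phi>
      = pval f (\<lambda>\<mu>. \<Sum>i=1..n. of_nat (i - 1) * (of_nat i * of_nat (count \<mu> i) * \<phi> (add_mset i (\<mu> - {#i#}))))"
      by (simp only: pval_sum pval_const_mult pval_p_var pval_p_star pval_fun_cmult[symmetric] pval_fun_sum)
    also have "\<dots> = pval f (Ddiag \<phi>)"
    proof (rule pval_cong)
      fix \<mu> assume "\<mu> \<in> Poly_Mapping.keys f"
      note m = mem[OF this]
      have "of_nat (count \<mu> i) * \<phi> (add_mset i (\<mu> - {#i#})) = of_nat (count \<mu> i) * \<phi> \<mu>" for i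
        by (cases "i \<in># \<mu>") (simp_all add: not_in_iff)
      then show "(\<Sum>i=1..n. of_nat (i - 1) * (of_nat i * of_nat (count \<mu> i) * \<phi> (add_mset i (\<mu> - {#i#})))) = Ddiag \<phi> \<mu>"
        unfolding Ddiag_def psum_eq_sum[OF m] sum_distrib_right by (intro sum.cong refl) (simp add: mult.assoc)
    qed
    finally show ?thesis .
  qed
  show ?thesis
    unfolding D_b_def pval_const_mult pval_add 1 2 3
    by (simp only: T1_eq_fun pval_fun_add pval_fun_cmult)
qed

lemma pval_eq_pairing:
  "pval f (\<lambda>\<mu>. if \<mu> \<in> partitions n then \<phi> \<mu> else 0) = pairing n (Poly_Mapping.lookup f) \<phi>"
proof -
  let ?A = "Poly_Mapping.keys f \<union> partitions n"
  have "pval f (\<lambda>\<mu>. if \<mu> \<in> partitions n then \<phi> \<mu> else 0)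
    = (\<Sum>\<mu>\<in>?A. Poly_Mapping.lookup f \<mu> * (if \<mu> \<in> partitions n then \<phi> \<mu> else 0))"
    by (rule pval_superset) auto
  also have "\<dots> = (\<Sum>\<mu>\<in>partitions n. Poly_Mapping.lookup f \<mu> * (if \<mu> \<in> partitions n then \<phi> \<mu> else 0))"
    by (rule sum.mono_neutral_right) auto
  finally show ?thesis by (simp add: pairing_def mult.commute cong: sum.cong)
qed

definition content_sum :: "nat multiset \<Rightarrow> qb" where
  "content_sum lam = (\<Sum>s\<in>boxes lam. b_content s)"

lemma jack_T1:
  assumes "is_jack lam f"
  shows "pairing n (Poly_Mapping.lookup f) (Tk 1 \<phi>) = 2 * content_sum lam * pairing n (Poly_Mapping.lookup f) \<phi>"
proof -
  obtain N where N: "parts_le N f" using exists_parts_le by blast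
  have sym: "is_partition \<mu>" if "\<mu> \<in> Poly_Mapping.keys f" for \<mu>
    using assms that by (auto simp: is_jack_def sym_functions_def)
  \<comment> \<open>The cut-off selects the component of f of degree n. T_1 preserves the degree and
    hence commutes with it.\<close>
  let ?\<phi> = "\<lambda>\<mu>. if \<mu> \<in> partitions n then \<phi> \<mu> else 0"
  have "D_b f = p_const (content_sum lam) * f"
    using assms by (simp add: is_jack_def content_sum_def)
  then have "1/2 * pval f (Tk 1 ?\<phi>) = content_sum lam * pval f ?\<phi>"
    using pval_D_b[OF N, of ?\<phi>] by (simp only: pval_const_mult)
  moreover have "pval f (Tk 1 ?\<phi>) = pval f (\<lambda>\<mu>. if \<mu> \<in> partitions n then Tk 1 \<phi> \<mu> else 0)"
  proof (rule pval_cong)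
    fix \<mu> assume "\<mu> \<in> Poly_Mapping.keys f"
    then have \<mu>: "is_partition \<mu>" by (rule sym)
    show "Tk 1 ?\<phi> \<mu> = (if \<mu> \<in> partitions n then Tk 1 \<phi> \<mu> else 0)"
    proof (cases "\<mu> \<in> partitions n")
      case True
      have "agree n ?\<phi> \<phi>" by (simp add: agree_def)
      with True show ?thesis using Tk_agree[of n ?\<phi> \<phi> 1] by (simp add: agree_def)
    next
      case False
      with \<mu> have "agree (sum_mset \<mu>) ?\<phi> (\<lambda>_. 0)" by (auto simp: agree_def partitions_def)
      then have "Tk 1 ?\<phi> \<mu> = Tk 1 (\<lambda>_. 0) \<mu>"
        using Tk_agree[of "sum_mset \<mu>" ?\<phi> "\<lambda>_. 0" 1] \<mu> by (simp add: agree_def partitions_def)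
      with False show ?thesis
        by (simp add: T1_eq[unfolded One_nat_def] Djoin_def Dsplit_def Ddiag_def)
    qed
  qed
  ultimately show ?thesis
    unfolding pval_eq_pairing by (simp add: field_simps)
qed

lemma lookup_restrict_vars:
  assumes "f \<in> sym_functions"
  shows "Poly_Mapping.lookup (restrict_vars N f) (expo N e) =
    pairing (sum e {..<N}) (Poly_Mapping.lookup f) (mono_coeff N e)"
proof -
  have "Poly_Mapping.lookup (restrict_vars N f) (expo N e) = pval f (mono_coeff N e)"
    unfolding restrict_vars_def lookup_sum x_const_def lookup_const_mult pval_def mono_coeff_def ..
  also have "\<dots> = pval f (\<lambda>\<mu>. if \<mu> \<in> partitions (sum e {..<N}) then mono_coeff N e \<mu> else 0)"
    using assms mono_coeff_degree[of N e] by (intro pval_cong) (auto simp: sym_functions_def partitions_def)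
  finally show ?thesis unfolding pval_eq_pairing .
qed

lemma lookup_monomial_sym:
  "Poly_Mapping.lookup (monomial_sym N \<nu>) (expo N e) = (if positive_parts (shape N e) = \<nu> then 1 else 0)"
proof -
  let ?E = "{e. Poly_Mapping.keys e \<subseteq> {..<N} \<and>
           image_mset (Poly_Mapping.lookup e) (mset_set (Poly_Mapping.keys e)) = \<nu>}"
  have "finite ?E"
  proof (rule finite_subset)
    let ?F = "PiE {..<N} (\<lambda>_. insert 0 (set_mset \<nu>))"
    show "?E \<subseteq> expo N ` ?F"
    proof
      fix e assume e: "e \<in> ?E"
      define g where "g = restrict (Poly_Mapping.lookup e) {..<N}"
      have "e = expo N g"
        using e by (auto simp: poly_mapping_eq_iff fun_eq_iff g_def in_keys_iff)
      moreover have "g \<in> ?F"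
      proof (rule PiE_I)
        fix i assume "i \<in> {..<N}"
        have "Poly_Mapping.lookup e i \<in># \<nu>" if "i \<in> Poly_Mapping.keys e"
          using e that by auto
        then show "g i \<in> insert 0 (set_mset \<nu>)"
          using \<open>i \<in> {..<N}\<close> by (auto simp: g_def in_keys_iff)
      qed (simp add: g_def)
      ultimately show "e \<in> expo N ` ?F" by blast
    qed
    show "finite (expo N ` ?F)" by (intro finite_imageI finite_PiE) auto
  qed
  then have "Poly_Mapping.lookup (monomial_sym N \<nu>) (expo N e) = (if expo N e \<in> ?E then 1 else 0)"
    unfolding monomial_sym_def lookup_sum by (simp add: lookup_single when_def)
  moreover have "expo N e \<in> ?E \<longleftrightarrow> positive_parts (shape N e) = \<nu>"
  proof -
    have keys: "Poly_Mapping.keys (expo N e) = {i \<in> {..<N}. e i \<noteq> 0}"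
      by (auto simp: in_keys_iff split: if_splits)
    have "image_mset (Poly_Mapping.lookup (expo N e)) (mset_set {i \<in> {..<N}. e i \<noteq> 0})
      = image_mset e (mset_set {i \<in> {..<N}. e i \<noteq> 0})"
      by (rule image_mset_cong) simp
    also have "\<dots> = positive_parts (shape N e)"
      by (simp add: positive_parts_def shape_def filter_mset_image_mset filter_mset_mset_set)
    finally show ?thesis unfolding mem_Collect_eq keys by auto
  qed
  ultimately show ?thesis by simp
qed

lemma jack_mono_coeff:
  assumes "is_jack lam f" "is_partition lam" "sum e {..<N} = n"
  shows "positive_parts (shape N e) = lam \<Longrightarrow> pairing n (Poly_Mapping.lookup f) (mono_coeff N e) = hook_b lam"
    and "pairing n (Poly_Mapping.lookup f) (mono_coeff N e) \<noteq> 0 \<Longrightarrow>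
      positive_parts (shape N e) = lam \<or> dominance_less (positive_parts (shape N e)) lam"
proof -
  have f: "f \<in> sym_functions" using assms(1) by (simp add: is_jack_def)
  let ?S = "{\<nu>. is_partition \<nu> \<and> dominance_less \<nu> lam}"
  obtain u where u: "restrict_vars N f = x_const (hook_b lam) * monomial_sym N lam
        + (\<Sum>\<nu>\<in>?S. x_const (u \<nu>) * monomial_sym N \<nu>)"
    using assms(1) by (auto simp: is_jack_def)
  have fin: "finite ?S"
    by (rule finite_subset[OF _ finite_partitions[of "sum_mset lam"]]) (auto simp: dominance_less_def partitions_def)
  have "pairing n (Poly_Mapping.lookup f) (mono_coeff N e) =
      hook_b lam * (if positive_parts (shape N e) = lam then 1 else 0)
      + (\<Sum>\<nu>\<in>?S. u \<nu> * (if positive_parts (shape N e) = \<nu> then 1 else 0))"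
    unfolding assms(3)[symmetric] lookup_restrict_vars[OF f, symmetric] u
      lookup_add lookup_sum x_const_def lookup_const_mult lookup_monomial_sym ..
  also have "(\<Sum>\<nu>\<in>?S. u \<nu> * (if positive_parts (shape N e) = \<nu> then 1 else 0))
      = (if positive_parts (shape N e) \<in> ?S then u (positive_parts (shape N e)) else 0)"
    using fin by (simp add: if_distrib[of "\<lambda>x. _ * x"] cong: if_cong)
  finally have *: "pairing n (Poly_Mapping.lookup f) (mono_coeff N e) =
      hook_b lam * (if positive_parts (shape N e) = lam then 1 else 0)
      + (if positive_parts (shape N e) \<in> ?S then u (positive_parts (shape N e)) else 0)" .
  show "pairing n (Poly_Mapping.lookup f) (mono_coeff N e) = hook_b lam" if "positive_parts (shape N e) = lam"
    unfolding * that by (simp add: dominance_less_def)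
  show "positive_parts (shape N e) = lam \<or> dominance_less (positive_parts (shape N e)) lam"
    if "pairing n (Poly_Mapping.lookup f) (mono_coeff N e) \<noteq> 0"
    using that unfolding * by (auto split: if_splits)
qed

section \<open>The Jack basis\<close>

lemma Tk_lincomb: "Tk k (\<lambda>\<mu>. \<Sum>i\<in>A. c i * f i \<mu>) = (\<lambda>\<mu>. \<Sum>i\<in>A. c i * Tk k (f i) \<mu>)"
proof (rule ext)
  fix \<mu>
  have "Theta (\<lambda>\<mu>. \<Sum>i\<in>A. c i * f i \<mu>) = (\<lambda>m \<mu>. \<Sum>i\<in>A. c i * Theta (f i) m \<mu>)"
    by (intro ext) (simp add: Theta_def)
  then show "Tk k (\<lambda>\<mu>. \<Sum>i\<in>A. c i * f i \<mu>) \<mu> = (\<Sum>i\<in>A. c i * Tk k (f i) \<mu>)"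
    by (simp only: Tk_def Laxpow_sum Laxpow_cmult Nabla_sum Nabla_cmult)
qed

lemma Rk_lincomb: "Rk k (\<lambda>\<mu>. \<Sum>i\<in>A. c i * f i \<mu>) = (\<lambda>\<mu>. \<Sum>i\<in>A. c i * Rk k (f i) \<mu>)"
proof (rule ext)
  fix \<mu>
  have "Eps (\<lambda>\<mu>. \<Sum>i\<in>A. c i * f i \<mu>) = (\<lambda>m \<mu>. \<Sum>i\<in>A. c i * Eps (f i) m \<mu>)"
    by (intro ext) (simp add: Eps_def)
  then show "Rk k (\<lambda>\<mu>. \<Sum>i\<in>A. c i * f i \<mu>) \<mu> = (\<Sum>i\<in>A. c i * Rk k (f i) \<mu>)"
    by (simp only: Rk_def Laxpow_sum Laxpow_cmult Nabla_sum Nabla_cmult)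
qed

lemma pairing_lincomb: "pairing n v (\<lambda>\<mu>. \<Sum>i\<in>A. c i * f i \<mu>) = (\<Sum>i\<in>A. c i * pairing n v (f i))"
  by (simp only: pairing_sum pairing_cmult)

text \<open>In the finite-dimensional degree n, any linear functional on forms is evaluation at a
  vector. This makes T_k J_\<lambda> and p_1^* J_\<lambda> available as coefficient vectors.\<close>

lemma linear_form_eq_pairing:
  fixes F :: "fnl \<Rightarrow> qb"
  assumes lin: "\<And>(A :: nat multiset set) c f. F (\<lambda>\<mu>. \<Sum>i\<in>A. c i * f i \<mu>) = (\<Sum>i\<in>A. c i * F (f i))"
    and agr: "\<And>\<phi> \<phi>'. agree n \<phi> \<phi>' \<Longrightarrow> F \<phi> = F \<phi>'"
  shows "F \<phi> = pairing n (\<lambda>\<kappa>. F (\<lambda>\<mu>. if \<mu> = \<kappa> then 1 else 0)) \<phi>"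
proof -
  have "F \<phi> = F (\<lambda>\<mu>. \<Sum>\<kappa>\<in>partitions n. \<phi> \<kappa> * (if \<mu> = \<kappa> then 1 else 0))"
    by (rule agr) (simp add: agree_def if_distrib[of "\<lambda>x. _ * x"] cong: if_cong)
  then show ?thesis unfolding lin pairing_def .
qed

lemma hook_b_nonzero: "hook_b lam \<noteq> 0"
proof -
  have "(1 + b) * of_nat x + of_nat y + 1 \<noteq> 0" for x y
  proof
    assume "(1 + b) * of_nat x + of_nat y + 1 = 0"
    then have "of_nat (x + y + 1) + of_nat x * b = of_nat 0 + of_nat 0 * b"
      by (simp add: algebra_simps)
    from nat_b_independent[OF this] show False by simp
  qed
  then show ?thesis
    unfolding hook_b_def by (cases "finite (boxes lam)") (simp_all add: prod_zero_iff)
qed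

lemma weight_mono:
  assumes "below A B" "sum_mset A = sum_mset B" shows "weight A \<le> weight B"
proof -
  have mem: "x \<le> sum_mset C" if "x \<in># C" for x and C :: "nat multiset"
    using multi_member_split[OF that] by auto
  have "weight A = 2 * (\<Sum>t = 1..sum_mset A. excess A t)"
    by (rule weight_eq_excess) (rule mem)
  also have "\<dots> \<le> 2 * (\<Sum>t = 1..sum_mset A. excess B t)"
    using assms(1) unfolding below_def by (intro mult_le_mono2 sum_mono) blast
  also have "\<dots> = weight B"
    unfolding assms(2) by (rule weight_eq_excess[symmetric]) (rule mem)
  finally show ?thesis .
qed

section \<open>Leading exponents and eigenvalues\<close>

definition exponents :: "nat multiset \<Rightarrow> nat \<Rightarrow> nat" where
  "exponents lam = (SOME e. positive_parts (shape (sum_mset lam) e) = lam)"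

lemma shape_exponents:
  assumes "is_partition lam"
  shows "positive_parts (shape (sum_mset lam) (exponents lam)) = lam"
proof -
  obtain e where "positive_parts (shape (sum_mset lam) e) = lam"
    using exists_shape[OF assms size_le_sum_mset[OF assms]] .
  then show ?thesis unfolding exponents_def by (rule someI[where P = "\<lambda>e. positive_parts (shape (sum_mset lam) e) = lam"])
qed

lemma sum_eq_if_positive_parts: "positive_parts (shape N e) = lam \<Longrightarrow> sum e {..<N} = sum_mset lam"
  using sum_mset_positive_parts[of "shape N e"] by (simp add: sum_mset_shape)

definition tcoeff :: "nat multiset \<Rightarrow> nat \<Rightarrow> qb" where
  "tcoeff lam k = tval (sum_mset lam) (exponents lam) k"

lemma tval_eq_tcoeff:
  assumes "is_partition lam" "positive_parts (shape (sum_mset lam) e) = lam"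
  shows "tval (sum_mset lam) e k = tcoeff lam k"
  unfolding tcoeff_def using assms shape_exponents[OF assms(1)]
  by (intro tval_shape shape_eq_if_positive_parts_eq) simp

text \<open>The factor of \<open>Bk i 0\<close> on the component J_\<nu> of p_1^* J_\<lambda>, with
  c the difference of the content sums. The start is \<open>Bk 0 0 = Rk 1\<close>; the recursion is
  \<open>Bk_Suc\<close> solved for \<open>Bk (Suc i) j\<close>.\<close>

fun beta :: "nat multiset \<Rightarrow> qb \<Rightarrow> nat \<Rightarrow> qb" where
  "beta \<nu> c 0 = c"
| "beta \<nu> c (Suc i) = (c - b) * beta \<nu> c i - \<alpha> * tcoeff \<nu> i"

locale jack_family =
  fixes J :: "nat multiset \<Rightarrow> psym"
  assumes jack: "is_partition lam \<Longrightarrow> is_jack lam (J lam)"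
begin

definition pr :: "nat multiset \<Rightarrow> fnl \<Rightarrow> qb" where
  "pr lam \<phi> = pairing (sum_mset lam) (Poly_Mapping.lookup (J lam)) \<phi>"

lemma pr_lincomb: "pr lam (\<lambda>\<mu>. \<Sum>i\<in>A. c i * f i \<mu>) = (\<Sum>i\<in>A. c i * pr lam (f i))"
  unfolding pr_def by (rule pairing_lincomb)

lemma pr_agree: "agree (sum_mset lam) \<phi> \<phi>' \<Longrightarrow> pr lam \<phi> = pr lam \<phi>'"
  unfolding pr_def by (rule pairing_agree)

lemma pr_T1: "is_partition lam \<Longrightarrow> pr lam (Tk 1 \<phi>) = 2 * content_sum lam * pr lam \<phi>"
  unfolding pr_def by (rule jack_T1[OF jack])

lemma pr_mono_coeff:
  assumes "is_partition lam" "positive_parts (shape N e) = lam"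
  shows "pr lam (mono_coeff N e) = hook_b lam"
  unfolding pr_def
  by (rule jack_mono_coeff(1)[OF jack[OF assms(1)] assms(1) sum_eq_if_positive_parts[OF assms(2)] assms(2)])

lemma pr_mono_coeff_support:
  assumes "is_partition lam" "sum e {..<N} = sum_mset lam" "pr lam (mono_coeff N e) \<noteq> 0"
  shows "below (shape N e) lam" "positive_parts (shape N e) = lam \<or> weight (shape N e) < weight lam"
proof -
  have *: "positive_parts (shape N e) = lam \<or> dominance_less (positive_parts (shape N e)) lam"
    using jack_mono_coeff(2)[OF jack[OF assms(1)] assms(1,2)] assms(3) unfolding pr_def .
  then have "below (positive_parts (shape N e)) lam"
    using dominance_less_below by auto
  then show below: "below (shape N e) lam" by (simp add: below_def)
  have sum: "sum_mset (shape N e) = sum_mset lam" using assms(2) by (simp add: sum_mset_shape)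
  show "positive_parts (shape N e) = lam \<or> weight (shape N e) < weight lam"
    using weight_mono[OF below sum] below_weight_eq[of "positive_parts (shape N e)" lam] assms(1) below sum
    by (auto simp: below_def)
qed

lemma pr_mono_coeff_eq_0:
  assumes "is_partition lam" "\<not> below (shape N e) lam"
  shows "pr lam (mono_coeff N e) = 0"
proof (rule ccontr)
  assume *: "pr lam (mono_coeff N e) \<noteq> 0"
  have "sum e {..<N} = sum_mset lam"
  proof (rule ccontr)
    assume "sum e {..<N} \<noteq> sum_mset lam"
    then have "mono_coeff N e \<mu> = 0" if "\<mu> \<in> partitions (sum_mset lam)" for \<mu>
      using that mono_coeff_degree[of N e \<mu>] by (auto simp: partitions_def)
    with * show False by (simp add: pr_def pairing_def)
  qed
  with assms * show False using pr_mono_coeff_support(1) by blast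
qed

lemma not_strictly_below:
  assumes "is_partition lam" "positive_parts (shape N e) = lam" "strictly_below (shape N e) A"
  shows "\<not> below A lam"
  using assms(3) excess_positive_parts[of "shape N e"] unfolding assms(2) strictly_below_def below_def by simp

text \<open>The eigenvalue postulated for J_\<lambda> is compared with the action of T_1 at the
  leading monomial, whose coefficient \<open>hook_b lam\<close> is nonzero.\<close>

lemma content_sum_weight:
  assumes lam: "is_partition lam" and e: "positive_parts (shape N e) = lam"
  shows "2 * content_sum lam = \<alpha> * of_nat (weight lam) - of_nat (overlap N e)"
proof -
  let ?u = "\<lambda>e. pr lam (mono_coeff N e)"
  have "raising N ?u e = (\<alpha> * of_nat (weight (shape N e)) - of_nat (overlap N e)) * ?u e"
  proof (rule raising_top)
    show "?u e = ?u e'" if "shape N e = shape N e'" for e e'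
      using mono_coeff_shape[OF that] by simp
    show "?u (transfer e i j a) = 0" if *: "i < N" "j < N" "i \<noteq> j" "a \<le> e i + e j"
      "max (e i) (e j) < a \<or> a < min (e i) (e j)" for i j a
      by (rule pr_mono_coeff_eq_0[OF lam not_strictly_below[OF lam e
            shape_transfer_strictly_below[of i N j a e, OF *]]])
  qed
  moreover have "raising N ?u e = 2 * content_sum lam * ?u e"
    using pr_T1[OF lam, of "mono_coeff N e"] unfolding pr_def pairing_T1_mono_coeff .
  moreover have "?u e \<noteq> 0" using pr_mono_coeff[OF lam e] hook_b_nonzero by simp
  moreover have "weight (shape N e) = weight lam"
    using weight_positive_parts[of "shape N e"] unfolding e by simp
  ultimately show ?thesis by simp
qed

text \<open>This takes the place of simplicity of the eigenvalue, which fails: an eigenvector can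
  start only at shapes of the weight of \<lambda>, so vanishing there is enough.\<close>

lemma eigenvector_zero:
  assumes lam: "is_partition lam" "sum_mset lam = n"
    and eig: "\<And>\<phi>. pairing n v (Tk 1 \<phi>) = 2 * content_sum lam * pairing n v \<phi>"
    and supp: "\<And>e. sum e {..<n} = n \<Longrightarrow> weight (shape n e) = weight lam \<Longrightarrow> pairing n v (mono_coeff n e) = 0"
    and "\<kappa> \<in> partitions n"
  shows "v \<kappa> = 0"
proof (rule pairing_mono_coeff_injective[OF _ order_refl \<open>\<kappa> \<in> partitions n\<close>])
  fix e :: "nat \<Rightarrow> nat" assume "sum e {..<n} = n"
  then show "pairing n v (mono_coeff n e) = 0"
  proof (rule raising_eigenvector_zero[where u = "\<lambda>e. pairing n v (mono_coeff n e)" and W = "weight lam"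
        and B = "overlap n (exponents lam)", rotated 3])
    show "pairing n v (mono_coeff n e) = pairing n v (mono_coeff n e')" if "shape n e = shape n e'" for e e'
      using mono_coeff_shape[OF that] by simp
    show "raising n (\<lambda>e. pairing n v (mono_coeff n e)) e =
        (\<alpha> * of_nat (weight lam) - of_nat (overlap n (exponents lam))) * pairing n v (mono_coeff n e)" for e
      using eig[of "mono_coeff n e"] content_sum_weight[OF lam(1) shape_exponents[OF lam(1)]]
      unfolding pairing_T1_mono_coeff lam(2) by simp
    show "weight (shape n e) \<noteq> weight lam" if "sum e {..<n} = n" "pairing n v (mono_coeff n e) \<noteq> 0" for e
      using supp that by blast
  qed
qed

text \<open>As T_k commutes with T_1, subtracting from T_k J_\<lambda> its leading multiple of
  J_\<lambda> gives a T_1-eigenvector for the eigenvalue of \<lambda>. It has no coefficient at the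
  weight of \<lambda>, so it is zero.\<close>

lemma pr_Tk:
  assumes lam: "is_partition lam"
  shows "pr lam (Tk k \<phi>) = tcoeff lam k * pr lam \<phi>"
proof -
  define n where "n = sum_mset lam"
  define F where "F \<phi> = pr lam (Tk k \<phi>) - tcoeff lam k * pr lam \<phi>" for \<phi>
  define v where "v \<kappa> = F (\<lambda>\<mu>. if \<mu> = \<kappa> then 1 else 0)" for \<kappa>
  have F: "F \<phi> = pairing n v \<phi>" for \<phi>
    unfolding v_def
  proof (rule linear_form_eq_pairing)
    show "F (\<lambda>\<mu>. \<Sum>i\<in>A. c i * f i \<mu>) = (\<Sum>i\<in>A. c i * F (f i))" for A :: "nat multiset set" and c f
      unfolding F_def Tk_lincomb pr_lincomb by (simp add: sum_subtractf sum_distrib_left algebra_simps)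
    show "F \<phi> = F \<phi>'" if "agree n \<phi> \<phi>'" for \<phi> \<phi>'
      unfolding F_def using pr_agree[of lam] Tk_agree[of n \<phi> \<phi>' k] that by (simp add: n_def)
  qed
  have "v \<kappa> = 0" if "\<kappa> \<in> partitions n" for \<kappa>
  proof (rule eigenvector_zero[OF lam n_def[symmetric] _ _ that])
    show "pairing n v (Tk 1 \<phi>) = 2 * content_sum lam * pairing n v \<phi>" for \<phi>
      unfolding F[symmetric] F_def Tk_T1 pr_T1[OF lam] by (simp add: algebra_simps)
    show "pairing n v (mono_coeff n e) = 0" if e: "sum e {..<n} = n" "weight (shape n e) = weight lam" for e
    \<comment> \<open>At equal weight, being below \<lambda> means being \<lambda>. Otherwise
      everything from this shape upwards lies outside the support of J_\<lambda>, and T_k produces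
      nothing there.\<close>
    proof (cases "below (shape n e) lam")
      case True
      have sh: "positive_parts (shape n e) = lam"
        using True e lam by (intro below_weight_eq) (simp_all add: below_def sum_mset_shape n_def)
      have "pr lam (mono_coeff n e') = 0" if "strictly_below (shape n e) (shape n e')" for e'
        by (rule pr_mono_coeff_eq_0[OF lam not_strictly_below[OF lam sh that]])
      then have "pr lam (Tk k (mono_coeff n e)) = tval n e k * pr lam (mono_coeff n e)"
        unfolding pr_def n_def[symmetric] by (rule pairing_Tk_mono_coeff)
      then show ?thesis
        unfolding F[symmetric] F_def using tval_eq_tcoeff[OF lam] sh by (simp add: n_def)
    next
      case False
      have zero: "pr lam (mono_coeff n e') = 0" if "below (shape n e) (shape n e')" for e'
        by (rule pr_mono_coeff_eq_0[OF lam]) (use that False below_trans in blast)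
      then have "pr lam (Tk k (mono_coeff n e)) = tval n e k * pr lam (mono_coeff n e)"
        unfolding pr_def n_def[symmetric] by (intro pairing_Tk_mono_coeff) (simp add: strictly_below_def)
      then show ?thesis
        unfolding F[symmetric] F_def using zero[of e] by simp
    qed
  qed
  then have "F \<phi> = 0" unfolding F pairing_def by (simp add: sum.neutral)
  then show ?thesis by (simp add: F_def)
qed

text \<open>Elimination from the top, where w bounds the weights at which v has coefficients. The
  J_\<nu> with \<open>weight \<nu> = w\<close> can be subtracted all at once, since each has no
  other shape of that weight.\<close>

lemma jack_span:
  "\<exists>x. \<forall>\<phi>. pairing n v \<phi> = (\<Sum>\<nu>\<in>partitions n. x \<nu> * pr \<nu> \<phi>)"
proof -
  have part: "is_partition \<nu>" "sum_mset \<nu> = n" if "\<nu> \<in> partitions n" for \<nu>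
    using that by (auto simp: partitions_def)
  have "\<exists>x. \<forall>\<phi>. pairing n v \<phi> = (\<Sum>\<nu>\<in>partitions n. x \<nu> * pr \<nu> \<phi>)"
    if "\<And>e. sum e {..<n} = n \<Longrightarrow> w \<le> weight (shape n e) \<Longrightarrow> pairing n v (mono_coeff n e) = 0" for w
    using that
  proof (induction w arbitrary: v)
    case 0
    have "v \<kappa> = 0" if "\<kappa> \<in> partitions n" for \<kappa>
      by (rule pairing_mono_coeff_injective[OF _ order_refl that]) (rule 0, simp_all)
    then have "pairing n v \<phi> = (\<Sum>\<nu>\<in>partitions n. 0 * pr \<nu> \<phi>)" for \<phi>
      by (simp add: pairing_def)
    then show ?case by (intro exI[of _ "\<lambda>_. 0"] allI)
  next
    case (Suc w)
    define c where "c \<nu> = (if weight \<nu> = w then pairing n v (mono_coeff n (exponents \<nu>)) / hook_b \<nu> else 0)" for \<nu>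
    define v' where "v' \<kappa> = v \<kappa> - (\<Sum>\<nu>\<in>partitions n. c \<nu> * Poly_Mapping.lookup (J \<nu>) \<kappa>)" for \<kappa>
    have v': "pairing n v' \<phi> = pairing n v \<phi> - (\<Sum>\<nu>\<in>partitions n. c \<nu> * pr \<nu> \<phi>)" for \<phi>
    proof -
      have "(\<Sum>\<nu>\<in>partitions n. c \<nu> * pr \<nu> \<phi>)
        = (\<Sum>\<nu>\<in>partitions n. \<Sum>\<kappa>\<in>partitions n. \<phi> \<kappa> * (c \<nu> * Poly_Mapping.lookup (J \<nu>) \<kappa>))"
        by (rule sum.cong) (auto simp: pr_def part pairing_def sum_distrib_left mult.left_commute)
      also have "\<dots> = (\<Sum>\<kappa>\<in>partitions n. \<phi> \<kappa> * (\<Sum>\<nu>\<in>partitions n. c \<nu> * Poly_Mapping.lookup (J \<nu>) \<kappa>))"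
        unfolding sum_distrib_left by (rule sum.swap)
      finally show ?thesis
        by (simp add: pairing_def v'_def right_diff_distrib sum_subtractf)
    qed
    have "pairing n v' (mono_coeff n e) = 0" if e: "sum e {..<n} = n" "w \<le> weight (shape n e)" for e
    proof -
      let ?\<nu> = "positive_parts (shape n e)"
      have \<nu>: "?\<nu> \<in> partitions n" using e by (simp add: partitions_def sum_mset_shape)
      have zero: "c \<nu> * pr \<nu> (mono_coeff n e) = 0" if "\<nu> \<in> partitions n" "\<nu> \<noteq> ?\<nu>" for \<nu>
      proof (cases "weight \<nu> = w \<and> pr \<nu> (mono_coeff n e) \<noteq> 0")
        case True
        then have "weight (shape n e) < w"
          using pr_mono_coeff_support(2)[of \<nu> e n] part[OF that(1)] that(2) e by auto
        with e show ?thesis by simp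
      qed (auto simp: c_def)
      have "(\<Sum>\<nu>\<in>partitions n. c \<nu> * pr \<nu> (mono_coeff n e)) =
          (\<Sum>\<nu>\<in>partitions n. if \<nu> = ?\<nu> then c ?\<nu> * pr ?\<nu> (mono_coeff n e) else 0)"
        by (rule sum.cong) (use zero in auto)
      also have "\<dots> = c ?\<nu> * hook_b ?\<nu>"
        using \<nu> pr_mono_coeff[of ?\<nu> n e] by simp
      finally have *: "(\<Sum>\<nu>\<in>partitions n. c \<nu> * pr \<nu> (mono_coeff n e)) = c ?\<nu> * hook_b ?\<nu>" .
      show ?thesis
      proof (cases "weight (shape n e) = w")
        case True
        have "shape n (exponents ?\<nu>) = shape n e"
          using shape_exponents[of ?\<nu>] part(2)[OF \<nu>] by (intro shape_eq_if_positive_parts_eq) simp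
        then have "mono_coeff n (exponents ?\<nu>) = mono_coeff n e" by (rule mono_coeff_shape)
        then show ?thesis
          unfolding v' * using True by (simp add: c_def hook_b_nonzero)
      next
        case False
        with e Suc.prems[OF e(1)] show ?thesis
          unfolding v' * by (simp add: c_def)
      qed
    qed
    from Suc.IH[of v', OF this] obtain x where x: "\<And>\<phi>. pairing n v' \<phi> = (\<Sum>\<nu>\<in>partitions n. x \<nu> * pr \<nu> \<phi>)"
      by blast
    have "pairing n v \<phi> = (\<Sum>\<nu>\<in>partitions n. (x \<nu> + c \<nu>) * pr \<nu> \<phi>)" for \<phi>
      using v'[of \<phi>] x[of \<phi>] by (simp add: distrib_right sum.distrib)
    then show ?case by (intro exI[of _ "\<lambda>\<nu>. x \<nu> + c \<nu>"] allI)
  qed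
  moreover have "pairing n v (mono_coeff n e) = 0" if "sum e {..<n} = n" "Suc (n * n) \<le> weight (shape n e)" for e
    using weight_le[of "shape n e"] that by (simp add: sum_mset_shape)
  ultimately show ?thesis by blast
qed

text \<open>Take \<kappa> of maximal weight with nonzero coefficient: at the leading exponents of
  \<kappa> no other J_\<nu> in the relation contributes.\<close>

lemma jack_independent:
  assumes zero: "\<And>\<phi>. (\<Sum>\<nu>\<in>partitions n. x \<nu> * pr \<nu> \<phi>) = 0" and "\<nu> \<in> partitions n"
  shows "x \<nu> = 0"
proof (rule ccontr)
  assume "x \<nu> \<noteq> 0"
  let ?S = "{\<nu> \<in> partitions n. x \<nu> \<noteq> 0}"
  have fin: "finite ?S" "?S \<noteq> {}" using assms(2) \<open>x \<nu> \<noteq> 0\<close> by auto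
  obtain \<kappa> where \<kappa>: "\<kappa> \<in> ?S" "\<And>\<nu>. \<nu> \<in> ?S \<Longrightarrow> weight \<nu> \<le> weight \<kappa>"
  proof -
    have "Max (weight ` ?S) \<in> weight ` ?S" using fin by (intro Max_in) auto
    then obtain \<kappa> where \<kappa>: "Max (weight ` ?S) = weight \<kappa>" "\<kappa> \<in> ?S" by (rule imageE)
    have "weight \<nu> \<le> Max (weight ` ?S)" if "\<nu> \<in> ?S" for \<nu>
      by (rule Max_ge[OF finite_imageI[OF fin(1)] imageI[OF that]])
    then show thesis unfolding \<kappa>(1) by (rule that[OF \<kappa>(2)])
  qed
  have part: "is_partition \<nu>" "sum_mset \<nu> = n" if "\<nu> \<in> ?S" for \<nu>
    using that by (auto simp: partitions_def)
  have e: "positive_parts (shape n (exponents \<kappa>)) = \<kappa>"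
    using shape_exponents[OF part(1)[OF \<kappa>(1)]] part(2)[OF \<kappa>(1)] by simp
  let ?X = "mono_coeff n (exponents \<kappa>)"
  have "x \<nu> * pr \<nu> ?X = 0" if "\<nu> \<in> partitions n" "\<nu> \<noteq> \<kappa>" for \<nu>
  proof (rule ccontr)
    assume *: "x \<nu> * pr \<nu> ?X \<noteq> 0"
    then have \<nu>: "\<nu> \<in> ?S" using that by auto
    have "sum (exponents \<kappa>) {..<n} = sum_mset \<nu>"
      using sum_eq_if_positive_parts[OF e] part(2)[OF \<nu>] part(2)[OF \<kappa>(1)] by simp
    then have "weight (shape n (exponents \<kappa>)) < weight \<nu>"
      using pr_mono_coeff_support(2)[OF part(1)[OF \<nu>], of "exponents \<kappa>" n] * e that(2) by auto
    then show False
      using \<kappa>(2)[OF \<nu>] weight_positive_parts[of "shape n (exponents \<kappa>)"] unfolding e by simp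
  qed
  then have "(\<Sum>\<nu>\<in>partitions n. x \<nu> * pr \<nu> ?X) = (\<Sum>\<nu>\<in>partitions n. if \<nu> = \<kappa> then x \<kappa> * pr \<kappa> ?X else 0)"
    by (intro sum.cong) auto
  also have "\<dots> = x \<kappa> * hook_b \<kappa>"
    using \<kappa>(1) pr_mono_coeff[OF part(1)[OF \<kappa>(1)] e] by simp
  finally show False
    using zero[of ?X] \<kappa>(1) hook_b_nonzero by simp
qed

section \<open>The components of p_1^* J_\<lambda>\<close>

lemma lower_expansion:
  assumes "is_partition lam" "sum_mset lam = Suc n"
  obtains r where "\<And>\<phi>. pr lam (lower \<phi>) = (\<Sum>\<nu>\<in>partitions n. r \<nu> * pr \<nu> \<phi>)"
proof -
  have "pr lam (lower \<phi>) = pairing n (\<lambda>\<kappa>. pr lam (lower (\<lambda>\<mu>. if \<mu> = \<kappa> then 1 else 0))) \<phi>" for \<phi>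
  proof (rule linear_form_eq_pairing)
    show "pr lam (lower (\<lambda>\<mu>. \<Sum>i\<in>A. c i * f i \<mu>)) = (\<Sum>i\<in>A. c i * pr lam (lower (f i)))" for A :: "nat multiset set" and c f
      unfolding Rk_lincomb pr_lincomb ..
    show "pr lam (lower \<phi>) = pr lam (lower \<phi>')" if "agree n \<phi> \<phi>'" for \<phi> \<phi>'
      using pr_agree[of lam] Rk_agree[OF that, of 0] assms(2) by simp
  qed
  then show thesis using jack_span[of n "\<lambda>\<kappa>. pr lam (lower (\<lambda>\<mu>. if \<mu> = \<kappa> then 1 else 0))"] that by metis
qed

text \<open>Each commutator with D_b multiplies the component J_\<nu> by the difference of the two
  content sums. That this difference is a content of \<lambda> is not yet known.\<close>

lemma pr_Rk:
  assumes lam: "is_partition lam"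
    and r: "\<And>\<phi>. pr lam (lower \<phi>) = (\<Sum>\<nu>\<in>partitions n. r \<nu> * pr \<nu> \<phi>)"
  shows "pr lam (Rk k \<phi>) = (\<Sum>\<nu>\<in>partitions n. r \<nu> * (content_sum lam - content_sum \<nu>) ^ k * pr \<nu> \<phi>)"
proof (induction k arbitrary: \<phi>)
  case (Suc k)
  have "2 * pr lam (Rk (Suc k) \<phi>) = pr lam (Tk 1 (Rk k \<phi>)) - pr lam (Rk k (Tk 1 \<phi>))"
  proof -
    have "(\<lambda>\<mu>. 2 * Rk (Suc k) \<phi> \<mu>) = (\<lambda>\<mu>. Tk 1 (Rk k \<phi>) \<mu> - Rk k (Tk 1 \<phi>) \<mu>)"
      by (rule ext) (rule Rk_Suc)
    from arg_cong[OF this, of "pr lam"] show ?thesis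
      unfolding pr_def pairing_cmult pairing_diff .
  qed
  also have "pr lam (Rk k (Tk 1 \<phi>)) = (\<Sum>\<nu>\<in>partitions n. r \<nu> * (content_sum lam - content_sum \<nu>) ^ k * (2 * content_sum \<nu> * pr \<nu> \<phi>))"
    unfolding Suc by (intro sum.cong refl arg_cong2[of _ _ _ _ "(*)"] pr_T1) (simp add: partitions_def)
  also have "pr lam (Tk 1 (Rk k \<phi>)) = (\<Sum>\<nu>\<in>partitions n. 2 * content_sum lam * (r \<nu> * (content_sum lam - content_sum \<nu>) ^ k * pr \<nu> \<phi>))"
    unfolding pr_T1[OF lam] Suc sum_distrib_left ..
  also have "(\<Sum>\<nu>\<in>partitions n. 2 * content_sum lam * (r \<nu> * (content_sum lam - content_sum \<nu>) ^ k * pr \<nu> \<phi>))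
      - (\<Sum>\<nu>\<in>partitions n. r \<nu> * (content_sum lam - content_sum \<nu>) ^ k * (2 * content_sum \<nu> * pr \<nu> \<phi>))
      = 2 * (\<Sum>\<nu>\<in>partitions n. r \<nu> * (content_sum lam - content_sum \<nu>) ^ Suc k * pr \<nu> \<phi>)"
    unfolding sum_subtractf[symmetric] sum_distrib_left by (intro sum.cong refl) (simp add: algebra_simps)
  finally show ?case by simp
qed (simp add: r)

lemma pr_Bk:
  assumes lam: "is_partition lam"
    and r: "\<And>\<phi>. pr lam (lower \<phi>) = (\<Sum>\<nu>\<in>partitions n. r \<nu> * pr \<nu> \<phi>)"
  shows "pr lam (Bk i j \<phi>) = (\<Sum>\<nu>\<in>partitions n. r \<nu> * (beta \<nu> (content_sum lam - content_sum \<nu>) i *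
    (content_sum lam - content_sum \<nu>) ^ j) * pr \<nu> \<phi>)"
proof (induction i arbitrary: j)
  case 0
  show ?case unfolding Bk_0 pr_Rk[OF assms] by simp
next
  case (Suc i)
  let ?c = "\<lambda>\<nu>. content_sum lam - content_sum \<nu>"
  have "pr lam (Bk i (Suc j) \<phi>) = pr lam (Bk (Suc i) j \<phi>) + b * pr lam (Bk i j \<phi>) + \<alpha> * pr lam (Rk j (Tk i \<phi>))"
  proof -
    have "Bk i (Suc j) \<phi> = (\<lambda>\<mu>. Bk (Suc i) j \<phi> \<mu> + b * Bk i j \<phi> \<mu> + \<alpha> * Rk j (Tk i \<phi>) \<mu>)"
      by (rule ext) (rule Bk_Suc)
    from arg_cong[OF this, of "pr lam"] show ?thesis
      unfolding pr_def pairing_cmult pairing_add .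
  qed
  then have "pr lam (Bk (Suc i) j \<phi>) = pr lam (Bk i (Suc j) \<phi>) - b * pr lam (Bk i j \<phi>) - \<alpha> * pr lam (Rk j (Tk i \<phi>))"
    by simp
  also have "pr lam (Rk j (Tk i \<phi>)) = (\<Sum>\<nu>\<in>partitions n. r \<nu> * ?c \<nu> ^ j * (tcoeff \<nu> i * pr \<nu> \<phi>))"
    unfolding pr_Rk[OF assms] by (intro sum.cong refl arg_cong2[of _ _ _ _ "(*)"] pr_Tk) (simp add: partitions_def)
  also have "pr lam (Bk i (Suc j) \<phi>) - b * pr lam (Bk i j \<phi>) - \<alpha> * \<dots> =
      (\<Sum>\<nu>\<in>partitions n. r \<nu> * (beta \<nu> (?c \<nu>) (Suc i) * ?c \<nu> ^ j) * pr \<nu> \<phi>)"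
    unfolding Suc sum_distrib_left sum_subtractf[symmetric]
    by (intro sum.cong refl) (simp add: algebra_simps)
  finally show ?case .
qed

text \<open>\<open>Tk_lower\<close> evaluated on J_\<lambda> becomes a relation between the J_\<nu>
  alone; by their independence it holds for each \<nu> with r \<nu> nonzero.\<close>

lemma tcoeff_lower:
  assumes lam: "is_partition lam"
    and r: "\<And>\<phi>. pr lam (lower \<phi>) = (\<Sum>\<nu>\<in>partitions n. r \<nu> * pr \<nu> \<phi>)"
    and \<nu>: "\<nu> \<in> partitions n" "r \<nu> \<noteq> 0" and c: "c = content_sum lam - content_sum \<nu>"
  shows "tcoeff lam k = tcoeff \<nu> k + c ^ k + (\<Sum>i<k. beta \<nu> c i * c ^ (k - 1 - i))"
proof -
  let ?c = "\<lambda>\<nu>. content_sum lam - content_sum \<nu>"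
  define x where "x \<nu> = r \<nu> * (tcoeff lam k - tcoeff \<nu> k - ?c \<nu> ^ k - (\<Sum>i<k. beta \<nu> (?c \<nu>) i * ?c \<nu> ^ (k - 1 - i)))" for \<nu>
  have "(\<Sum>\<nu>\<in>partitions n. x \<nu> * pr \<nu> \<phi>) = 0" for \<phi>
  proof -
    have "pr lam (Tk k (lower \<phi>)) = pr lam (lower (Tk k \<phi>)) + pr lam (Rk k \<phi>) + (\<Sum>i<k. pr lam (Bk i (k - 1 - i) \<phi>))"
    proof -
      have "Tk k (lower \<phi>) = (\<lambda>\<mu>. lower (Tk k \<phi>) \<mu> + Rk k \<phi> \<mu> + (\<Sum>i<k. Bk i (k - 1 - i) \<phi> \<mu>))"
        by (rule ext) (rule Tk_lower)
      from arg_cong[OF this, of "pr lam"] show ?thesis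
        unfolding pr_def pairing_add pairing_sum .
    qed
    moreover have "pr lam (Tk k (lower \<phi>)) = (\<Sum>\<nu>\<in>partitions n. tcoeff lam k * (r \<nu> * pr \<nu> \<phi>))"
      unfolding pr_Tk[OF lam] r sum_distrib_left ..
    moreover have "pr lam (lower (Tk k \<phi>)) = (\<Sum>\<nu>\<in>partitions n. r \<nu> * (tcoeff \<nu> k * pr \<nu> \<phi>))"
      unfolding r by (intro sum.cong refl arg_cong2[of _ _ _ _ "(*)"] pr_Tk) (simp add: partitions_def)
    moreover have "(\<Sum>i<k. pr lam (Bk i (k - 1 - i) \<phi>)) =
        (\<Sum>\<nu>\<in>partitions n. r \<nu> * (\<Sum>i<k. beta \<nu> (?c \<nu>) i * ?c \<nu> ^ (k - 1 - i)) * pr \<nu> \<phi>)"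
      unfolding pr_Bk[OF lam r] sum_distrib_left sum_distrib_right by (rule sum.swap)
    ultimately have "(\<Sum>\<nu>\<in>partitions n. tcoeff lam k * (r \<nu> * pr \<nu> \<phi>))
      = (\<Sum>\<nu>\<in>partitions n. r \<nu> * (tcoeff \<nu> k * pr \<nu> \<phi>))
      + (\<Sum>\<nu>\<in>partitions n. r \<nu> * ?c \<nu> ^ k * pr \<nu> \<phi>)
      + (\<Sum>\<nu>\<in>partitions n. r \<nu> * (\<Sum>i<k. beta \<nu> (?c \<nu>) i * ?c \<nu> ^ (k - 1 - i)) * pr \<nu> \<phi>)"
      unfolding pr_Rk[OF lam r] by simp
    moreover have "(\<Sum>\<nu>\<in>partitions n. x \<nu> * pr \<nu> \<phi>) = (\<Sum>\<nu>\<in>partitions n. tcoeff lam k * (r \<nu> * pr \<nu> \<phi>))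
      - (\<Sum>\<nu>\<in>partitions n. r \<nu> * (tcoeff \<nu> k * pr \<nu> \<phi>))
      - (\<Sum>\<nu>\<in>partitions n. r \<nu> * ?c \<nu> ^ k * pr \<nu> \<phi>)
      - (\<Sum>\<nu>\<in>partitions n. r \<nu> * (\<Sum>i<k. beta \<nu> (?c \<nu>) i * ?c \<nu> ^ (k - 1 - i)) * pr \<nu> \<phi>)"
      unfolding x_def sum_subtractf[symmetric] by (intro sum.cong refl) (simp only: algebra_simps)
    ultimately show ?thesis by simp
  qed
  then have "x \<nu> = 0" using \<nu>(1) by (rule jack_independent)
  with \<nu>(2) have "tcoeff lam k - tcoeff \<nu> k - c ^ k - (\<Sum>i<k. beta \<nu> c i * c ^ (k - 1 - i)) = 0"
    unfolding x_def c by (simp only: mult_eq_0_iff) simp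
  then show ?thesis by (simp only: diff_diff_eq eq_iff_diff_eq_0[symmetric] add.assoc)
qed

end

section \<open>Eigenvalues in terms of contents\<close>

definition lin :: "'a \<Rightarrow> 'a::comm_ring_1 fps" where
  "lin x = 1 - fps_const x * fps_X"

lemma lin_nonzero: "lin x \<noteq> (0 :: 'a::comm_ring_1 fps)"
proof
  assume "lin x = 0"
  from arg_cong[OF this, of "\<lambda>f. fps_nth f 0"] show False by (simp add: lin_def)
qed

definition tseries :: "nat multiset \<Rightarrow> qb fps" where
  "tseries lam = Abs_fps (tcoeff lam)"

text \<open>With \<open>z = 1/u\<close> this is \<open>z (u + b - \<alpha> \<Theta> (u - L)\<^sup>-\<^sup>1 \<nabla>)\<close>. The shift by \<open>b\<close> makes it multiplicative
  over the boxes.\<close>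

definition wseries :: "nat multiset \<Rightarrow> qb fps" where
  "wseries lam = 1 + fps_const b * fps_X - fps_const \<alpha> * fps_X\<^sup>2 * tseries lam"

lemma geometric_fps: "lin c * Abs_fps (\<lambda>k. c ^ k) = 1"
proof (rule fps_ext)
  fix k
  show "fps_nth (lin c * Abs_fps (\<lambda>k. c ^ k)) k = fps_nth 1 k"
    by (cases k) (simp_all add: lin_def left_diff_distrib mult.assoc)
qed

text \<open>In generating series the hypothesis reads t_\<lambda> = t_\<nu> + G + X B G with G =
  1/(1 - cX), and the recursion of \<open>beta\<close> is a linear equation for B. Eliminating G and
  B leaves a rational factor depending on c alone.\<close>

lemma wseries_step:
  assumes "\<And>k. tcoeff lam k = tcoeff \<nu> k + c ^ k + (\<Sum>i<k. beta \<nu> c i * c ^ (k - 1 - i))"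
  shows "lin c * lin (c - b) * wseries lam = lin (c + 1) * lin (c - 1 - b) * wseries \<nu>"
proof -
  define G where "G = Abs_fps (\<lambda>k. c ^ k)"
  define B where "B = Abs_fps (beta \<nu> c)"
  have G: "lin c * G = 1" unfolding G_def by (rule geometric_fps)
  have 1: "tseries lam = tseries \<nu> + G + fps_X * (B * G)"
  proof (rule fps_ext)
    fix k
    have "fps_nth (fps_X * (B * G)) k = (if k = 0 then 0 else fps_nth (B * G) (k - 1))" by simp
    also have "\<dots> = (\<Sum>i<k. beta \<nu> c i * c ^ (k - 1 - i))"
      unfolding fps_mult_nth B_def G_def by (cases k) (simp_all add: atLeast0AtMost lessThan_Suc_atMost)
    finally have "fps_nth (fps_X * (B * G)) k = (\<Sum>i<k. beta \<nu> c i * c ^ (k - 1 - i))" .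
    then show "fps_nth (tseries lam) k = fps_nth (tseries \<nu> + G + fps_X * (B * G)) k"
      using assms[of k] by (simp add: tseries_def G_def)
  qed
  have 2: "B = fps_const c + fps_X * (fps_const (c - b) * B - fps_const \<alpha> * tseries \<nu>)"
  proof (rule fps_ext)
    fix k
    show "fps_nth B k = fps_nth (fps_const c + fps_X * (fps_const (c - b) * B - fps_const \<alpha> * tseries \<nu>)) k"
      by (cases k) (simp_all add: B_def tseries_def)
  qed
  have c1: "fps_const (c - b) = fps_const c - fps_const b" "fps_const (c + 1) = fps_const c + 1"
    "fps_const (c - 1 - b) = fps_const c - 1 - fps_const b" "fps_const \<alpha> = 1 + fps_const b"
    by (simp_all add: fps_const_sub[symmetric] fps_const_add[symmetric] del: fps_const_sub fps_const_add)
  show ?thesis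
    using G 1 2 unfolding wseries_def lin_def c1 by algebra
qed

text \<open>The nonzero elements are the inverses of the roots of the product. As
  \<open>lin 0 = 1\<close>, the multiplicity of 0 is invisible to it and is supplied by the
  size.\<close>

lemma lin_prod_eq_imp_eq:
  fixes A B :: "'a::field_char_0 multiset"
  assumes "(\<Prod>x\<in>#A. lin x) = (\<Prod>x\<in>#B. lin x)" "size A = size B"
  shows "A = B"
  using assms
proof (induction "size A" arbitrary: A B)
  case (Suc n)
  have poly: "(\<Prod>x\<in>#C. lin x) = fps_of_poly (\<Prod>x\<in>#C. [:1, - x:])" for C :: "'a multiset"
    by (induction C) (simp_all add: lin_def fps_of_poly_mult fps_of_poly_linear)
  have root: "x \<in># D" if x: "x \<noteq> 0" "x \<in># C" and eq: "(\<Prod>x\<in>#C. lin x) = (\<Prod>x\<in>#D. lin x)" for x C and D :: "'a multiset"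
  proof -
    have val: "poly (\<Prod>x\<in>#E. [:1, - x:]) (1 / x) = (\<Prod>y\<in>#E. 1 - y / x)" for E
      by (induction E) (simp_all add: left_diff_distrib)
    have "(\<Prod>y\<in>#C. 1 - y / x) = (\<Prod>y\<in>#D. 1 - y / x)"
      using eq unfolding poly fps_of_poly_eq_iff val[symmetric] by simp
    moreover have "(\<Prod>y\<in>#C. 1 - y / x) = 0"
      using x by (auto simp: prod_mset_zero_iff image_iff intro!: bexI[of _ x])
    ultimately show ?thesis
      using x(1) by (auto simp: prod_mset_zero_iff)
  qed
  show ?case
  proof (cases "\<exists>x. x \<noteq> 0 \<and> (x \<in># A \<or> x \<in># B)")
    case True
    then obtain x where x: "x \<noteq> 0" "x \<in># A" "x \<in># B"
      using root[of _ A B] root[of _ B A] Suc.prems(1) by metis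
    then obtain A' B' where AB: "A = add_mset x A'" "B = add_mset x B'"
      by (meson multi_member_split)
    have "A' = B'"
      by (rule Suc.hyps(1)) (use Suc.hyps(2) Suc.prems AB lin_nonzero[of x] in auto)
    then show ?thesis by (simp add: AB)
  next
    case False
    have "C = replicate_mset (size C) 0" if "\<And>x. x \<in># C \<Longrightarrow> x = 0" for C :: "'a multiset"
      using that by (induction C) auto
    with False show ?thesis using Suc.prems(2) by metis
  qed
qed simp

section \<open>Boxes and contents by columns\<close>

definition column :: "nat multiset \<Rightarrow> nat \<Rightarrow> nat" where
  "column lam y = size (filter_mset (\<lambda>x. y \<le> x) lam)"

lemma in_boxes_iff: "(x, y) \<in> boxes lam \<longleftrightarrow> 1 \<le> y \<and> 1 \<le> x \<and> x \<le> column lam y"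
proof (cases y)
  case (Suc t)
  have "x \<in> {x \<in> {1..size lam}. t < part lam x} \<longleftrightarrow> x \<in> {1..column lam y}"
    unfolding part_superlevel by (simp add: column_def Suc Suc_le_eq)
  then show ?thesis by (auto simp: boxes_def Suc)
qed (simp add: boxes_def)

lemma column_eq_0:
  assumes "sum_mset lam < y" shows "column lam y = 0"
proof -
  have "x < y" if "x \<in># lam" for x
    using multi_member_split[OF that] assms by auto
  then have "filter_mset (\<lambda>x. y \<le> x) lam = {#}" by (auto simp: not_le)
  then show ?thesis by (simp add: column_def)
qed

lemma boxes_columns:
  "boxes lam = (\<lambda>(y, x). (x, y)) ` (SIGMA y:{1..sum_mset lam}. {1..column lam y})"
proof (rule set_eqI)
  fix s :: "nat \<times> nat"
  obtain x y where s: "s = (x, y)" by (cases s)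
  have "y \<le> sum_mset lam" if "1 \<le> x" "x \<le> column lam y"
    using column_eq_0[of lam y] that by (cases "y \<le> sum_mset lam") auto
  then show "s \<in> boxes lam \<longleftrightarrow> s \<in> (\<lambda>(y, x). (x, y)) ` (SIGMA y:{1..sum_mset lam}. {1..column lam y})"
    unfolding s in_boxes_iff by force
qed

lemma finite_boxes [simp]: "finite (boxes lam)"
  unfolding boxes_columns by (intro finite_imageI finite_SigmaI) auto

lemma prod_boxes: "(\<Prod>s\<in>boxes lam. f s) = (\<Prod>y=1..sum_mset lam. \<Prod>x=1..column lam y. f (x, y))"
  unfolding boxes_columns
  by (subst prod.reindex) (auto simp: inj_on_def prod.Sigma comp_def case_prod_unfold)

lemma card_boxes: "card (boxes lam) = sum_mset lam"
proof -
  have "boxes lam = (SIGMA x:{1..size lam}. {1..part lam x})"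
    by (auto simp: boxes_def)
  then have "card (boxes lam) = (\<Sum>x=1..size lam. part lam x)" by simp
  also have "\<dots> = sum_mset lam" using sum_mset_part[of "\<lambda>x. x" lam] by simp
  finally show ?thesis .
qed

definition contents :: "nat multiset \<Rightarrow> qb multiset" where
  "contents lam = image_mset b_content (mset_set (boxes lam))"

lemma size_contents: "size (contents lam) = sum_mset lam"
  by (simp add: contents_def card_boxes)

lemma prod_contents: "(\<Prod>c\<in>#contents lam. f c) = (\<Prod>s\<in>boxes lam. f (b_content s))"
  by (simp add: contents_def prod_unfold_prod_mset image_mset.compositionality comp_def)

text \<open>Both sides are the product of v + i z over -1 \<le> i \<le> h - 1.\<close>

lemma column_product:
  fixes v z :: "'a::comm_ring_1"
  shows "(v + (of_nat h - 1) * z) * (\<Prod>x=1..h. v + (of_nat x - 2) * z) = (v - z) * (\<Prod>x=1..h. v + (of_nat x - 1) * z)"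
proof (induction h)
  case (Suc h)
  have "(v + (of_nat (Suc h) - 1) * z) * (\<Prod>x=1..Suc h. v + (of_nat x - 2) * z) =
     (v + of_nat h * z) * ((v + (of_nat h - 1) * z) * (\<Prod>x=1..h. v + (of_nat x - 2) * z))"
    by (simp add: algebra_simps)
  also have "\<dots> = (v - z) * (\<Prod>x=1..Suc h. v + (of_nat x - 1) * z)"
    unfolding Suc.IH by (simp add: algebra_simps)
  finally show ?case .
qed simp

text \<open>By \<open>wseries_step\<close>, a box of content c multiplies \<open>wseries\<close> by
  \<open>wup c / wdown c\<close>.\<close>

abbreviation wup :: "qb \<Rightarrow> qb fps" where "wup c \<equiv> lin (c + 1) * lin (c - 1 - b)"
abbreviation wdown :: "qb \<Rightarrow> qb fps" where "wdown c \<equiv> lin c * lin (c - b)"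

text \<open>The recursion of \<open>qv\<close> sees the other parts only through min a x, so its
  series Q a obeys an equation with the smaller parts and the column height alone. Solving it for
  increasing a gives \<open>wseries\<close> as a product over columns.\<close>

lemma wseries_contents:
  assumes lam: "is_partition lam"
  shows "wseries lam * (\<Prod>c\<in>#contents lam. wdown c) = (1 + fps_const b * fps_X) * (\<Prod>c\<in>#contents lam. wup c)"
proof -
  define n where "n = sum_mset lam"
  define e where "e = exponents lam"
  have e: "positive_parts (shape n e) = lam" unfolding n_def e_def by (rule shape_exponents[OF lam])
  define Q where "Q a = Abs_fps (\<lambda>k. qv n e k a)" for a
  let ?X = "fps_X :: qb fps"
  let ?h = "\<lambda>a. fps_const (of_nat (column lam a)) :: qb fps"
  define v where "v a = 1 - fps_const (\<alpha> * (of_nat a - 1)) * ?X" for a :: nat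
  \<comment> \<open>\<open>V a\<close> is \<open>lin\<close> of the content formula at (column lam
    a, a), the end of column a. \<open>V' a\<close> is \<open>lin\<close> of that of column a + 1,
    less \<alpha>.\<close>
  define V where "V a = v a + (?h a - 1) * ?X" for a
  define V' where "V' a = v a + (?h (Suc a) - 1) * ?X" for a
  define S where "S a = (\<Sum>x\<in>#filter_mset (\<lambda>x. x < a) lam. Q x)" for a
  define Z where "Z a = of_nat a - ?X * S a" for a
  \<comment> \<open>\<open>\<Omega>\<close> interpolates: at a = 1 the sum S is empty, beyond the
    largest part it is complete and \<open>\<Omega>\<close> is \<open>wseries lam\<close>. Each step
    multiplies it by V' a / V a.\<close>
  define \<Omega> where "\<Omega> a = fps_const \<alpha> * ?X * Z a + V a" for a
  have Q0: "Q 0 = 0"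
  proof (rule fps_ext)
    fix k
    have "qv n e k 0 = 0" by (induction k) simp_all
    then show "fps_nth (Q 0) k = fps_nth 0 k" by (simp add: Q_def)
  qed
  have sum_Q: "(\<Sum>x\<in>#shape n e. Q (f x)) = (\<Sum>x\<in>#lam. Q (f x))" if "f 0 = 0" for f
  proof -
    have "(\<Sum>x\<in>#A. Q (f x)) = (\<Sum>x\<in>#positive_parts A. Q (f x))" for A
      by (induction A) (auto simp: that Q0)
    then show ?thesis using e by metis
  qed
  have Q_min: "(\<Sum>x\<in>#lam. Q (min a x)) = S a + ?h a * Q a" for a
  proof -
    have "(\<Sum>x\<in>#A. Q (min a x)) = (\<Sum>x\<in>#filter_mset (\<lambda>x. x < a) A. Q x)
        + of_nat (size (filter_mset (\<lambda>x. a \<le> x) A)) * Q a" for A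
      by (induction A) (auto simp: min_def not_le algebra_simps)
    then show ?thesis by (simp add: S_def column_def fps_of_nat)
  qed
  have VQ: "V a * Q a = Z a" for a
  proof -
    have "Q a = of_nat a + ?X * (fps_const (\<alpha> * (of_nat a - 1)) * Q a - ((\<Sum>x\<in>#lam. Q (min a x)) - Q a))"
    proof (rule fps_ext)
      fix k
      have nth: "fps_nth (\<Sum>x\<in>#A. F x) k = (\<Sum>x\<in>#A. fps_nth (F x) k)" for A :: "nat multiset" and F :: "nat \<Rightarrow> qb fps" and k
        by (induction A) simp_all
      show "fps_nth (Q a) k = fps_nth (of_nat a + ?X * (fps_const (\<alpha> * (of_nat a - 1)) * Q a
          - ((\<Sum>x\<in>#lam. Q (min a x)) - Q a))) k"
        unfolding sum_Q[of "min a", symmetric, simplified]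
        by (cases k) (simp_all add: nth Q_def sum_shape[symmetric] fps_of_nat[symmetric] fps_sum_nth)
    qed
    then show ?thesis
      unfolding Q_min V_def Z_def v_def by algebra
  qed
  have V_nz: "V a \<noteq> 0" "V' a \<noteq> 0" for a
  proof -
    have "fps_nth (V a) 0 = 1" "fps_nth (V' a) 0 = 1" by (simp_all add: V_def V'_def v_def)
    then show "V a \<noteq> 0" "V' a \<noteq> 0" by auto
  qed
  have v_Suc: "v a = v (Suc a) + fps_const \<alpha> * ?X" for a
    by (simp add: v_def algebra_simps fps_const_add[symmetric] del: fps_const_add)
  have \<Omega>_step: "V a * \<Omega> (Suc a) = V' a * \<Omega> a" for a
  proof -
    have count: "column lam a = column lam (Suc a) + count lam a"
      unfolding column_def by (induction lam) auto
    have "S (Suc a) = S a + of_nat (count lam a) * Q a"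
      unfolding S_def by (induction lam) (auto simp: less_Suc_eq algebra_simps)
    then have "Z (Suc a) = Z a + 1 - ?X * (of_nat (count lam a) * Q a)"
      by (simp add: Z_def algebra_simps)
    moreover have "?h a = ?h (Suc a) + of_nat (count lam a)"
      by (simp add: count fps_of_nat[symmetric])
    ultimately show ?thesis
      using VQ[of a] v_Suc[of a] unfolding \<Omega>_def V_def V'_def by algebra
  qed
  have V'0: "V' 0 = \<Omega> 1"
  proof -
    have "filter_mset (\<lambda>x. x < 1) lam = {#}"
      using lam by (auto simp: is_partition_def intro!: gr0I)
    then have "S 1 = 0" by (simp only: S_def) simp
    then have "Z 1 = 1" by (simp add: Z_def)
    then show ?thesis using v_Suc[of 0] by (simp add: \<Omega>_def V_def V'_def algebra_simps)
  qed
  have V'n: "V' n = v n - ?X" using column_eq_0[of lam "Suc n"] by (simp add: V'_def n_def)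
  have \<Omega>_n: "\<Omega> (Suc n) = wseries lam"
  proof -
    have "x \<le> n" if "x \<in># lam" for x
      using multi_member_split[OF that] by (auto simp: n_def)
    then have all: "filter_mset (\<lambda>x. x < Suc n) lam = lam"
      by (auto simp: filter_mset_eq_conv less_Suc_eq_le)
    have "tseries lam = S (Suc n)"
    proof (rule fps_ext)
      fix k
      have nth: "fps_nth (\<Sum>x\<in>#A. Q x) k = (\<Sum>x\<in>#A. qv n e k x)" for A
        by (induction A) (simp_all add: Q_def)
      show "fps_nth (tseries lam) k = fps_nth (S (Suc n)) k"
        unfolding S_def all using sum_Q[of "\<lambda>x. x"]
        by (simp add: tseries_def tcoeff_def tval_def sum_shape nth[symmetric] n_def[symmetric] e_def[symmetric])
    qed
    moreover have "V (Suc n) = 1 - fps_const (\<alpha> * of_nat n) * ?X - ?X"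
      using column_eq_0[of lam "Suc n"] by (simp add: V_def v_def n_def)
    ultimately show ?thesis
      unfolding \<Omega>_def Z_def wseries_def
      by (simp add: fps_of_nat[symmetric] algebra_simps power2_eq_square fps_const_add[symmetric] fps_const_mult[symmetric]
          del: fps_const_add fps_const_mult)
  qed
  define A B where "A y = (\<Prod>x=1..column lam y. wdown (b_content (x, y)))"
    and "B y = (\<Prod>x=1..column lam y. wup (b_content (x, y)))" for y
  \<comment> \<open>Inside a column the box factors telescope by \<open>column_product\<close>,
    leaving its ends; the factors v y - X then cancel between neighbouring columns.\<close>
  have col: "V (Suc y) * (v y - ?X) * B (Suc y) = (v (Suc y) - ?X) * V' y * A (Suc y)" for y
  proof -
    let ?H = "column lam (Suc y)" and ?v = "v (Suc y)"
    have c: "b_content (x, Suc y) = \<alpha> * (of_nat (Suc y) - 1) - (of_nat x - 1)" for x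
      by (simp add: b_content_def algebra_simps)
    have fac: "lin (\<alpha> * (of_nat (Suc y) - 1) - t) = ?v + fps_const t * ?X" for t
      by (simp add: lin_def v_def left_diff_distrib fps_const_sub[symmetric] del: fps_const_sub)
    have fac': "lin (b_content (x, Suc y)) = ?v + (of_nat x - 1) * ?X"
      "lin (b_content (x, Suc y) - b) = (?v + fps_const \<alpha> * ?X) + (of_nat x - 2) * ?X"
      "lin (b_content (x, Suc y) + 1) = ?v + (of_nat x - 2) * ?X"
      "lin (b_content (x, Suc y) - 1 - b) = (?v + fps_const \<alpha> * ?X) + (of_nat x - 1) * ?X" for x
    proof -
      show "lin (b_content (x, Suc y)) = ?v + (of_nat x - 1) * ?X"
        unfolding c fac by (simp add: fps_of_nat[symmetric] fps_const_sub[symmetric] del: fps_const_sub)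
      have "b_content (x, Suc y) - b = \<alpha> * (of_nat (Suc y) - 1) - (of_nat x - 2 + \<alpha>)" unfolding c by simp
      then show "lin (b_content (x, Suc y) - b) = (?v + fps_const \<alpha> * ?X) + (of_nat x - 2) * ?X"
        by (simp only: fac) (simp add: fps_of_nat[symmetric] fps_const_sub[symmetric] fps_const_add[symmetric] algebra_simps del: fps_const_sub fps_const_add)
      have "b_content (x, Suc y) + 1 = \<alpha> * (of_nat (Suc y) - 1) - (of_nat x - 2)" unfolding c by simp
      then show "lin (b_content (x, Suc y) + 1) = ?v + (of_nat x - 2) * ?X"
        by (simp only: fac) (simp add: fps_of_nat[symmetric] fps_const_sub[symmetric] del: fps_const_sub)
      have "b_content (x, Suc y) - 1 - b = \<alpha> * (of_nat (Suc y) - 1) - (of_nat x - 1 + \<alpha>)" unfolding c by simp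
      then show "lin (b_content (x, Suc y) - 1 - b) = (?v + fps_const \<alpha> * ?X) + (of_nat x - 1) * ?X"
        by (simp only: fac) (simp add: fps_of_nat[symmetric] fps_const_sub[symmetric] fps_const_add[symmetric] algebra_simps del: fps_const_sub fps_const_add)
    qed
    have "V (Suc y) = ?v + (of_nat ?H - 1) * ?X" by (simp add: V_def fps_of_nat)
    moreover have "V' y = (?v + fps_const \<alpha> * ?X) + (of_nat ?H - 1) * ?X"
      using v_Suc[of y] by (simp add: V'_def fps_of_nat)
    moreover have "v y = ?v + fps_const \<alpha> * ?X" by (rule v_Suc)
    ultimately show ?thesis
      unfolding A_def B_def fac' prod.distrib
      using column_product[of ?v ?H ?X] column_product[of "?v + fps_const \<alpha> * ?X" ?H ?X] by algebra
  qed
  have "\<Omega> (Suc y) * (v y - ?X) * (\<Prod>i=1..y. A i) = V' y * (v 0 - ?X) * (\<Prod>i=1..y. B i)" for y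
  proof (induction y)
    case 0
    show ?case by (simp add: V'0)
  next
    case (Suc y)
    have "(V' y * V (Suc y)) * (\<Omega> (Suc (Suc y)) * (v (Suc y) - ?X) * (\<Prod>i=1..Suc y. A i))
      = (V' y * V (Suc y)) * (V' (Suc y) * (v 0 - ?X) * (\<Prod>i=1..Suc y. B i))"
    proof -
      have "(\<Prod>i=1..Suc y. A i) = (\<Prod>i=1..y. A i) * A (Suc y)" "(\<Prod>i=1..Suc y. B i) = (\<Prod>i=1..y. B i) * B (Suc y)"
        by simp_all
      then show ?thesis using Suc.IH \<Omega>_step[of "Suc y"] col[of y] by algebra
    qed
    then show ?case using V_nz by simp
  qed
  from this[of n] have "(v n - ?X) * (wseries lam * (\<Prod>i=1..n. A i)) = (v n - ?X) * ((v 0 - ?X) * (\<Prod>i=1..n. B i))"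
    unfolding \<Omega>_n V'n by algebra
  moreover have "v n - ?X \<noteq> 0" using V_nz(2)[of n] V'n by simp
  ultimately have "wseries lam * (\<Prod>i=1..n. A i) = (v 0 - ?X) * (\<Prod>i=1..n. B i)" by simp
  moreover have "v 0 - ?X = 1 + fps_const b * ?X"
    by (simp add: v_def fps_const_add[symmetric] fps_const_neg[symmetric] algebra_simps del: fps_const_add fps_const_neg)
  ultimately show ?thesis
    unfolding prod_contents prod_boxes A_def B_def n_def by simp
qed

text \<open>Evaluating the relation one step above a point of the support that is maximal for the
  strict order generated by the shifts by 1 and \<open>1 + b\<close> isolates a single term.\<close>

lemma shift_relation_zero:
  fixes m :: "qb \<Rightarrow> int"
  assumes fin: "finite {x. m x \<noteq> 0}"
    and rel: "\<And>x. m x + m (x + b) = m (x - 1) + m (x + 1 + b)"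
  shows "m x = 0"
proof (rule ccontr)
  assume "m x \<noteq> 0"
  let ?S = "{x. m x \<noteq> 0}"
  define R where "R x y \<longleftrightarrow> (\<exists>k l. y = x + of_nat (Suc k) + of_nat l * b)" for x y :: qb
  have trans: "transp_on ?S R"
  proof (rule transp_onI)
    fix x y z assume "R x y" "R y z"
    then obtain k l k' l' where *: "y = x + of_nat (Suc k) + of_nat l * b" "z = y + of_nat (Suc k') + of_nat l' * b"
      unfolding R_def by blast
    then have "z = x + of_nat (Suc (Suc (k + k'))) + of_nat (l + l') * b" by (simp add: algebra_simps)
    then show "R x z" unfolding R_def by blast
  qed
  have irrefl: "\<not> R x x" for x
  proof
    assume "R x x"
    then obtain k l where "x = x + of_nat (Suc k) + of_nat l * b" unfolding R_def by blast
    then have "of_nat (Suc k) + of_nat l * b = of_nat 0 + of_nat 0 * b" by simp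
    from nat_b_independent[OF this] show False by simp
  qed
  then have "asymp_on ?S R"
    using trans unfolding asymp_on_def transp_on_def by blast
  then obtain c where c: "c \<in> ?S" "\<forall>x\<in>?S. x \<noteq> c \<longrightarrow> \<not> R c x"
    using Finite_Set.bex_max_element[OF fin _ trans] \<open>m x \<noteq> 0\<close> by blast
  have zero: "m y = 0" if "R c y" for y
    by (rule ccontr) (use c(2) that irrefl[of c] in auto)
  have "R c (c + 1)" unfolding R_def by (intro exI[of _ 0]) simp
  moreover have "R c (c + 1 + b)" unfolding R_def by (intro exI[of _ 0] exI[of _ 1]) simp
  moreover have "R c (c + 1 + 1 + b)" unfolding R_def by (intro exI[of _ 1]) simp
  ultimately show False
    using rel[of "c + 1"] zero c(1) by simp
qed

lemma count_image_translate: "count (image_mset (\<lambda>x. x + d) A) y = count A (y - d)" for d :: "'a::ab_group_add"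
  by (induction A) (auto simp: algebra_simps)

text \<open>The product formulas for \<lambda> and \<nu> and the one-step factor give an identity of
  products of linear factors, hence of multisets shifted by 0, -b, 1 and -1 - b. It is linear in the
  difference m of the multiplicities, and m has finite support.\<close>

lemma contents_lower:
  assumes "is_partition lam" "is_partition \<nu>" "sum_mset lam = Suc (sum_mset \<nu>)"
    and "\<And>k. tcoeff lam k = tcoeff \<nu> k + c ^ k + (\<Sum>i<k. beta \<nu> c i * c ^ (k - 1 - i))"
  shows "contents lam = add_mset c (contents \<nu>)"
proof -
  let ?A = "contents lam" and ?B = "add_mset c (contents \<nu>)"
  let ?u = "1 + fps_const b * fps_X :: qb fps"
  have u: "?u \<noteq> 0"
  proof
    assume "?u = 0"
    from arg_cong[OF this, of "\<lambda>f. fps_nth f 0"] show False by simp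
  qed
  have nz: "(\<Prod>c\<in>#C. wup c) \<noteq> 0" "(\<Prod>c\<in>#C. wdown c) \<noteq> 0" for C
    by (induction C) (simp_all add: lin_nonzero)
  have "?u * ((\<Prod>c\<in>#?B. wdown c) * (\<Prod>c\<in>#?A. wup c)) = ?u * ((\<Prod>c\<in>#?A. wdown c) * (\<Prod>c\<in>#?B. wup c))"
    using wseries_contents[OF assms(1)] wseries_contents[OF assms(2)] wseries_step[OF assms(4)]
    unfolding image_mset_add_mset prod_mset.add_mset by algebra
  then have eq: "(\<Prod>c\<in>#?B. wdown c) * (\<Prod>c\<in>#?A. wup c) = (\<Prod>c\<in>#?A. wdown c) * (\<Prod>c\<in>#?B. wup c)"
    using u by simp
  let ?L = "\<lambda>A B. A + image_mset (\<lambda>x. x + - b) A + image_mset (\<lambda>x. x + 1) B + image_mset (\<lambda>x. x + (- 1 - b)) B"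
  have L: "(\<Prod>x\<in>#?L A B. lin x) = (\<Prod>c\<in>#A. wdown c) * (\<Prod>c\<in>#B. wup c)" for A B
    by (simp add: image_mset.compositionality comp_def prod_mset.distrib diff_diff_eq2 add_diff_eq algebra_simps)
  have "?L ?B ?A = ?L ?A ?B"
    by (rule lin_prod_eq_imp_eq) (use eq assms(3) in \<open>simp_all only: L size_union size_image_mset size_add_mset size_contents\<close>)
  then have cnt: "count (?L ?B ?A) x = count (?L ?A ?B) x" for x by simp
  define m where "m x = int (count ?B x) - int (count ?A x)" for x
  have "m x = 0" for x
  proof (rule shift_relation_zero)
    show "finite {x. m x \<noteq> 0}"
      by (rule finite_subset[of _ "set_mset ?A \<union> set_mset ?B"]) (auto simp: m_def not_in_iff)
    show "m x + m (x + b) = m (x - 1) + m (x + 1 + b)" for x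
      using cnt[of x] unfolding count_union count_image_translate m_def
      by (simp add: algebra_simps)
  qed
  then have "count ?A x = count ?B x" for x by (simp add: m_def)
  then show ?thesis by (rule multiset_eqI)
qed

section \<open>Normalisation\<close>

text \<open>On degree \<open>n\<close>, \<open>top_form\<close> is the coefficient of \<open>p\<^sub>1\<^sup>n\<close>, and \<open>power_form N\<close> the
  specialisation \<open>p\<^sub>i = N\<close>.\<close>

definition top_form :: fnl where
  "top_form \<mu> = (if \<forall>x\<in>#\<mu>. x = 1 then 1 else 0)"

definition power_form :: "nat \<Rightarrow> fnl" where
  "power_form N \<mu> = of_nat N ^ size \<mu>"

lemma Tk_0: "is_partition \<mu> \<Longrightarrow> Tk 0 \<phi> \<mu> = of_nat (sum_mset \<mu>) * \<phi> \<mu>"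
proof -
  have "Tk 0 \<phi> \<mu> = psum (\<lambda>j \<nu>. \<phi> \<mu>) \<mu>"
    unfolding Tk_def Nabla_def funpow_0 by (rule psum_cong_pos) (simp add: Theta_def)
  then show ?thesis by (simp add: psum_const)
qed

text \<open>A power of p_1 can come from p_m f only if m = 1.\<close>

lemma Theta_top_form: "Theta top_form = Eps top_form"
  by (intro ext) (simp add: Theta_def Eps_def top_form_def)

lemma Rk_top_form: "Rk k top_form = Tk k top_form"
  by (simp add: Rk_def Tk_def Theta_top_form)

text \<open>For m \<ge> 1 the value N of p_{m+1} is also that of p_m, the coefficient of y_1 in L
  y_{m+1}; at m = 0 the value is produced by N \<epsilon>.\<close>

lemma Theta_power_form:
  "Theta (power_form N) = (\<lambda>m \<mu>. of_nat N * Eps (power_form N) m \<mu> + Lax (Eps (power_form N)) m \<mu>)"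
  unfolding Shift_Theta[symmetric]
  by (intro ext) (simp add: Theta_def Eps_def Shift_def power_form_def)

lemma Tk_power_form: "Tk 0 (power_form N) = (\<lambda>\<mu>. of_nat N * Rk 0 (power_form N) \<mu> + Rk 1 (power_form N) \<mu>)"
proof (rule ext)
  fix \<mu>
  have "Tk 0 (power_form N) \<mu> = Nabla (Theta (power_form N)) \<mu>" by (simp add: Tk_def)
  then show "Tk 0 (power_form N) \<mu> = of_nat N * Rk 0 (power_form N) \<mu> + Rk 1 (power_form N) \<mu>"
    unfolding Theta_power_form Nabla_add Nabla_cmult by (simp add: Rk_def)
qed

section \<open>Removing the first column\<close>

definition strip_column :: "nat multiset \<Rightarrow> nat multiset" where
  "strip_column lam = positive_parts (image_mset (\<lambda>x. x - 1) lam)"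

lemma less_part_iff: "1 \<le> x \<Longrightarrow> t < part A x \<longleftrightarrow> x \<le> size (filter_mset (\<lambda>x. t < x) A)"
proof (cases "x \<le> size A")
  case True
  assume "1 \<le> x"
  have "x \<in> {x \<in> {1..size A}. t < part A x} \<longleftrightarrow> x \<in> {1..size (filter_mset (\<lambda>x. t < x) A)}"
    unfolding part_superlevel ..
  with True \<open>1 \<le> x\<close> show ?thesis by simp
next
  case False
  then have "\<not> x \<le> size (filter_mset (\<lambda>x. t < x) A)"
    using size_filter_mset_lesseq[of "\<lambda>x. t < x" A] by linarith
  with False show ?thesis by (simp add: part_def)
qed

lemma part_strip_column:
  assumes "1 \<le> x" shows "part (strip_column lam) x = part lam x - 1"
proof -
  have "size (filter_mset (\<lambda>x. t < x) (strip_column lam)) = size (filter_mset (\<lambda>x. Suc t < x) lam)" for t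
    unfolding strip_column_def by (induction lam) auto
  then have "t < part (strip_column lam) x \<longleftrightarrow> t < part lam x - 1" for t
    using less_part_iff[OF assms, of t "strip_column lam"] less_part_iff[OF assms, of "Suc t" lam] by auto
  then show ?thesis by (metis nat_neq_iff)
qed

lemma size_strip_column: "size (strip_column lam) \<le> size lam"
  unfolding strip_column_def by (induction lam) auto

lemma sum_strip_column: "is_partition lam \<Longrightarrow> sum_mset lam = sum_mset (strip_column lam) + size lam"
  unfolding strip_column_def by (induction lam) auto

lemma weight_strip_column:
  "is_partition lam \<Longrightarrow> weight lam = weight (strip_column lam) + 2 * sum_mset (strip_column lam)"
proof (induction lam)
  case (add x A)
  obtain t where t: "x = Suc t" using add.prems by (cases x) auto
  have "Suc t * t = t * (t - 1) + 2 * t" by (cases t) simp_all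
  with add show ?case unfolding t by (simp add: strip_column_def weight_def)
qed (simp add: strip_column_def weight_def)

lemma prod_boxes_rows:
  assumes "size lam \<le> M"
  shows "(\<Prod>s\<in>boxes lam. f s) = (\<Prod>x=1..M. \<Prod>y=1..part lam x. f (x, y))"
proof -
  have "boxes lam = (SIGMA x:{1..M}. {1..part lam x})"
    using assms by (auto simp: boxes_def part_def split: if_splits)
  then show ?thesis by (simp add: prod.Sigma)
qed

lemma conj_part_eq_column: "1 \<le> y \<Longrightarrow> conj_part lam y = column lam y"
proof -
  assume y: "1 \<le> y"
  have "{x. 1 \<le> x \<and> x \<le> size lam \<and> y \<le> part lam x} = {x \<in> {1..size lam}. y - 1 < part lam x}"
    using y by auto
  also have "\<dots> = {1..size (filter_mset (\<lambda>x. y - 1 < x) lam)}" by (rule part_superlevel)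
  also have "(\<lambda>x. y - 1 < x) = (\<lambda>x. y \<le> x)" using y by (auto simp: fun_eq_iff)
  finally show ?thesis by (simp add: conj_part_def column_def)
qed

lemma column_strip_column: "1 \<le> y \<Longrightarrow> column (strip_column lam) y = column lam (Suc y)"
  unfolding column_def strip_column_def by (induction lam) auto

lemma column_1: "is_partition lam \<Longrightarrow> column lam 1 = size lam"
  unfolding column_def by (induction lam) auto

lemma prod_atLeast1_shift:
  fixes p :: nat
  assumes "1 \<le> p" shows "(\<Prod>y=1..p. g y) = g 1 * (\<Prod>y=1..p - 1. g (Suc y))"
proof -
  have "(\<Prod>y=1..Suc q. g y) = g 1 * (\<Prod>y=1..q. g (Suc y))" for q
    by (induction q) (simp_all add: mult.assoc)
  from this[of "p - 1"] assms show ?thesis by simp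
qed

lemma part_pos: "is_partition lam \<Longrightarrow> 1 \<le> x \<Longrightarrow> x \<le> size lam \<Longrightarrow> 1 \<le> part lam x"
proof -
  assume lam: "is_partition lam" and x: "1 \<le> x" "x \<le> size lam"
  have "filter_mset (\<lambda>x. 0 < x) lam = lam" using lam by (induction lam) auto
  then show ?thesis using less_part_iff[of x 0 lam] x by simp
qed

text \<open>Box (x, y) of the stripped partition has the arm and leg of box (x, y + 1) of \<lambda>,
  so the first box of each row is left over.\<close>

lemma hook_b_strip_column:
  assumes lam: "is_partition lam"
  shows "hook_b lam = hook_b (strip_column lam) *
    (\<Prod>x=1..size lam. \<alpha> * of_nat (part lam x - 1) + of_nat (size lam - x) + 1)"
proof -
  let ?f = "\<lambda>lam s. (1 + b) * of_nat (arm lam s) + of_nat (leg lam s) + 1"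
  let ?lam = "strip_column lam"
  have "hook_b lam = (\<Prod>x=1..size lam. ?f lam (x, 1) * (\<Prod>y=1..part ?lam x. ?f ?lam (x, y)))"
    unfolding hook_b_def prod_boxes_rows[OF order_refl]
  proof (rule prod.cong[OF refl])
    fix x assume x: "x \<in> {1..size lam}"
    have "?f lam (x, Suc y) = ?f ?lam (x, y)" if "y \<in> {1..part lam x - 1}" for y
      using that x by (simp add: arm_def leg_def conj_part_eq_column column_strip_column part_strip_column)
    then have "(\<Prod>y=1..part lam x - 1. ?f lam (x, Suc y)) = (\<Prod>y=1..part ?lam x. ?f ?lam (x, y))"
      using x by (intro prod.cong) (simp_all add: part_strip_column)
    moreover have "(\<Prod>y=1..part lam x. ?f lam (x, y)) = ?f lam (x, 1) * (\<Prod>y=1..part lam x - 1. ?f lam (x, Suc y))"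
      by (rule prod_atLeast1_shift) (use part_pos[OF lam] x in auto)
    ultimately show "(\<Prod>y=1..part lam x. ?f lam (x, y)) = ?f lam (x, 1) * (\<Prod>y=1..part ?lam x. ?f ?lam (x, y))"
      by (simp only:)
  qed
  also have "\<dots> = (\<Prod>x=1..size lam. ?f lam (x, 1)) * hook_b ?lam"
    unfolding prod.distrib hook_b_def prod_boxes_rows[OF size_strip_column] ..
  also have "(\<Prod>x=1..size lam. ?f lam (x, 1)) = (\<Prod>x=1..size lam. \<alpha> * of_nat (part lam x - 1) + of_nat (size lam - x) + 1)"
    using column_1[OF lam] by (simp add: arm_def leg_def conj_part_eq_column)
  finally show ?thesis by (simp only: mult.commute)
qed

text \<open>Contents depend on the coordinates only, so here the last box of each row is left over.
  Its content plus the length of \<lambda> is the hook of the first box of that row: the extra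
  product is the one in \<open>hook_b_strip_column\<close>.\<close>

lemma content_prod_strip_column:
  assumes lam: "is_partition lam"
  shows "(\<Prod>c\<in>#contents lam. of_nat (size lam) + c) = (\<Prod>c\<in>#contents (strip_column lam). of_nat (size lam) + c) *
    (\<Prod>x=1..size lam. \<alpha> * of_nat (part lam x - 1) + of_nat (size lam - x) + 1)"
proof -
  let ?f = "\<lambda>s. of_nat (size lam) + b_content s"
  let ?lam = "strip_column lam"
  have "(\<Prod>c\<in>#contents lam. of_nat (size lam) + c) = (\<Prod>x=1..size lam. (\<Prod>y=1..part ?lam x. ?f (x, y)) * ?f (x, part lam x))"
    unfolding prod_contents prod_boxes_rows[OF order_refl]
  proof (rule prod.cong[OF refl])
    fix x assume x: "x \<in> {1..size lam}"
    then obtain t where "part lam x = Suc t" using part_pos[OF lam, of x] by (cases "part lam x") auto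
    with x show "(\<Prod>y=1..part lam x. ?f (x, y)) = (\<Prod>y=1..part ?lam x. ?f (x, y)) * ?f (x, part lam x)"
      by (simp add: part_strip_column)
  qed
  also have "\<dots> = (\<Prod>c\<in>#contents ?lam. of_nat (size lam) + c) * (\<Prod>x=1..size lam. ?f (x, part lam x))"
    unfolding prod.distrib prod_contents prod_boxes_rows[OF size_strip_column] ..
  also have "(\<Prod>x=1..size lam. ?f (x, part lam x)) = (\<Prod>x=1..size lam. \<alpha> * of_nat (part lam x - 1) + of_nat (size lam - x) + 1)"
  proof (rule prod.cong[OF refl])
    fix x assume x: "x \<in> {1..size lam}"
    then have "1 \<le> part lam x" "x \<le> size lam" using part_pos[OF lam, of x] by auto
    then show "?f (x, part lam x) = \<alpha> * of_nat (part lam x - 1) + of_nat (size lam - x) + 1"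
      by (simp add: b_content_def of_nat_diff algebra_simps)
  qed
  finally show ?thesis .
qed

lemma content_prod_nonzero:
  "(\<Prod>c\<in>#contents lam. of_nat (size lam) + c) \<noteq> (0 :: qb)"
proof -
  have "of_nat (size lam) + b_content s \<noteq> 0" if s: "s \<in> boxes lam" for s
  proof
    obtain x y where xy: "s = (x, y)" by (cases s)
    have le: "1 \<le> x" "x \<le> size lam" "1 \<le> y" using s by (auto simp: xy boxes_def)
    assume "of_nat (size lam) + b_content s = 0"
    moreover have "of_nat (size lam) + b_content s = of_nat (size lam - x + y) + of_nat (y - 1) * b"
      using le by (simp add: xy b_content_def of_nat_diff algebra_simps)
    ultimately have "of_nat (size lam - x + y) + of_nat (y - 1) * b = of_nat 0 + of_nat 0 * b" by simp
    from nat_b_independent[OF this] le show False by simp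
  qed
  then show ?thesis unfolding prod_contents by (simp add: prod_zero_iff)
qed

section \<open>Specialisation at x_i = 1 and multiplication by all variables\<close>

definition exponent_set :: "nat \<Rightarrow> nat \<Rightarrow> (nat \<Rightarrow> nat) set" where
  "exponent_set N n = {e. (\<forall>i\<ge>N. e i = 0) \<and> sum e {..<N} = n}"

lemma finite_exponent_set: "finite (exponent_set N n)"
proof (rule finite_subset)
  show "exponent_set N n \<subseteq> (\<lambda>g i. if i < N then g i else 0) ` (PiE {..<N} (\<lambda>_. {..n}))"
  proof
    fix e assume e: "e \<in> exponent_set N n"
    have "e i \<le> n" if "i < N" for i
      using e that member_le_sum[of i "{..<N}" e] by (auto simp: exponent_set_def)
    then have "restrict e {..<N} \<in> PiE {..<N} (\<lambda>_. {..n})" by auto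
    moreover have "e = (\<lambda>i. if i < N then restrict e {..<N} i else 0)"
      using e by (auto simp: exponent_set_def fun_eq_iff)
    ultimately show "e \<in> (\<lambda>g i. if i < N then g i else 0) ` (PiE {..<N} (\<lambda>_. {..n}))" by blast
  qed
qed (intro finite_imageI finite_PiE, auto)

text \<open>The sum of all coefficients is the value at x_i = 1, where each power sum equals
  N.\<close>

lemma sum_mono_coeff: "(\<Sum>e\<in>exponent_set N (sum_mset \<mu>). mono_coeff N e \<mu>) = power_form N \<mu>"
proof (induction \<mu>)
  case empty
  have "exponent_set N 0 = {\<lambda>_. 0}"
    by (auto simp: exponent_set_def fun_eq_iff not_less[symmetric])
  then show ?case by (simp add: mono_coeff_empty power_form_def)
next
  case (add r \<mu>)
  let ?X = "exponent_set N (sum_mset (add_mset r \<mu>))" and ?Y = "exponent_set N (sum_mset \<mu>)"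
  have "(\<Sum>e\<in>?X. if r \<le> e i then mono_coeff N (e(i := e i - r)) \<mu> else 0) = (\<Sum>e\<in>?Y. mono_coeff N e \<mu>)"
    if i: "i < N" for i
  proof -
    have "(\<Sum>e\<in>?X. if r \<le> e i then mono_coeff N (e(i := e i - r)) \<mu> else 0)
       = (\<Sum>e\<in>{e \<in> ?X. r \<le> e i}. mono_coeff N (e(i := e i - r)) \<mu>)"
      by (rule sum.inter_filter[symmetric]) (rule finite_exponent_set)
    also have "\<dots> = (\<Sum>e\<in>?Y. mono_coeff N e \<mu>)"
    proof (rule sum.reindex_bij_witness[of _ "\<lambda>e. e(i := e i + r)" "\<lambda>e. e(i := e i - r)"])
      fix e assume e: "e \<in> {e \<in> ?X. r \<le> e i}"
      show "e(i := e i - r, i := (e(i := e i - r)) i + r) = e" using e by auto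
      show "e(i := e i - r) \<in> ?Y"
        using e i sum_fun_upd_diff[of i N r e] by (auto simp: exponent_set_def)
    next
      fix e assume e: "e \<in> ?Y"
      show "e(i := e i + r, i := (e(i := e i + r)) i - r) = e" by auto
      have "e(i := e i + r, i := (e(i := e i + r)) i - r) = e" by auto
      then show "e(i := e i + r) \<in> {e \<in> ?X. r \<le> e i}"
        using e i sum_fun_upd_diff[of i N r "e(i := e i + r)"] by (auto simp: exponent_set_def)
    qed simp
    finally show ?thesis .
  qed
  then have "(\<Sum>i<N. \<Sum>e\<in>?X. if r \<le> e i then mono_coeff N (e(i := e i - r)) \<mu> else 0) = (\<Sum>i<N. power_form N \<mu>)"
    using add.IH by (intro sum.cong) auto
  then show ?case
    unfolding mono_coeff_add_mset by (subst sum.swap) (simp add: power_form_def)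
qed

text \<open>If u are the coefficients of a symmetric f, then v are those of x_1 ... x_N f. The
  diagonal d(d-1) becomes (d+1)d, which yields 2 \<alpha> times the degree, and each ordered pair of
  variables contributes -1.\<close>

lemma raising_shift:
  fixes u :: "(nat \<Rightarrow> nat) \<Rightarrow> qb" and N :: nat
  assumes inv: "\<And>e e'. shape N e = shape N e' \<Longrightarrow> u e = u e'"
  defines "v \<equiv> \<lambda>e. if \<forall>i<N. 1 \<le> e i then u (\<lambda>i. e i - 1) else 0"
  assumes pos: "\<forall>i<N. 1 \<le> e i"
  shows "raising N v e = raising N u (\<lambda>i. e i - 1)
    + (2 * \<alpha> * of_nat (\<Sum>i<N. e i - 1) - of_nat (N * (N - 1))) * u (\<lambda>i. e i - 1)"
proof -
  define d where "d = (\<lambda>i. e i - 1)"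
  have cross: "exchange (\<lambda>a e. of_nat a * v e) e i j = exchange (\<lambda>a d. of_nat a * u d) d i j - u d"
    if ij: "i < N" "j < N" "i \<noteq> j" for i j
  proof -
    have ed: "e i = Suc (d i)" "e j = Suc (d j)" using pos ij by (auto simp: d_def)
    have tr: "v (transfer e i j (Suc a)) = u (transfer d i j a)" if "a \<le> d i + d j" for a
    proof -
      have "\<forall>l<N. 1 \<le> transfer e i j (Suc a) l"
        using pos that ed by (auto simp: transfer_def)
      moreover have "(\<lambda>l. transfer e i j (Suc a) l - 1) = transfer d i j a"
        using ed by (auto simp: transfer_def fun_eq_iff d_def)
      ultimately show ?thesis by (simp add: v_def)
    qed
    \<comment> \<open>This transfer empties x_j; without it the upper range of a for e is that for d
      shifted by one.\<close>
    have tr0: "v (transfer e i j (e i + e j)) = 0"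
    proof -
      have "transfer e i j (e i + e j) j = 0" by (simp add: transfer_def)
      then have "\<not> (\<forall>l<N. 1 \<le> transfer e i j (e i + e j) l)" using ij(2) by (metis not_one_le_zero)
      then show ?thesis unfolding v_def by (rule if_not_P)
    qed
    have refl: "u (transfer d i j (d i + d j - a)) = u (transfer d i j a)" if "a \<le> d i + d j" for a
    proof -
      have "d i + d j - (d i + d j - a) = a" using that by simp
      then show ?thesis unfolding transfer_def by (simp only:) (rule inv, rule shape_swap_upd[OF ij])
    qed
    have up: "(\<Sum>a\<in>{max (e i) (e j)<..e i + e j}. of_nat a * v (transfer e i j a))
      = (\<Sum>a\<in>{max (d i) (d j)<..d i + d j}. (of_nat a + 1) * u (transfer d i j a))"
    proof -
      have "(\<Sum>a\<in>{max (e i) (e j)<..e i + e j}. of_nat a * v (transfer e i j a))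
        = (\<Sum>a\<in>{max (e i) (e j)<..Suc (d i + d j)}. of_nat a * v (transfer e i j a))"
      proof (rule sum.mono_neutral_right)
        show "\<forall>a\<in>{max (e i) (e j)<..e i + e j} - {max (e i) (e j)<..Suc (d i + d j)}. of_nat a * v (transfer e i j a) = 0"
        proof
          fix a assume "a \<in> {max (e i) (e j)<..e i + e j} - {max (e i) (e j)<..Suc (d i + d j)}"
          then have "a = e i + e j" using ed by auto
          with tr0 show "of_nat a * v (transfer e i j a) = 0" by simp
        qed
      qed (use ed in auto)
      also have "\<dots> = (\<Sum>a\<in>{max (d i) (d j)<..d i + d j}. of_nat (Suc a) * v (transfer e i j (Suc a)))"
        by (rule sum.reindex_bij_witness[of _ Suc "\<lambda>a. a - 1"]) (use ed in auto)
      also have "\<dots> = (\<Sum>a\<in>{max (d i) (d j)<..d i + d j}. (of_nat a + 1) * u (transfer d i j a))"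
        by (rule sum.cong) (auto simp: tr)
      finally show ?thesis .
    qed
    have down: "(\<Sum>a\<le>min (e i) (e j). of_nat a * v (transfer e i j a))
      = (\<Sum>a\<le>min (d i) (d j). (of_nat a + 1) * u (transfer d i j a))"
    proof -
      have "min (e i) (e j) = Suc (min (d i) (d j))" using ed by simp
      then have "(\<Sum>a\<le>min (e i) (e j). of_nat a * v (transfer e i j a))
        = (\<Sum>a\<le>min (d i) (d j). of_nat (Suc a) * v (transfer e i j (Suc a)))"
        by (simp only: sum.atMost_Suc_shift) simp
      also have "\<dots> = (\<Sum>a\<le>min (d i) (d j). (of_nat a + 1) * u (transfer d i j a))"
        by (rule sum.cong) (auto simp: tr)
      finally show ?thesis .
    qed
    \<comment> \<open>The shift turns the weight a into a + 1. The extra sums cancel under the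
      exchange of the two variables, except for the term a = min, which is u d.\<close>
    have "(\<Sum>a\<in>{max (d i) (d j)<..d i + d j}. u (transfer d i j a)) = (\<Sum>a<min (d i) (d j). u (transfer d i j (d i + d j - a)))"
      by (rule sum.reindex_bij_witness[of _ "\<lambda>a. d i + d j - a" "\<lambda>a. d i + d j - a"]) auto
    also have "\<dots> = (\<Sum>a<min (d i) (d j). u (transfer d i j a))"
      by (rule sum.cong) (auto simp: refl)
    finally have ones: "(\<Sum>a\<le>min (d i) (d j). u (transfer d i j a))
      = (\<Sum>a\<in>{max (d i) (d j)<..d i + d j}. u (transfer d i j a)) + u d"
      unfolding lessThan_Suc_atMost[symmetric] sum.lessThan_Suc using inv[OF shape_transfer_min[OF ij, of d]] by simp
    show ?thesis
      unfolding exchange_def up down using ones by (simp add: distrib_right sum.distrib)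
  qed
  have "raising N v e = (\<Sum>i<N. (\<alpha> * (of_nat (d i) - 1) * (of_nat (d i) * u d) + 2 * \<alpha> * of_nat (d i) * u d)
    + (\<Sum>j\<in>{..<N}-{i}. exchange (\<lambda>a d. of_nat a * u d) d i j - u d))"
    unfolding raising_def
  proof (intro sum.cong refl arg_cong2[of _ _ _ _ "(+)"])
    fix i assume "i \<in> {..<N}"
    then have "e i = Suc (d i)" using pos by (auto simp: d_def)
    moreover have "v e = u d" using pos by (simp add: v_def d_def)
    ultimately show "\<alpha> * (of_nat (e i) - 1) * (of_nat (e i) * v e)
      = \<alpha> * (of_nat (d i) - 1) * (of_nat (d i) * u d) + 2 * \<alpha> * of_nat (d i) * u d"
      by (simp add: algebra_simps)
  qed (use cross in auto)
  also have "\<dots> = raising N u d + (\<Sum>i<N. 2 * \<alpha> * of_nat (d i) * u d) - (\<Sum>i<N. \<Sum>j\<in>{..<N}-{i}. u d)"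
    unfolding raising_def sum.distrib sum_subtractf by simp
  also have "(\<Sum>i<N. 2 * \<alpha> * of_nat (d i) * u d) = 2 * \<alpha> * of_nat (\<Sum>i<N. d i) * u d"
    by (simp only: of_nat_sum sum_distrib_left sum_distrib_right)
  also have "(\<Sum>i<N. \<Sum>j\<in>{..<N}-{i}. u d) = of_nat (N * (N - 1)) * u d"
  proof -
    have "(\<Sum>j\<in>{..<N}-{i}. u d) = of_nat (N - 1) * u d" if "i \<in> {..<N}" for i
      using that by (simp add: card_Diff_singleton)
    then show ?thesis by (cases N) (simp_all add: distrib_right)
  qed
  finally show ?thesis unfolding d_def[symmetric] by (simp add: algebra_simps)
qed

text \<open>The operator preserves multiples of x_1 ... x_N. A transfer avoiding l keeps the zero
  exponent; for one involving l the ranges leave only a = 0, which has weight 0.\<close>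

lemma raising_shift_zero:
  fixes u :: "(nat \<Rightarrow> nat) \<Rightarrow> qb" and N :: nat
  defines "v \<equiv> \<lambda>e. if \<forall>i<N. 1 \<le> e i then u (\<lambda>i. e i - 1) else 0"
  assumes l: "l < N" "e l = 0"
  shows "raising N v e = 0"
proof -
  have v0: "v e' = 0" if "i < N" "e' i = 0" for e' i
  proof -
    have "\<not> (\<forall>i<N. 1 \<le> e' i)" using that by (metis not_one_le_zero)
    then show ?thesis unfolding v_def by (rule if_not_P)
  qed
  have tr: "of_nat a * v (transfer e i j a) = 0" if ij: "i < N" "j < N" "i \<noteq> j"
    and a: "max (e i) (e j) < a \<and> a \<le> e i + e j \<or> a \<le> min (e i) (e j)" for i j a
  proof (cases "l = i \<or> l = j")
    case True
    then have "a = 0" using a l by auto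
    then show ?thesis by simp
  next
    case False
    then have "transfer e i j a l = 0" using l by (simp add: transfer_def)
    then show ?thesis using v0[OF l(1)] by simp
  qed
  show ?thesis
    unfolding raising_def
  proof (rule sum.neutral, rule ballI)
    fix i assume i: "i \<in> {..<N}"
    have "exchange (\<lambda>a e. of_nat a * v e) e i j = 0" if "j \<in> {..<N} - {i}" for j
      by (rule exchange_eq_0, rule tr) (use i that in auto)
    then have "(\<Sum>j\<in>{..<N}-{i}. exchange (\<lambda>a e. of_nat a * v e) e i j) = 0"
      by (rule sum.neutral[OF ballI])
    then show "\<alpha> * (of_nat (e i) - 1) * (of_nat (e i) * v e)
        + (\<Sum>j\<in>{..<N}-{i}. exchange (\<lambda>a e. of_nat a * v e) e i j) = 0"
      using v0[of l e] l by simp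
  qed
qed

lemma partitions_0: "partitions 0 = {{#}}"
proof -
  have "\<mu> = {#}" if "is_partition \<mu>" "sum_mset \<mu> = 0" for \<mu>
    using that by (cases \<mu>) (auto simp: is_partition_def)
  then show ?thesis by (auto simp: partitions_def is_partition_def)
qed

context jack_family
begin

lemma lower_contents:
  assumes lam: "is_partition lam" "sum_mset lam = Suc n"
  obtains r where "\<And>\<phi>. pr lam (lower \<phi>) = (\<Sum>\<nu>\<in>partitions n. r \<nu> * pr \<nu> \<phi>)"
    "\<And>\<nu>. \<nu> \<in> partitions n \<Longrightarrow> r \<nu> \<noteq> 0 \<Longrightarrow>
      contents lam = add_mset (content_sum lam - content_sum \<nu>) (contents \<nu>)"
proof -
  obtain r where r: "\<And>\<phi>. pr lam (lower \<phi>) = (\<Sum>\<nu>\<in>partitions n. r \<nu> * pr \<nu> \<phi>)"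
    using lower_expansion[OF lam] by blast
  have "contents lam = add_mset (content_sum lam - content_sum \<nu>) (contents \<nu>)"
    if \<nu>: "\<nu> \<in> partitions n" "r \<nu> \<noteq> 0" for \<nu>
  proof (rule contents_lower[OF lam(1)])
    show "is_partition \<nu>" "sum_mset lam = Suc (sum_mset \<nu>)" using \<nu>(1) lam(2) by (auto simp: partitions_def)
    show "tcoeff lam k = tcoeff \<nu> k + (content_sum lam - content_sum \<nu>) ^ k +
      (\<Sum>i<k. beta \<nu> (content_sum lam - content_sum \<nu>) i * (content_sum lam - content_sum \<nu>) ^ (k - 1 - i))" for k
      by (rule tcoeff_lower[OF lam(1) r \<nu> refl])
  qed
  with r show thesis by (rule that)
qed

lemma pr_Tk_0: "is_partition lam \<Longrightarrow> pr lam (Tk 0 \<phi>) = of_nat (sum_mset lam) * pr lam \<phi>"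
  unfolding pr_def pairing_cmult[symmetric] by (rule pairing_cong) (simp add: Tk_0 partitions_def)

text \<open>T_0 is multiplication by the degree, and on this form it is N p_1^* plus the first
  commutator, so J_\<nu> enters with r \<nu> (N + c). By induction N + c completes the content
  product of \<nu> to that of \<lambda>; what remains is the same expansion for
  \<open>top_form\<close>.\<close>

lemma pr_power_form:
  assumes "is_partition lam"
  shows "pr lam (power_form N) = pr lam top_form * (\<Prod>c\<in>#contents lam. of_nat N + c)"
  using assms
proof (induction "sum_mset lam" arbitrary: lam)
  case 0
  then have "lam = {#}" by (cases lam) (auto simp: is_partition_def)
  moreover have "agree 0 (power_form N) top_form"
    by (simp add: agree_def partitions_0 power_form_def top_form_def)
  ultimately show ?case
    using pr_agree[of "{#}" "power_form N" top_form] size_contents[of "{#}"] by simp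
next
  case (Suc n)
  obtain r where r: "\<And>\<phi>. pr lam (lower \<phi>) = (\<Sum>\<nu>\<in>partitions n. r \<nu> * pr \<nu> \<phi>)"
    and cont: "\<And>\<nu>. \<nu> \<in> partitions n \<Longrightarrow> r \<nu> \<noteq> 0 \<Longrightarrow>
      contents lam = add_mset (content_sum lam - content_sum \<nu>) (contents \<nu>)"
    using lower_contents[OF Suc.prems Suc.hyps(2)[symmetric]] by blast
  let ?c = "\<lambda>\<nu>. content_sum lam - content_sum \<nu>" and ?P = "\<lambda>lam. \<Prod>c\<in>#contents lam. of_nat N + c"
  have "of_nat (Suc n) * pr lam (power_form N) = of_nat N * pr lam (Rk 0 (power_form N)) + pr lam (Rk 1 (power_form N))"
    unfolding Suc.hyps(2) pr_Tk_0[OF Suc.prems, symmetric] Tk_power_form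
    unfolding pr_def pairing_add pairing_cmult ..
  also have "\<dots> = (\<Sum>\<nu>\<in>partitions n. r \<nu> * (of_nat N + ?c \<nu>) * pr \<nu> (power_form N))"
    unfolding pr_Rk[OF Suc.prems r] sum_distrib_left sum.distrib[symmetric]
    by (intro sum.cong refl) (simp add: algebra_simps)
  also have "\<dots> = (\<Sum>\<nu>\<in>partitions n. r \<nu> * pr \<nu> top_form * ?P lam)"
  proof (rule sum.cong[OF refl])
    fix \<nu> assume \<nu>: "\<nu> \<in> partitions n"
    then have IH: "pr \<nu> (power_form N) = pr \<nu> top_form * ?P \<nu>"
      by (intro Suc.hyps(1)) (auto simp: partitions_def)
    show "r \<nu> * (of_nat N + ?c \<nu>) * pr \<nu> (power_form N) = r \<nu> * pr \<nu> top_form * ?P lam"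
    proof (cases "r \<nu> = 0")
      case False
      show ?thesis unfolding IH cont[OF \<nu> False] by simp
    qed simp
  qed
  also have "\<dots> = pr lam (Tk 0 top_form) * ?P lam"
    unfolding Rk_top_form[symmetric] r sum_distrib_right ..
  finally show ?case
    unfolding pr_Tk_0[OF Suc.prems] Suc.hyps(2)[symmetric] by (simp del: of_nat_Suc)
qed

text \<open>In exactly as many variables as \<lambda> has parts, J_\<lambda> is proportional to x_1
  ... x_N times the Jack function of the stripped partition. Both are eigenfunctions of
  \<open>raising\<close> with one eigenvalue, and their difference \<open>w\<close>, scaled to
  cancel at \<lambda>, has no coefficient at the weight of \<lambda>.\<close>

lemma pr_mono_coeff_strip:
  assumes lam: "is_partition lam" and deg: "sum e {..<size lam} = sum_mset lam"
  defines "N \<equiv> size lam"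
  shows "hook_b (strip_column lam) * pr lam (mono_coeff N e) =
    hook_b lam * (if \<forall>i<N. 1 \<le> e i then pr (strip_column lam) (mono_coeff N (\<lambda>i. e i - 1)) else 0)"
proof -
  let ?lam = "strip_column lam"
  have lam': "is_partition ?lam" by (simp add: strip_column_def)
  define u where "u e = pr ?lam (mono_coeff N e)" for e
  define v where "v e = (if \<forall>i<N. 1 \<le> e i then u (\<lambda>i. e i - 1) else 0)" for e
  define w where "w e = hook_b ?lam * pr lam (mono_coeff N e) - hook_b lam * v e" for e
  have u_inv: "u e = u e'" if "shape N e = shape N e'" for e e'
    using mono_coeff_shape[OF that] by (simp add: u_def)
  have shape_Suc: "shape N e = image_mset Suc (shape N (\<lambda>i. e i - 1))"
    and shape_pred: "shape N (\<lambda>i. e i - 1) = image_mset (\<lambda>x. x - 1) (shape N e)" if "\<forall>i<N. 1 \<le> e i" for e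
    using that by (auto simp: shape_def image_mset.compositionality comp_def intro!: image_mset_cong)
  have pos_iff: "(\<forall>i<N. 1 \<le> e i) \<longleftrightarrow> 0 \<notin># shape N e" for e
    by (auto simp: shape_def Suc_le_eq intro!: gr0I)
  have v_inv: "v e = v e'" if "shape N e = shape N e'" for e e'
  proof (cases "\<forall>i<N. 1 \<le> e i")
    case True
    then have "\<forall>i<N. 1 \<le> e' i" unfolding pos_iff that .
    with True show ?thesis
      unfolding v_def using u_inv[of "\<lambda>i. e i - 1" "\<lambda>i. e' i - 1"] shape_pred[OF True] shape_pred that by simp
  next
    case False
    then have "\<not> (\<forall>i<N. 1 \<le> e' i)" unfolding pos_iff that .
    with False show ?thesis unfolding v_def by (simp only: if_False)
  qed
  have w_inv: "w e = w e'" if "shape N e = shape N e'" for e e'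
    unfolding w_def using v_inv[OF that] mono_coeff_shape[OF that] by simp
  obtain e0 where e0: "positive_parts (shape N e0) = lam"
    using exists_shape[OF lam, of N] by (auto simp: N_def)
  have shape_lam: "shape N e = lam" if "positive_parts (shape N e) = lam" for e
  proof -
    have "size (shape N e) = size (positive_parts (shape N e))" 
      unfolding that by (simp add: shape_def N_def)
    moreover have "size A = size (positive_parts A) \<longrightarrow> positive_parts A = A" for A
    proof (induction A)
      case (add x A)
      have "size (positive_parts A) \<le> size A" by (simp add: positive_parts_def size_filter_mset_lesseq)
      with add show ?case by auto
    qed simp
    ultimately show ?thesis using that by metis
  qed
  have pos0: "\<forall>i<N. 1 \<le> e i" if "shape N e = lam" for e
    unfolding pos_iff that using lam by (simp add: is_partition_def)
  have strip: "positive_parts (shape N (\<lambda>i. e i - 1)) = ?lam" if "shape N e = lam" for e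
    unfolding shape_pred[OF pos0[OF that]] that strip_column_def ..
  define d0 where "d0 = (\<lambda>i. e0 i - 1)"
  have sums: "sum e {..<N} = (\<Sum>i<N. e i - 1) + N" if "\<forall>i<N. 1 \<le> e i" for e
  proof -
    have "sum e {..<N} = (\<Sum>i<N. (e i - 1) + 1)" by (rule sum.cong) (use that in auto)
    then show ?thesis by (simp only: sum.distrib) simp
  qed
  \<comment> \<open>The change of eigenvalue is the scalar of \<open>raising_shift\<close> at the
    degree of the stripped partition.\<close>
  have cs: "2 * content_sum lam = 2 * content_sum ?lam + 2 * \<alpha> * of_nat (sum_mset ?lam) - of_nat (N * (N - 1))"
  proof -
    have ov: "overlap N e0 = overlap N d0 + N * (N - 1)"
    proof -
      have "(\<Sum>j\<in>{..<N}-{i}. min (e0 i) (e0 j)) = (\<Sum>j\<in>{..<N}-{i}. min (d0 i) (d0 j)) + (N - 1)" if i: "i < N" for i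
      proof -
        have "min (e0 i) (e0 j) = min (d0 i) (d0 j) + 1" if "j \<in> {..<N} - {i}" for j
          using pos0[OF shape_lam[OF e0]] i that by (auto simp: d0_def min_def)
        then have "(\<Sum>j\<in>{..<N}-{i}. min (e0 i) (e0 j)) = (\<Sum>j\<in>{..<N}-{i}. min (d0 i) (d0 j) + 1)"
          by (intro sum.cong) auto
        then show ?thesis using i by (simp only: sum.distrib) (simp add: card_Diff_singleton)
      qed
      then have "overlap N e0 = (\<Sum>i<N. (\<Sum>j\<in>{..<N}-{i}. min (d0 i) (d0 j)) + (N - 1))"
        unfolding overlap_def by (intro sum.cong) auto
      then show ?thesis unfolding overlap_def by (simp only: sum.distrib) simp
    qed
    have 1: "2 * content_sum ?lam = \<alpha> * of_nat (weight ?lam) - of_nat (overlap N d0)"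
      using strip[OF shape_lam[OF e0]] unfolding d0_def[symmetric] by (rule content_sum_weight[OF lam'])
    have 2: "of_nat (weight lam) = (of_nat (weight ?lam) + 2 * of_nat (sum_mset ?lam) :: qb)"
      unfolding weight_strip_column[OF lam] by (simp only: of_nat_add of_nat_mult of_nat_numeral)
    show ?thesis
      unfolding content_sum_weight[OF lam e0] 1 ov 2 of_nat_add by algebra
  qed
  have raising_u: "raising N u e = 2 * content_sum ?lam * u e" for e
    using pr_T1[OF lam', of "mono_coeff N e"] unfolding pr_def u_def pairing_T1_mono_coeff .
  have raising_v: "raising N v e = 2 * content_sum lam * v e" if e: "sum e {..<N} = sum_mset lam" for e
  proof (cases "\<forall>i<N. 1 \<le> e i")
    case True
    have deg': "(\<Sum>i<N. e i - 1) = sum_mset ?lam"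
      using sums[OF True] e sum_strip_column[OF lam] by (simp add: N_def)
    have "raising N v e = raising N u (\<lambda>i. e i - 1)
      + (2 * \<alpha> * of_nat (\<Sum>i<N. e i - 1) - of_nat (N * (N - 1))) * u (\<lambda>i. e i - 1)"
      unfolding v_def[abs_def] by (rule raising_shift[OF u_inv True])
    moreover have "v e = u (\<lambda>i. e i - 1)" unfolding v_def by (rule if_P[OF True])
    ultimately show ?thesis
      unfolding raising_u deg' cs by (simp add: algebra_simps)
  next
    case False
    then obtain l where l: "l < N" "e l = 0" by auto
    have "raising N v e = 0" unfolding v_def[abs_def] by (rule raising_shift_zero[of l N e, OF l])
    moreover have "v e = 0" unfolding v_def by (rule if_not_P[OF False])
    ultimately show ?thesis by simp
  qed
  have raising_lam: "raising N (\<lambda>e. pr lam (mono_coeff N e)) e = 2 * content_sum lam * pr lam (mono_coeff N e)" for e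
    using pr_T1[OF lam, of "mono_coeff N e"] unfolding pr_def pairing_T1_mono_coeff .
  have raising_lin: "raising N w e = hook_b ?lam * raising N (\<lambda>e. pr lam (mono_coeff N e)) e - hook_b lam * raising N v e" for e
    unfolding raising_def exchange_def w_def sum_distrib_left sum_subtractf[symmetric]
    by (intro sum.cong refl) (simp add: algebra_simps sum_subtractf sum.distrib sum_distrib_left)
  have "w e = 0"
  proof (rule raising_eigenvector_zero[of N w "sum_mset lam" "weight lam" "overlap N e0" e, OF w_inv])
    fix e assume e: "sum e {..<N} = sum_mset lam"
    show "raising N w e = (\<alpha> * of_nat (weight lam) - of_nat (overlap N e0)) * w e"
      unfolding raising_lin raising_lam raising_v[OF e] content_sum_weight[OF lam e0, symmetric] w_def
      by (simp add: algebra_simps)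
    assume "w e \<noteq> 0"
    show "weight (shape N e) \<noteq> weight lam"
    proof
      assume wt: "weight (shape N e) = weight lam"
      show False
      proof (cases "positive_parts (shape N e) = lam")
        case True
        have "pr lam (mono_coeff N e) = hook_b lam" by (rule pr_mono_coeff[OF lam True])
        moreover have "v e = hook_b ?lam"
          unfolding v_def if_P[OF pos0[OF shape_lam[OF True]]] u_def
          by (rule pr_mono_coeff[OF lam' strip[OF shape_lam[OF True]]])
        ultimately show False using \<open>w e \<noteq> 0\<close> by (simp add: w_def mult.commute)
      next
        case False
        \<comment> \<open>Now v e would be nonzero, so \<open>?d\<close> carries a term of the
          stripped Jack function with the weight of its leading shape. It then has that shape, and e
          has the shape of \<lambda>, a contradiction.\<close>
        then have "pr lam (mono_coeff N e) = 0"
          using pr_mono_coeff_support(2)[OF lam e] wt by auto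
        with \<open>w e \<noteq> 0\<close> have "v e \<noteq> 0" by (auto simp: w_def)
        then have pos: "\<forall>i<N. 1 \<le> e i" unfolding v_def by presburger
        let ?d = "\<lambda>i. e i - 1"
        have deg': "sum ?d {..<N} = sum_mset ?lam"
          using sums[OF pos] e sum_strip_column[OF lam] by (simp add: N_def)
        have "weight (shape N e) = weight (shape N ?d) + 2 * sum_mset (shape N ?d)"
        proof -
          have "Suc t * t = t * (t - 1) + 2 * t" for t by (cases t) simp_all
          then have "weight (image_mset Suc A) = weight A + 2 * sum_mset A" for A
            by (induction A) (simp_all add: weight_def)
          then show ?thesis by (subst shape_Suc[OF pos])
        qed
        then have "weight (shape N ?d) = weight ?lam"
          using wt weight_strip_column[OF lam] deg' by (simp add: sum_mset_shape)
        moreover have "pr ?lam (mono_coeff N ?d) \<noteq> 0"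
          using \<open>v e \<noteq> 0\<close> unfolding v_def if_P[OF pos] u_def .
        ultimately have "positive_parts (shape N ?d) = ?lam"
          using pr_mono_coeff_support(2)[OF lam' deg'] by auto
        then have "positive_parts (shape N ?d) = positive_parts (shape N d0)"
          using strip[OF shape_lam[OF e0]] by (simp add: d0_def)
        then have "shape N ?d = shape N d0" by (rule shape_eq_if_positive_parts_eq)
        then have "shape N e = shape N e0"
          unfolding d0_def using shape_Suc[OF pos] shape_Suc[OF pos0[OF shape_lam[OF e0]]] by simp
        with e0 False show False by simp
      qed
    qed
  next
    show "sum e {..<N} = sum_mset lam" unfolding N_def by (rule deg)
  qed
  then show ?thesis unfolding w_def v_def u_def by simp
qed

lemma hook_power_form:
  assumes lam: "is_partition lam"
  shows "hook_b (strip_column lam) * pr lam (power_form (size lam)) =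
    hook_b lam * pr (strip_column lam) (power_form (size lam))"
proof -
  let ?lam = "strip_column lam" and ?N = "size lam"
  have power: "pr \<nu> (power_form N) = (\<Sum>e\<in>exponent_set N (sum_mset \<nu>). pr \<nu> (mono_coeff N e))" for \<nu> N
    unfolding pr_def pairing_sum[symmetric]
  proof (rule pairing_cong)
    fix \<mu> assume "\<mu> \<in> partitions (sum_mset \<nu>)"
    then have "sum_mset \<mu> = sum_mset \<nu>" by (simp add: partitions_def)
    then show "power_form N \<mu> = (\<Sum>e\<in>exponent_set N (sum_mset \<nu>). mono_coeff N e \<mu>)"
      using sum_mono_coeff[of N \<mu>] by simp
  qed
  let ?X = "exponent_set ?N (sum_mset lam)" and ?Y = "exponent_set ?N (sum_mset ?lam)"
  let ?u = "\<lambda>e. pr ?lam (mono_coeff ?N e)"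
  have "hook_b ?lam * pr lam (power_form ?N) =
      (\<Sum>e\<in>?X. hook_b lam * (if \<forall>i<?N. 1 \<le> e i then ?u (\<lambda>i. e i - 1) else 0))"
    unfolding power sum_distrib_left
    by (rule sum.cong[OF refl], rule pr_mono_coeff_strip[OF lam]) (simp add: exponent_set_def)
  also have "\<dots> = hook_b lam * (\<Sum>e\<in>?X. if \<forall>i<?N. 1 \<le> e i then ?u (\<lambda>i. e i - 1) else 0)"
    by (rule sum_distrib_left[symmetric])
  also have "(\<Sum>e\<in>?X. if \<forall>i<?N. 1 \<le> e i then ?u (\<lambda>i. e i - 1) else 0)
      = (\<Sum>e\<in>{e \<in> ?X. \<forall>i<?N. 1 \<le> e i}. ?u (\<lambda>i. e i - 1))"
    by (rule sum.inter_filter[symmetric]) (rule finite_exponent_set)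
  also have "\<dots> = (\<Sum>e\<in>?Y. ?u e)"
  proof (rule sum.reindex_bij_witness[of _ "\<lambda>e i. if i < ?N then e i + 1 else 0" "\<lambda>e i. e i - 1"])
    fix e assume e: "e \<in> {e \<in> ?X. \<forall>i<?N. 1 \<le> e i}"
    then have "sum e {..<?N} = (\<Sum>i<?N. (e i - 1) + 1)" by (intro sum.cong) auto
    then have "sum e {..<?N} = (\<Sum>i<?N. e i - 1) + ?N" by (simp only: sum.distrib) simp
    then show "(\<lambda>i. e i - 1) \<in> ?Y"
      using e sum_strip_column[OF lam] by (simp add: exponent_set_def)
    show "(\<lambda>i. if i < ?N then e i - 1 + 1 else 0) = e"
      using e by (auto simp: exponent_set_def fun_eq_iff)
  next
    fix e assume e: "e \<in> ?Y"
    show "(\<lambda>i. (if i < ?N then e i + 1 else 0) - 1) = e"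
      using e by (auto simp: exponent_set_def fun_eq_iff)
    have "(\<Sum>i<?N. if i < ?N then e i + 1 else 0) = (\<Sum>i<?N. e i + 1)" by (rule sum.cong) auto
    also have "\<dots> = sum e {..<?N} + ?N" by (simp only: sum.distrib) simp
    finally show "(\<lambda>i. if i < ?N then e i + 1 else 0) \<in> {e \<in> ?X. \<forall>i<?N. 1 \<le> e i}"
      using e sum_strip_column[OF lam] by (simp add: exponent_set_def)
  qed simp
  also have "(\<Sum>e\<in>?Y. ?u e) = pr ?lam (power_form ?N)" unfolding power ..
  finally show ?thesis .
qed

lemma pr_top_form: "is_partition lam \<Longrightarrow> pr lam top_form = 1"
proof (induction "sum_mset lam" arbitrary: lam rule: less_induct)
  case less
  show ?case
  proof (cases "lam = {#}")
    case True
    have "pr {#} (mono_coeff 0 (\<lambda>_. 0)) = hook_b {#}"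
      by (rule pr_mono_coeff) (simp_all add: is_partition_def shape_def)
    moreover have "boxes {#} = {}" by (auto simp: boxes_def)
    then have "hook_b {#} = 1" by (simp add: hook_b_def)
    moreover have "agree 0 top_form (mono_coeff 0 (\<lambda>_. 0))"
      by (simp add: agree_def partitions_0 mono_coeff_empty top_form_def)
    ultimately show ?thesis
      using True pr_agree[of "{#}" top_form "mono_coeff 0 (\<lambda>_. 0)"] by simp
  next
    case False
    let ?lam = "strip_column lam"
    let ?K = "\<lambda>lam'. \<Prod>c\<in>#contents lam'. of_nat (size lam) + c"
    let ?H = "\<Prod>x=1..size lam. \<alpha> * of_nat (part lam x - 1) + of_nat (size lam - x) + 1"
    have lam': "is_partition ?lam" by (simp add: strip_column_def)
    have "sum_mset ?lam < sum_mset lam"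
      using sum_strip_column[OF less.prems] False by (simp add: nonempty_has_size)
    then have E': "pr ?lam top_form = 1" using lam' by (rule less.hyps)
    have "hook_b ?lam * (pr lam top_form * ?K lam) = hook_b lam * ?K ?lam"
      using hook_power_form[OF less.prems] pr_power_form[OF less.prems, of "size lam"] pr_power_form[OF lam', of "size lam"]
      by (simp add: E')
    also have "\<dots> = hook_b ?lam * ?K lam"
      using hook_b_strip_column[OF less.prems] content_prod_strip_column[OF less.prems] by (simp add: mult_ac)
    finally show ?thesis using hook_b_nonzero content_prod_nonzero[of lam] by simp
  qed
qed

end

section \<open>Complete homogeneous functions of the contents\<close>

lemma complete_homogeneous_0: "complete_homogeneous 0 I c = 1"
proof -
  have "{M. set_mset M \<subseteq> I \<and> size M = 0} = {{#}}" by auto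
  then show ?thesis by (simp add: complete_homogeneous_def)
qed

lemma finite_multisets: "finite I \<Longrightarrow> finite {M. set_mset M \<subseteq> I \<and> size M = k}"
  using finite_multisets_of_size[of I k] by (simp add: multisets_of_size_def)

lemma complete_homogeneous_insert:
  assumes "finite I" "i \<notin> I"
  shows "complete_homogeneous (Suc k) (insert i I) c =
    complete_homogeneous (Suc k) I c + c i * complete_homogeneous k (insert i I) c"
proof -
  let ?A = "{M. set_mset M \<subseteq> I \<and> size M = Suc k}" and ?B = "{M. set_mset M \<subseteq> insert i I \<and> size M = k}"
  have split: "{M. set_mset M \<subseteq> insert i I \<and> size M = Suc k} = ?A \<union> add_mset i ` ?B"
  proof (intro equalityI subsetI)
    fix M assume M: "M \<in> {M. set_mset M \<subseteq> insert i I \<and> size M = Suc k}"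
    show "M \<in> ?A \<union> add_mset i ` ?B"
    proof (cases "i \<in># M")
      case True
      then obtain M' where "M = add_mset i M'" by (rule mset_add)
      with M show ?thesis by auto
    next
      case False
      with M show ?thesis by auto
    qed
  qed auto
  have "(\<Sum>M\<in>?A \<union> add_mset i ` ?B. \<Prod>i\<in>#M. c i) = (\<Sum>M\<in>?A. \<Prod>i\<in>#M. c i) + (\<Sum>M\<in>add_mset i ` ?B. \<Prod>i\<in>#M. c i)"
    by (rule sum.union_disjoint) (use assms in \<open>auto intro: finite_multisets\<close>)
  also have "(\<Sum>M\<in>add_mset i ` ?B. \<Prod>i\<in>#M. c i) = c i * (\<Sum>M\<in>?B. \<Prod>i\<in>#M. c i)"
    by (subst sum.reindex) (auto simp: inj_on_def sum_distrib_left)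
  finally show ?thesis unfolding complete_homogeneous_def split .
qed

lemma complete_homogeneous_series:
  fixes c :: "'i \<Rightarrow> 'a::comm_ring_1"
  assumes "finite I"
  shows "Abs_fps (\<lambda>k. complete_homogeneous k I c) * (\<Prod>i\<in>I. lin (c i)) = 1"
  using assms
proof (induction I rule: finite_induct)
  case empty
  have "complete_homogeneous k {} c = (if k = 0 then 1 else 0)" for k
  proof (cases k)
    case (Suc k')
    have *: "{M :: 'i multiset. set_mset M \<subseteq> {} \<and> size M = Suc k'} = {}" by auto
    show ?thesis unfolding complete_homogeneous_def Suc * by simp
  qed (simp add: complete_homogeneous_0)
  then have "Abs_fps (\<lambda>k. complete_homogeneous k {} c) = 1" by (intro fps_ext) simp
  then show ?case by simp
next
  case (insert i I)
  let ?F = "Abs_fps (\<lambda>k. complete_homogeneous k (insert i I) c)"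
  have "?F * lin (c i) = ?F - fps_const (c i) * (fps_X * ?F)"
    by (simp add: lin_def algebra_simps)
  also have "\<dots> = Abs_fps (\<lambda>k. complete_homogeneous k I c)"
  proof (rule fps_ext)
    fix k
    show "fps_nth (?F - fps_const (c i) * (fps_X * ?F)) k = fps_nth (Abs_fps (\<lambda>k. complete_homogeneous k I c)) k"
      by (cases k) (simp_all add: complete_homogeneous_0 complete_homogeneous_insert[OF insert.hyps(1,2)])
  qed
  finally have "?F * lin (c i) = Abs_fps (\<lambda>k. complete_homogeneous k I c)" .
  with insert show ?case by (simp add: mult.assoc[symmetric])
qed

text \<open>The generating series satisfy H_\<lambda> (1 - cX) = H_\<nu>.\<close>

lemma complete_homogeneous_contents:
  assumes "contents lam = add_mset c (contents \<nu>)"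
  shows "complete_homogeneous k (boxes lam) b_content =
    (\<Sum>i\<le>k. c ^ i * complete_homogeneous (k - i) (boxes \<nu>) b_content)"
proof -
  let ?H = "\<lambda>lam. Abs_fps (\<lambda>k. complete_homogeneous k (boxes lam) b_content)"
  have H: "?H lam * (\<Prod>c\<in>#contents lam. lin c) = 1" for lam
    unfolding prod_contents by (rule complete_homogeneous_series) simp
  let ?P = "\<Prod>c\<in>#contents \<nu>. lin c"
  have "?P * (?H lam * lin c) = ?P * ?H \<nu>"
    using H[of lam] H[of \<nu>] unfolding assms by (simp add: mult_ac)
  moreover have "?P \<noteq> 0" using H[of \<nu>] by (metis mult_zero_right zero_neq_one)
  ultimately have "?H lam * lin c = ?H \<nu>" by simp
  moreover have "?H lam = (?H lam * lin c) * Abs_fps (\<lambda>k. c ^ k)"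
    unfolding mult.assoc geometric_fps by simp
  ultimately have "?H lam = Abs_fps (\<lambda>k. c ^ k) * ?H \<nu>"
    by (simp only: mult.commute)
  from arg_cong[OF this, of "\<lambda>f. fps_nth f k"] show ?thesis
    by (simp add: fps_mult_nth atLeast0AtMost)
qed


section \<open>The recursion\<close>

context jack_family
begin

text \<open>The Jack functions span degree n, so they separate linear forms.\<close>

lemma form_zero:
  assumes "\<And>lam. lam \<in> partitions n \<Longrightarrow> pr lam \<phi> = 0" and "\<mu> \<in> partitions n"
  shows "\<phi> \<mu> = 0"
proof -
  obtain x where x: "\<And>\<phi>. pairing n (\<lambda>\<nu>. if \<nu> = \<mu> then 1 else 0) \<phi> = (\<Sum>\<nu>\<in>partitions n. x \<nu> * pr \<nu> \<phi>)"
    using jack_span by blast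
  have "\<phi> \<mu> = pairing n (\<lambda>\<nu>. if \<nu> = \<mu> then 1 else 0) \<phi>"
    using assms(2) by (simp add: pairing_def if_distrib[of "\<lambda>x. _ * x"] cong: if_cong)
  also have "\<dots> = 0" unfolding x using assms(1) by (simp add: sum.neutral)
  finally show ?thesis .
qed

lemma Theta_h_coefficients:
  assumes a: "\<And>k lam. is_partition lam \<Longrightarrow> pr lam (a k) = complete_homogeneous k (boxes lam) b_content"
    and \<kappa>: "is_partition \<kappa>"
  shows "Theta (a k) m \<kappa> = (\<Sum>i\<le>k. (Lax ^^ i) (Eps (a (k - i))) m \<kappa>)"
proof -
  define n where "n = sum_mset \<kappa> + m"
  let ?h = "\<lambda>k lam. complete_homogeneous k (boxes lam) b_content"
  define \<psi> where "\<psi> = (\<lambda>m \<mu>. Theta (a k) m \<mu> + - 1 * (\<Sum>i\<le>k. (Lax ^^ i) (Eps (a (k - i))) m \<mu>))"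
  have N: "Nabla ((Lax ^^ j) \<psi>) = (\<lambda>\<mu>. Tk j (a k) \<mu> + - 1 * (\<Sum>i\<le>k. Rk (i + j) (a (k - i)) \<mu>))" for j
  proof (rule ext)
    fix \<mu>
    have "(Lax ^^ j) ((Lax ^^ i) \<chi>) = (Lax ^^ (i + j)) \<chi>" for i \<chi>
      by (subst add.commute) (simp only: funpow_add comp_apply)
    then show "Nabla ((Lax ^^ j) \<psi>) \<mu> = Tk j (a k) \<mu> + - 1 * (\<Sum>i\<le>k. Rk (i + j) (a (k - i)) \<mu>)"
      unfolding \<psi>_def Laxpow_add Laxpow_cmult Laxpow_sum Nabla_add Nabla_cmult Nabla_sum
      by (simp add: Tk_def Rk_def)
  qed
  have "\<psi> m \<kappa> = 0"
  proof (rule Nabla_Lax_orbit_zero[OF _ \<kappa>])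
    show "sum_mset \<kappa> + Suc m = Suc n" by (simp add: n_def)
    show "Nabla ((Lax ^^ j) \<psi>) \<mu> = 0" if "\<mu> \<in> partitions (Suc n)" for j \<mu>
    proof (rule form_zero[OF _ that])
      fix lam assume "lam \<in> partitions (Suc n)"
      then have lam: "is_partition lam" "sum_mset lam = Suc n" by (auto simp: partitions_def)
      obtain r where r: "\<And>\<phi>. pr lam (lower \<phi>) = (\<Sum>\<nu>\<in>partitions n. r \<nu> * pr \<nu> \<phi>)"
        and cont: "\<And>\<nu>. \<nu> \<in> partitions n \<Longrightarrow> r \<nu> \<noteq> 0 \<Longrightarrow>
          contents lam = add_mset (content_sum lam - content_sum \<nu>) (contents \<nu>)"
        using lower_contents[OF lam] by blast
      let ?c = "\<lambda>\<nu>. content_sum lam - content_sum \<nu>"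
      have part: "is_partition \<nu>" if "\<nu> \<in> partitions n" for \<nu> using that by (simp add: partitions_def)
      \<comment> \<open>On the coefficient of the power of p_1, which is 1 for every Jack function,
        T_j and \<open>Rk j\<close> agree. This presents the eigenvalue of T_j as the j-th moment of
        the r \<nu>.\<close>
      have t: "tcoeff lam j = (\<Sum>\<nu>\<in>partitions n. r \<nu> * ?c \<nu> ^ j)"
      proof -
        have "tcoeff lam j = pr lam (Rk j top_form)"
          unfolding Rk_top_form pr_Tk[OF lam(1)] pr_top_form[OF lam(1)] by simp
        also have "\<dots> = (\<Sum>\<nu>\<in>partitions n. r \<nu> * ?c \<nu> ^ j)"
          unfolding pr_Rk[OF lam(1) r] by (rule sum.cong) (auto simp: pr_top_form part)
        finally show ?thesis .
      qed
      have "(\<Sum>i\<le>k. pr lam (Rk (i + j) (a (k - i)))) = (\<Sum>i\<le>k. \<Sum>\<nu>\<in>partitions n. r \<nu> * ?c \<nu> ^ (i + j) * ?h (k - i) \<nu>)"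
        unfolding pr_Rk[OF lam(1) r] by (intro sum.cong refl) (simp add: a part)
      also have "\<dots> = (\<Sum>\<nu>\<in>partitions n. \<Sum>i\<le>k. r \<nu> * ?c \<nu> ^ (i + j) * ?h (k - i) \<nu>)"
        by (rule sum.swap)
      also have "\<dots> = (\<Sum>\<nu>\<in>partitions n. r \<nu> * ?c \<nu> ^ j * ?h k lam)"
      proof (rule sum.cong[OF refl])
        fix \<nu> assume \<nu>: "\<nu> \<in> partitions n"
        show "(\<Sum>i\<le>k. r \<nu> * ?c \<nu> ^ (i + j) * ?h (k - i) \<nu>) = r \<nu> * ?c \<nu> ^ j * ?h k lam"
        proof (cases "r \<nu> = 0")
          case False
          show ?thesis
            unfolding complete_homogeneous_contents[OF cont[OF \<nu> False]] sum_distrib_left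
            by (intro sum.cong refl) (simp add: power_add mult_ac)
        qed simp
      qed
      also have "\<dots> = pr lam (Tk j (a k))"
        unfolding pr_Tk[OF lam(1)] t a[OF lam(1)] sum_distrib_right ..
      finally show "pr lam (Nabla ((Lax ^^ j) \<psi>)) = 0"
        unfolding N pr_def pairing_add pairing_cmult pairing_sum by simp
    qed
  qed
  then show ?thesis by (simp add: \<psi>_def)
qed

text \<open>In the expansion at k + 1 the terms with i \<ge> 1 are L applied to the expansion at
  k.\<close>

lemma h_coefficients_recursion:
  assumes a: "\<And>k lam. is_partition lam \<Longrightarrow> pr lam (a k) = complete_homogeneous k (boxes lam) b_content"
    and \<kappa>: "is_partition \<kappa>"
  shows "Theta (a (Suc k)) m \<kappa> = Eps (a (Suc k)) m \<kappa> + Lax (Theta (a k)) m \<kappa>"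
proof -
  have "yagree (sum_mset \<kappa> + Suc m) (Theta (a k)) (\<lambda>m \<mu>. \<Sum>i\<le>k. (Lax ^^ i) (Eps (a (k - i))) m \<mu>)"
    unfolding yagree_def using Theta_h_coefficients[OF a] by blast
  then have "Lax (Theta (a k)) m \<kappa> = Lax (\<lambda>m \<mu>. \<Sum>i\<le>k. (Lax ^^ i) (Eps (a (k - i))) m \<mu>) m \<kappa>"
    by (rule yagreeD[OF Lax_agree \<kappa> refl])
  also have "\<dots> = (\<Sum>i\<le>k. (Lax ^^ Suc i) (Eps (a (k - i))) m \<kappa>)"
    unfolding Lax_sum by simp
  finally have L: "Lax (Theta (a k)) m \<kappa> = (\<Sum>i\<le>k. (Lax ^^ Suc i) (Eps (a (k - i))) m \<kappa>)" .
  have "Theta (a (Suc k)) m \<kappa> = (\<Sum>i\<le>Suc k. (Lax ^^ i) (Eps (a (Suc k - i))) m \<kappa>)"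
    by (rule Theta_h_coefficients[OF a \<kappa>])
  then show ?thesis unfolding L sum.atMost_Suc_shift by simp
qed

end

theorem theorem2p8:
  fixes J :: "nat multiset \<Rightarrow> psym"
    and a :: "nat \<Rightarrow> nat multiset \<Rightarrow> qb"
    and k m :: nat
    and \<rho> :: "nat multiset"
  assumes "\<And>lam. is_partition lam \<Longrightarrow> is_jack lam (J lam)"
    and "h_coefficients J a"
    and "k \<ge> 1"
    and "m \<ge> 1"
    and "is_partition \<rho>"
  shows "a k (\<rho> + {#m#}) =
      (if m = 1 then a k \<rho> else 0)
      + (\<Sum>(r, s) | 1 \<le> r \<and> 1 \<le> s \<and> r + s = m. a (k - 1) (\<rho> + {#r, s#}))
      + (1 + b) * (\<Sum>i = 1..size \<rho>.
          of_nat (part \<rho> i) * a (k - 1) (\<rho> - {#part \<rho> i#} + {#part \<rho> i + m#}))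
      + b * of_nat (m - 1) * a (k - 1) (\<rho> + {#m#})"
proof -
  interpret jack_family J by unfold_locales (rule assms(1))
  have a: "pr lam (a k) = complete_homogeneous k (boxes lam) b_content" if "is_partition lam" for k lam
    using assms(2) that by (simp add: h_coefficients_def jack_character_def pr_def pairing_def)
  obtain k' where k: "k = Suc k'" using assms(3) by (cases k) auto
  obtain m' where m: "m = Suc m'" using assms(4) by (cases m) auto
  \<comment> \<open>The index s in \<open>splitting\<close> stands for the part s + 1, so the pair
    of parts is (m' - s, s + 1), of sum m.\<close>
  have "(\<Sum>(r, s) | 1 \<le> r \<and> 1 \<le> s \<and> r + s = m. a k' (\<rho> + {#r, s#})) = splitting (Theta (a k')) m' \<rho>"
    unfolding splitting_def Theta_def
    by (rule sum.reindex_bij_witness[of _ "\<lambda>s. (m' - s, Suc s)" "\<lambda>(r, s). s - 1"])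
       (auto simp: m add_mset_commute dest!: sym[of "_ + _" "Suc m'"])
  moreover have "(\<Sum>i = 1..size \<rho>. of_nat (part \<rho> i) * a k' (\<rho> - {#part \<rho> i#} + {#part \<rho> i + m#}))
      = joining (Theta (a k')) m' \<rho>"
    unfolding joining_def psum_def Theta_def sum_mset_part[of _ \<rho>] by (simp add: m add.commute)
  ultimately show ?thesis
    using h_coefficients_recursion[OF a assms(5), of k' m'] by (simp add: k m Theta_def Eps_def Lax_def)
qed

end
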